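(* Let $Z=A\cdot[0,1]^n\subseteq\mathbb{R}^d$ be a unimodular zonotope and $L=\operatorname{rowspace}(A)\otimes\mathbb{C}\subseteq\mathbb{C}^n$. The harmonic algebra $\mathcal{H}_Z$ is isomorphic, as a bigraded $\mathbb{C}$-algebra, to the bigraded homogeneous coordinate ring $\mathbb{C}[z_S:S\subseteq[n]]/I(\Phi(Y_L))$ of the image of the arrangement Schubert variety $Y_L$ under the Segre embedding $\Phi:(\mathbb{P}^1)^n\to\mathbb{P}^{2^n-1}$, where $z_S$ has bidegree $(1,|S|)$ and $I(\Phi(Y_L))$ is the homogeneous vanishing ideal.
   Context: A unimodular zonotope is $Z=A\cdot[0,1]^n\subseteq\mathbb{R}^d$ where $A$ is a $d\times n$ integer matrix of rank $d$ all of whose maximal minors lie in $\{-1,0,1\}$. For a finite $\mathcal{Z}\subseteq\mathbb{Z}^d\subseteq\mathbb{C}^d$, $\operatorname{gr}I(\mathcal{Z})\subseteq\mathbb{C}[x_1,\dots,x_d]$ is the ideal generated by top-degree homogeneous components of polynomials vanishing on $\mathcal{Z}$. For a homogeneous ideal $I\subseteq\mathbb{C}[x_1,\dots,x_d]$, the Macaulay inverse system is $I^\perp=\{f: (g(\partial/\partial x_1,\dots,\partial/\partial x_d)f)|_{x=0}=0\text{ for all }g\in I\}$ (equivalently $f(D)g|_{0}=0$), a graded subspace. For a lattice polytope $P$ set $V_P=(\operatorname{gr}I(P\cap\mathbb{Z}^d))^\perp$. The harmonic algebra is $\mathcal{H}_P=\bigoplus_{m\ge0}\mathbb{C}x_0^m\otimes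 V_{mP}\subseteq\mathbb{C}[x_0,x_1,\dots,x_d]$, a subalgebra (multiplication $(x_0^i f)(x_0^j g)=x_0^{i+j}fg$), bigraded with $\deg x_0=(1,0)$ and $\deg x_i=(0,1)$ for $i\ge1$. The arrangement Schubert variety $Y_L$ of a linear subspace $L\subseteq\mathbb{C}^n$ is the closure of the image of $L$ under $\mathbb{C}^n\hookrightarrow(\mathbb{P}^1)^n$, $(a_1,\dots,a_n)\mapsto([a_1:1],\dots,[a_n:1])$. The Segre embedding sends $([a_1:b_1],\dots,[a_n:b_n])$ to $[c_S]_{S\subseteq[n]}$ with $c_S=\prod_{i\in S}a_i\prod_{j\notin S}b_j$; the bigrading $(1,|S|)$ on $z_S$ is preserved by $I(\Phi(Y_L))$ because $Y_L$ is stable under the $\mathbb{C}^*$-action $t\cdot([a_i:b_i])_i=([t^{-1}a_i:b_i])_i$. *)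

theory Defs
  imports "HOL-Analysis.Function_Topology" "HOL-Library.Poly_Mapping"
    "Jordan_Normal_Form.DL_Rank" "Jordan_Normal_Form.DL_Submatrix"
begin

type_synonym 'v mpoly = "('v \<Rightarrow>\<^sub>0 nat) \<Rightarrow>\<^sub>0 complex"

definition mdeg :: "('v \<Rightarrow>\<^sub>0 nat) \<Rightarrow> nat" where
  "mdeg m = (\<Sum>v\<in>Poly_Mapping.keys m. Poly_Mapping.lookup m v)"

definition vars_in :: "'v set \<Rightarrow> 'v mpoly \<Rightarrow> bool" where
  "vars_in V p \<longleftrightarrow> (\<forall>m\<in>Poly_Mapping.keys p. Poly_Mapping.keys m \<subseteq> V)"

definition meval :: "'v mpoly \<Rightarrow> ('v \<Rightarrow> complex) \<Rightarrow> complex" where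
  "meval p x = (\<Sum>m\<in>Poly_Mapping.keys p. Poly_Mapping.lookup p m * (\<Prod>v\<in>Poly_Mapping.keys m. x v ^ Poly_Mapping.lookup m v))"

definition const_poly :: "complex \<Rightarrow> 'v mpoly" where
  "const_poly c = Poly_Mapping.single 0 c"

definition homogeneous :: "nat \<Rightarrow> 'v mpoly \<Rightarrow> bool" where
  "homogeneous k p \<longleftrightarrow> (\<forall>m\<in>Poly_Mapping.keys p. mdeg m = k)"

definition hcomp :: "nat \<Rightarrow> 'v mpoly \<Rightarrow> 'v mpoly" where
  "hcomp k p = (\<Sum>m\<in>{m\<in>Poly_Mapping.keys p. mdeg m = k}. Poly_Mapping.single m (Poly_Mapping.lookup p m))"

definition topcomp :: "'v mpoly \<Rightarrow> 'v mpoly" where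
  "topcomp p = hcomp (Max (mdeg ` Poly_Mapping.keys p)) p"

definition ideal_gen :: "'v set \<Rightarrow> 'v mpoly set \<Rightarrow> 'v mpoly set" where
  "ideal_gen V G = {\<Sum>i<k. h i * g i | (k::nat) h g. \<forall>i<k. g i \<in> G \<and> vars_in V (h i)}"

definition vanishing_ideal :: "'v set \<Rightarrow> ('v \<Rightarrow> complex) set \<Rightarrow> 'v mpoly set" where
  "vanishing_ideal V Z = {p. vars_in V p \<and> (\<forall>z\<in>Z. meval p z = 0)}"

definition gr_ideal :: "'v set \<Rightarrow> ('v \<Rightarrow> complex) set \<Rightarrow> 'v mpoly set" where
  "gr_ideal V Z = ideal_gen V {topcomp p | p. p \<in> vanishing_ideal V Z \<and> p \<noteq> 0}"

definition pderiv_var :: "'v \<Rightarrow> 'v mpoly \<Rightarrow> 'v mpoly" where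
  "pderiv_var v p = (\<Sum>m\<in>Poly_Mapping.keys p.
      Poly_Mapping.single (m - Poly_Mapping.single v 1) (of_nat (Poly_Mapping.lookup m v) * Poly_Mapping.lookup p m))"

definition diff_mono :: "(nat \<Rightarrow>\<^sub>0 nat) \<Rightarrow> nat mpoly \<Rightarrow> nat mpoly" where
  "diff_mono m f = foldr (\<lambda>v. pderiv_var v ^^ Poly_Mapping.lookup m v) (sorted_list_of_set (Poly_Mapping.keys m)) f"

definition diffop :: "nat mpoly \<Rightarrow> nat mpoly \<Rightarrow> nat mpoly" where
  "diffop g f = (\<Sum>m\<in>Poly_Mapping.keys g. const_poly (Poly_Mapping.lookup g m) * diff_mono m f)"

definition inverse_system :: "nat set \<Rightarrow> nat mpoly set \<Rightarrow> nat mpoly set" where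
  "inverse_system V I = {f. vars_in V f \<and> (\<forall>g\<in>I. Poly_Mapping.lookup (diffop g f) 0 = 0)}"

definition unimodular :: "int mat \<Rightarrow> bool" where
  "unimodular A \<longleftrightarrow>
     vec_space.rank (dim_row A) (map_mat real_of_int A) = dim_row A \<and>
     (\<forall>J\<subseteq>{..<dim_col A}. card J = dim_row A \<longrightarrow>
        det (submatrix A UNIV J) \<in> {-1, 0, 1})"

definition dil_zonotope_lattice_points :: "int mat \<Rightarrow> nat \<Rightarrow> (nat \<Rightarrow> int) set" where
  "dil_zonotope_lattice_points A m =
     {z. (\<forall>i\<ge>dim_row A. z i = 0) \<and>
         (\<exists>t::nat \<Rightarrow> real. (\<forall>j<dim_col A. 0 \<le> t j \<and> t j \<le> real m) \<and>
            (\<forall>i<dim_row A. real_of_int (z i) =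
                (\<Sum>j<dim_col A. real_of_int (A $$ (i,j)) * t j)))}"

definition V_dil :: "int mat \<Rightarrow> nat \<Rightarrow> nat mpoly set" where
  "V_dil A m = inverse_system {..<dim_row A}
     (gr_ideal {..<dim_row A} ((\<lambda>z i. complex_of_int (z i)) ` dil_zonotope_lattice_points A m))"

section \<open>Harmonic algebra in C[x_0,...,x_d]: x_0 = None, x_(i+1) = Some i\<close>

definition embed_mono :: "(nat \<Rightarrow>\<^sub>0 nat) \<Rightarrow> (nat option \<Rightarrow>\<^sub>0 nat)" where
  "embed_mono m = (\<Sum>i\<in>Poly_Mapping.keys m. Poly_Mapping.single (Some i) (Poly_Mapping.lookup m i))"

definition embed :: "nat mpoly \<Rightarrow> nat option mpoly" where
  "embed f = (\<Sum>m\<in>Poly_Mapping.keys f. Poly_Mapping.single (embed_mono m) (Poly_Mapping.lookup f m))"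

definition x0pow :: "nat \<Rightarrow> nat option mpoly" where
  "x0pow k = Poly_Mapping.single (Poly_Mapping.single None k) 1"

definition harmonic_algebra :: "int mat \<Rightarrow> nat option mpoly set" where
  "harmonic_algebra A =
     {\<Sum>m<N. x0pow m * embed (f m) | N f. \<forall>m<N. f m \<in> V_dil A m}"

definition bihomog_x :: "nat \<Rightarrow> nat \<Rightarrow> nat option mpoly \<Rightarrow> bool" where
  "bihomog_x a b F \<longleftrightarrow>
     (\<forall>m\<in>Poly_Mapping.keys F. Poly_Mapping.lookup m None = a \<and> (\<Sum>v\<in>Poly_Mapping.keys m - {None}. Poly_Mapping.lookup m v) = b)"

definition bihomog_z :: "nat \<Rightarrow> nat \<Rightarrow> nat set mpoly \<Rightarrow> bool" where
  "bihomog_z a b F \<longleftrightarrow>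
     (\<forall>m\<in>Poly_Mapping.keys F. (\<Sum>S\<in>Poly_Mapping.keys m. Poly_Mapping.lookup m S) = a \<and> (\<Sum>S\<in>Poly_Mapping.keys m. Poly_Mapping.lookup m S * card S) = b)"

text \<open>affine cone over the Segre image of L = rowspace(A) tensor C, using the chart
  a |-> ([a_1:1],...,[a_n:1]); its closure is the affine cone over Phi(Y_L)\<close>
definition segre_cone :: "int mat \<Rightarrow> (nat set \<Rightarrow> complex) set" where
  "segre_cone A =
     {w. \<exists>(c::complex) (y::nat \<Rightarrow> complex). w = (\<lambda>S. if S \<subseteq> {..<dim_col A}
          then c * (\<Prod>j\<in>S. \<Sum>i<dim_row A. y i * complex_of_int (A $$ (i,j))) else 0)}"

definition segre_schubert_ideal :: "int mat \<Rightarrow> nat set mpoly set" where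
  "segre_schubert_ideal A = ideal_gen (Pow {..<dim_col A})
     {F. vars_in (Pow {..<dim_col A}) F \<and> (\<exists>k. homogeneous k F) \<and>
         (\<forall>w\<in>closure (segre_cone A). meval F w = 0)}"

end

theory Submission
  imports Defs "HOL-Library.Function_Algebras" "HOL-Computational_Algebra.Formal_Power_Series"
begin

text \<open>
  The isomorphism sends \<open>z\<^sub>S\<close> to \<open>x\<^sub>0\<close> times the product of the column forms \<open>l\<^sub>j\<close>, \<open>j \<in> S\<close>. Its kernel is
  the ideal of the Segre cone because this is evaluation on a parametrisation of the cone, so
  everything rests on the identification of \<open>V\<^bsub>mZ\<^esub>\<close> with the span of the products of the \<open>l\<^sub>j\<close> in
  which each form occurs at most \<open>m\<close> times.

  Such products lie in \<open>V\<^bsub>mZ\<^esub>\<close> because the product of the finite differences along the columns in \<open>S\<close>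
  only evaluates at lattice points of the zonotope, and acts on the top degree component as the
  product of derivatives. Conversely, an element of \<open>V\<^bsub>mZ\<^esub>\<close> of degree \<open>k\<close> is the leading part of a
  measure \<open>\<mu>\<close> on the lattice points whose moments of order below \<open>k\<close> vanish. Deletion-contraction in
  the group ring of the lattice shows that \<open>\<mu>\<close> is a combination of the products of \<open>exp (a\<^sub>s) - 1\<close>,
  \<open>s \<in> S\<close>, over sets \<open>S\<close> of at least \<open>k\<close> columns: after subtracting a lift of the solution for the
  contraction by \<open>a\<close>, the measure is divisible by \<open>exp a - 1\<close>, and by convexity the quotient lives on
  the zonotope of the deletion. Unimodularity enters only through the pivots, which are all \<open>\<plusminus>1\<close>.
\<close>

text \<open>The induction runs on measures rather than on polynomials because passing to leading
  parts forgets the support, and the support in the zonotope is exactly what deletion and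
  contraction control. Keeping every order \<open>k\<close> in the statement allows the leading
  parts to be read off afterwards: the product of the \<open>exp (a_s) - 1\<close> over
  \<open>S\<close> begins, in degree \<open>card S\<close>, with the product of the forms
  \<open>l_s\<close>.

  The hypothesis bounds only the maximal minors, so the entries of \<open>A\<close> can be large and
  contraction by a coordinate could leave the integers. The columns are therefore rewritten in a
  lattice basis consisting of some of them; there every nonzero entry is a unit, and this persists
  under contraction.

  Dilation is absorbed into the index set: \<open>mZ\<close> is the zonotope in which each column is
  listed \<open>m\<close> times, indexed by pairs \<open>(j, r)\<close> with \<open>r < m\<close>.
  For this reason generators are families over an arbitrary index type. A set of such pairs is the
  same as a sequence of \<open>m\<close> sets of columns, that is, an ordered monomial of degree
  \<open>m\<close> in the \<open>z_S\<close>; this matches products of forms with monomials.\<close>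

abbreviation "keys \<equiv> Poly_Mapping.keys"
abbreviation "lookup \<equiv> Poly_Mapping.lookup"
abbreviation "single \<equiv> Poly_Mapping.single"

section \<open>Linear extension of monoid homomorphisms\<close>

lemma poly_mapping_expand:
  fixes p :: "'m \<Rightarrow>\<^sub>0 'b::comm_monoid_add"
  shows "p = (\<Sum>m\<in>keys p. single m (lookup p m))"
proof (rule poly_mapping_eqI)
  fix k
  have "(\<Sum>m\<in>keys p. lookup (single m (lookup p m)) k) = (\<Sum>m\<in>keys p. if m = k then lookup p k else 0)"
    by (rule sum.cong) (auto simp: lookup_single when_def)
  also have "\<dots> = lookup p k"
    by (auto simp: in_keys_iff)
  finally show "lookup p k = lookup (\<Sum>m\<in>keys p. single m (lookup p m)) k"
    by (simp add: lookup_sum)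
qed

lemma lookup_single_0_mult:
  fixes p :: "'m::comm_monoid_add \<Rightarrow>\<^sub>0 'b::comm_semiring_1"
  shows "lookup (single 0 c * p) m = c * lookup p m"
  by (simp add: mult_map_scale_conv_mult[symmetric] Poly_Mapping.map.rep_eq when_def)

lemma keys_single_0_mult: "keys (single 0 c * p) \<subseteq> keys p"
  for p :: "'m::comm_monoid_add \<Rightarrow>\<^sub>0 'b::comm_semiring_1"
  by (auto simp: in_keys_iff lookup_single_0_mult)

text \<open>One scheme for evaluation, pushforward, transform, \<open>embed\<close> and
  \<open>segre_map\<close>: \<open>s\<close> carries the scalars and \<open>h\<close> the monomials
  into the target ring. Moments and the differentiation pairing respect only addition, hence the two
  locales.\<close>

definition lin :: "(complex \<Rightarrow> 'r::comm_ring_1) \<Rightarrow> ('m \<Rightarrow> 'r) \<Rightarrow> ('m \<Rightarrow>\<^sub>0 complex) \<Rightarrow> 'r" where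
  "lin s h p = (\<Sum>m\<in>keys p. s (lookup p m) * h m)"

locale additive_extension =
  fixes s :: "complex \<Rightarrow> 'r::comm_ring_1" and h :: "'m \<Rightarrow> 'r"
  assumes s_0: "s 0 = 0" and s_add: "s (a + b) = s a + s b"
begin

lemma lin_superset: "finite M \<Longrightarrow> keys p \<subseteq> M \<Longrightarrow> lin s h p = (\<Sum>m\<in>M. s (lookup p m) * h m)"
  unfolding lin_def by (rule sum.mono_neutral_left) (auto simp: in_keys_iff s_0)

lemma lin_zero: "lin s h 0 = 0"
  by (simp add: lin_def)

lemma lin_add: "lin s h (p + q) = lin s h p + lin s h q"
proof -
  have "lin s h (p + q) = (\<Sum>m\<in>keys p \<union> keys q. s (lookup (p + q) m) * h m)"
    by (intro lin_superset) (simp_all add: Poly_Mapping.keys_add)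
  also have "\<dots> = (\<Sum>m\<in>keys p \<union> keys q. s (lookup p m) * h m) + (\<Sum>m\<in>keys p \<union> keys q. s (lookup q m) * h m)"
    by (simp add: lookup_add s_add distrib_right sum.distrib)
  also have "\<dots> = lin s h p + lin s h q"
    by (simp add: lin_superset[of "keys p \<union> keys q"])
  finally show ?thesis .
qed

lemma lin_sum: "lin s h (\<Sum>i\<in>I. f i) = (\<Sum>i\<in>I. lin s h (f i))"
  by (induction I rule: infinite_finite_induct) (auto simp: lin_zero lin_add)

lemma lin_uminus: "lin s h (- p) = - lin s h p"
  using lin_add[of p "- p"] by (simp add: lin_zero eq_neg_iff_add_eq_0 add.commute)

lemma lin_diff: "lin s h (p - q) = lin s h p - lin s h q"
  using lin_add[of p "- q"] by (simp add: lin_uminus)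

lemma lin_single: "lin s h (single m c) = s c * h m"
  by (simp add: lin_def s_0)

end

locale linear_extension = additive_extension s h
  for s :: "complex \<Rightarrow> 'r::comm_ring_1" and h :: "'m::comm_monoid_add \<Rightarrow> 'r" +
  assumes s_1: "s 1 = 1" and s_mult: "s (a * b) = s a * s b"
    and h_0: "h 0 = 1" and h_add: "h (m + m') = h m * h m'"
begin

lemma lin_one: "lin s h 1 = 1"
  using lin_single[of 0 1] by (simp add: s_1 h_0)

lemma lin_mult: "lin s h (p * q) = lin s h p * lin s h q"
proof -
  have "p * q = (\<Sum>m\<in>keys p. \<Sum>m'\<in>keys q. single (m + m') (lookup p m * lookup q m'))"
    using arg_cong2[OF poly_mapping_expand[of p] poly_mapping_expand[of q], of "(*)"]
    by (simp only: sum_product mult_single)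
  then have "lin s h (p * q) = (\<Sum>m\<in>keys p. \<Sum>m'\<in>keys q. (s (lookup p m) * h m) * (s (lookup q m') * h m'))"
    by (simp add: lin_sum lin_single s_mult h_add mult_ac)
  also have "\<dots> = lin s h p * lin s h q"
    by (simp add: lin_def sum_product)
  finally show ?thesis .
qed

lemma lin_prod: "lin s h (\<Prod>i\<in>I. f i) = (\<Prod>i\<in>I. lin s h (f i))"
  by (induction I rule: infinite_finite_induct) (auto simp: lin_one lin_mult)

lemma lin_power: "lin s h (p ^ k) = lin s h p ^ k"
  by (induction k) (auto simp: lin_one lin_mult)

lemmas lin_simps = lin_zero lin_add lin_sum lin_uminus lin_diff lin_single lin_one lin_mult lin_prod lin_power

end

section \<open>Polynomials and their evaluation\<close>

definition monom_val :: "('v \<Rightarrow> 'r::comm_monoid_mult) \<Rightarrow> ('v \<Rightarrow>\<^sub>0 nat) \<Rightarrow> 'r" where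
  "monom_val x m = (\<Prod>v\<in>keys m. x v ^ lookup m v)"

lemma monom_val_superset:
  "finite V \<Longrightarrow> keys m \<subseteq> V \<Longrightarrow> monom_val x m = (\<Prod>v\<in>V. x v ^ lookup m v)"
  unfolding monom_val_def by (rule prod.mono_neutral_left) (auto simp: in_keys_iff)

lemma monom_val_0 [simp]: "monom_val x 0 = 1"
  by (simp add: monom_val_def)

lemma monom_val_add: "monom_val x (m + m') = monom_val x m * monom_val x m'"
proof -
  have "monom_val x (m + m') = (\<Prod>v\<in>keys m \<union> keys m'. x v ^ lookup (m + m') v)"
    by (intro monom_val_superset) (simp_all add: Poly_Mapping.keys_add)
  also have "\<dots> = monom_val x m * monom_val x m'"
    by (simp add: monom_val_superset[of "keys m \<union> keys m'"] lookup_add power_add prod.distrib)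
  finally show ?thesis .
qed

lemma monom_val_single [simp]: "monom_val x (single v k) = x v ^ k"
  by (simp add: monom_val_def)

lemma monom_val_sum: "monom_val x (\<Sum>i\<in>I. f i) = (\<Prod>i\<in>I. monom_val x (f i))"
  by (induction I rule: infinite_finite_induct) (auto simp: monom_val_add)

lemma monom_val_mult: "monom_val (\<lambda>v. x v * y v) m = monom_val x m * monom_val y m"
  by (simp add: monom_val_def power_mult_distrib prod.distrib)

lemma meval_eq_lin: "meval p x = lin (\<lambda>c. c) (monom_val x) p"
  by (simp add: meval_def lin_def monom_val_def)

interpretation meval: linear_extension "\<lambda>c. c" "monom_val x" for x
  by standard (auto simp: monom_val_add)

lemmas meval_simps = meval.lin_simps[folded meval_eq_lin]

lemma meval_const [simp]: "meval (const_poly c) x = c"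
  by (simp add: const_poly_def meval_simps)

text \<open>Artin's argument: distinct monomials are distinct characters of the multiplicative
  monoid of points, hence linearly independent.\<close>
lemma monom_val_independent:
  fixes c :: "('v \<Rightarrow>\<^sub>0 nat) \<Rightarrow> complex"
  assumes "finite M" "\<And>x. (\<Sum>m\<in>M. c m * monom_val x m) = 0"
  shows "\<forall>m\<in>M. c m = 0"
  using assms
proof (induction M arbitrary: c)
  case (insert m0 M)
  have "c m = 0" if m: "m \<in> M" for m
  proof -
    have "m \<noteq> m0" using m insert.hyps by auto
    then obtain v where v: "lookup m v \<noteq> lookup m0 v"
      by (metis poly_mapping_eqI)
    \<comment> \<open>This point separates the two characters: \<open>monom_val y\<close> is 2 to
      the exponent of \<open>v\<close>.\<close>
    define y where "y = (\<lambda>u. if u = v then 2 else 1 :: complex)"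
    have y: "monom_val y m' = 2 ^ lookup m' v" for m'
    proof -
      have "monom_val y m' = (\<Prod>u\<in>insert v (keys m'). y u ^ lookup m' u)"
        by (rule monom_val_superset) auto
      also have "\<dots> = (\<Prod>u\<in>insert v (keys m'). if u = v then 2 ^ lookup m' v else 1)"
        by (rule prod.cong) (auto simp: y_def)
      also have "\<dots> = 2 ^ lookup m' v"
        by (subst prod.delta) auto
      finally show ?thesis .
    qed
    have "(\<Sum>m\<in>M. (c m * (monom_val y m - monom_val y m0)) * monom_val x m) = 0" for x
    proof -
      have "(\<Sum>m\<in>M. (c m * (monom_val y m - monom_val y m0)) * monom_val x m)
        = (\<Sum>m\<in>insert m0 M. (c m * (monom_val y m - monom_val y m0)) * monom_val x m)"
        using insert.hyps by simp
      also have "\<dots> = (\<Sum>m\<in>insert m0 M. c m * monom_val (\<lambda>v. x v * y v) m)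
           - monom_val y m0 * (\<Sum>m\<in>insert m0 M. c m * monom_val x m)"
        unfolding sum_distrib_left sum_subtractf[symmetric]
        by (rule sum.cong) (auto simp: monom_val_mult algebra_simps)
      also have "\<dots> = 0" by (simp only: insert.prems) simp
      finally show ?thesis .
    qed
    then have "\<forall>m\<in>M. c m * (monom_val y m - monom_val y m0) = 0"
      by (rule insert.IH)
    then have "c m * (2 ^ lookup m v - 2 ^ lookup m0 v) = 0"
      using m by (simp add: y)
    moreover have "(2 ^ lookup m v :: complex) \<noteq> 2 ^ lookup m0 v"
    proof
      assume "(2 ^ lookup m v :: complex) = 2 ^ lookup m0 v"
      then have "norm (2 ^ lookup m v :: complex) = norm (2 ^ lookup m0 v :: complex)"
        by (rule arg_cong)
      then have "(2 ^ lookup m v :: real) = 2 ^ lookup m0 v"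
        by (simp only: norm_power norm_numeral)
      with v show False by (simp add: power_inject_exp)
    qed
    ultimately show ?thesis by auto
  qed
  moreover have "c m0 = 0"
    using insert.prems[of "\<lambda>_. 1"] insert.hyps calculation by (simp add: monom_val_def)
  ultimately show ?case by auto
qed auto

lemma meval_eq_0_imp: "(\<And>x. meval p x = 0) \<Longrightarrow> p = 0"
  using monom_val_independent[of "keys p" "lookup p"]
  unfolding meval_eq_lin lin_def by (metis finite_keys in_keys_iff keys_eq_empty all_not_in_conv)

lemma meval_eqI: "(\<And>x. meval p x = meval q x) \<Longrightarrow> p = q"
  using meval_eq_0_imp[of "p - q"] by (simp add: meval_simps)

section \<open>Degrees, homogeneous components and the variables of a polynomial\<close>

lemma mdeg_superset: "finite V \<Longrightarrow> keys m \<subseteq> V \<Longrightarrow> mdeg m = (\<Sum>v\<in>V. lookup m v)"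
  unfolding mdeg_def by (rule sum.mono_neutral_left) (auto simp: in_keys_iff)

lemma mdeg_0 [simp]: "mdeg 0 = 0"
  by (simp add: mdeg_def)

lemma mdeg_add: "mdeg (m + m') = mdeg m + mdeg m'"
proof -
  have "mdeg (m + m') = (\<Sum>v\<in>keys m \<union> keys m'. lookup (m + m') v)"
    by (intro mdeg_superset) (simp_all add: Poly_Mapping.keys_add)
  then show ?thesis
    by (simp add: mdeg_superset[of "keys m \<union> keys m'"] lookup_add sum.distrib)
qed

lemma mdeg_single [simp]: "mdeg (single v k) = k"
  by (simp add: mdeg_def)

lemma lookup_hcomp: "lookup (hcomp k p) m = (if mdeg m = k then lookup p m else 0)"
proof -
  have "lookup (hcomp k p) m
    = (\<Sum>m'\<in>{m \<in> keys p. mdeg m = k}. if m' = m then lookup p m else 0)"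
    unfolding hcomp_def lookup_sum by (rule sum.cong) (auto simp: lookup_single when_def)
  also have "\<dots> = (if mdeg m = k then lookup p m else 0)"
    by (subst sum.delta) (auto simp: in_keys_iff)
  finally show ?thesis .
qed

lemma keys_hcomp: "keys (hcomp k p) = {m \<in> keys p. mdeg m = k}"
  by (auto simp: in_keys_iff lookup_hcomp split: if_splits)

lemma homogeneous_hcomp: "homogeneous k (hcomp k p)"
  by (simp add: homogeneous_def keys_hcomp)

lemma sum_hcomp:
  assumes "\<And>m. m \<in> keys p \<Longrightarrow> mdeg m < N"
  shows "p = (\<Sum>k<N. hcomp k p)"
proof (rule poly_mapping_eqI)
  fix m
  show "lookup p m = lookup (\<Sum>k<N. hcomp k p) m"
    using assms[of m] by (auto simp: lookup_sum lookup_hcomp in_keys_iff)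
qed

lemma mdeg_bound: obtains N where "\<And>m. m \<in> keys p \<Longrightarrow> mdeg m < N"
proof
  fix m assume "m \<in> keys p"
  then show "mdeg m < Suc (\<Sum>m\<in>keys p. mdeg m)"
    by (simp add: less_Suc_eq_le member_le_sum)
qed

lemma vars_in_add: "vars_in V p \<Longrightarrow> vars_in V q \<Longrightarrow> vars_in V (p + q)"
  using Poly_Mapping.keys_add[of p q] by (auto simp: vars_in_def)

lemma vars_in_zero [simp]: "vars_in V 0"
  by (auto simp: vars_in_def)

lemma vars_in_sum: "(\<And>i. i \<in> I \<Longrightarrow> vars_in V (f i)) \<Longrightarrow> vars_in V (\<Sum>i\<in>I. f i)"
  by (induction I rule: infinite_finite_induct) (auto intro: vars_in_add)

lemma vars_in_mult:
  assumes "vars_in V p" "vars_in V q" shows "vars_in V (p * q)"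
  unfolding vars_in_def
proof
  fix m assume "m \<in> keys (p * q)"
  then obtain a b where "a \<in> keys p" "b \<in> keys q" "m = a + b"
    using keys_mult[of p q] by blast
  then show "keys m \<subseteq> V"
    using assms Poly_Mapping.keys_add[of a b] unfolding vars_in_def by blast
qed

lemma vars_in_one [simp]: "vars_in V 1"
  by (auto simp: vars_in_def)

lemma vars_in_prod: "(\<And>i. i \<in> I \<Longrightarrow> vars_in V (f i)) \<Longrightarrow> vars_in V (\<Prod>i\<in>I. f i)"
  by (induction I rule: infinite_finite_induct) (auto intro: vars_in_mult)

lemma vars_in_const [simp]: "vars_in V (const_poly c)"
  by (auto simp: vars_in_def const_poly_def)

lemma vars_in_hcomp: "vars_in V p \<Longrightarrow> vars_in V (hcomp k p)"
  by (auto simp: vars_in_def keys_hcomp)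

lemma vars_in_single: "keys m \<subseteq> V \<Longrightarrow> vars_in V (single m c)"
  by (auto simp: vars_in_def)

section \<open>The group ring of the lattice\<close>

text \<open>Finitely supported functions are read as measures, or as exponential sums with
  \<open>single x 1\<close> for exp x. Multiplication is convolution and \<open>push\<close> is the
  image measure, a ring homomorphism whenever \<pi> is additive.\<close>

definition push :: "('a \<Rightarrow> 'b) \<Rightarrow> ('a \<Rightarrow>\<^sub>0 complex) \<Rightarrow> ('b \<Rightarrow>\<^sub>0 complex)" where
  "push \<pi> \<mu> = (\<Sum>x\<in>keys \<mu>. single (\<pi> x) (lookup \<mu> x))"

lemma keys_sum_subset: "keys (\<Sum>i\<in>I. f i) \<subseteq> (\<Union>i\<in>I. keys (f i))"
  for f :: "'i \<Rightarrow> 'm \<Rightarrow>\<^sub>0 'b::comm_monoid_add"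
proof
  fix k assume "k \<in> keys (\<Sum>i\<in>I. f i)"
  then have "(\<Sum>i\<in>I. lookup (f i) k) \<noteq> 0"
    by (simp add: in_keys_iff lookup_sum)
  then obtain i where "i \<in> I" "lookup (f i) k \<noteq> 0"
    by (meson sum.neutral)
  then show "k \<in> (\<Union>i\<in>I. keys (f i))"
    by (auto simp: in_keys_iff)
qed

lemma keys_push: "keys (push \<pi> \<mu>) \<subseteq> \<pi> ` keys \<mu>"
  unfolding push_def by (rule order_trans[OF keys_sum_subset]) auto

lemma push_cong: "(\<And>x. x \<in> keys \<mu> \<Longrightarrow> \<pi> x = \<rho> x) \<Longrightarrow> push \<pi> \<mu> = push \<rho> \<mu>"
  by (simp add: push_def)

lemma push_id: "push (\<lambda>x. x) \<mu> = \<mu>"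
  unfolding push_def by (rule poly_mapping_expand[symmetric])

lemma push_eq_lin: "push \<pi> \<mu> = lin (single 0) (\<lambda>x. single (\<pi> x) 1) \<mu>"
  for \<pi> :: "'a \<Rightarrow> 'b::comm_monoid_add"
  by (simp add: push_def lin_def mult_single)

lemma linear_extension_push:
  fixes \<pi> :: "'a::comm_monoid_add \<Rightarrow> 'b::comm_monoid_add"
  assumes "\<pi> 0 = 0" "\<And>x y. \<pi> (x + y) = \<pi> x + \<pi> y"
  shows "linear_extension (single 0) (\<lambda>x. single (\<pi> x) (1::complex))"
  by standard (auto simp: single_add mult_single assms)

context linear_extension
begin

lemma lin_push: "lin s h (push \<pi> \<mu>) = lin s (\<lambda>x. h (\<pi> x)) \<mu>"
  by (simp add: push_def lin_sum lin_single) (simp add: lin_def)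

end

lemma push_push:
  fixes \<pi> :: "'a \<Rightarrow> 'b::comm_monoid_add" and \<rho> :: "'b \<Rightarrow> 'c::comm_monoid_add"
  assumes "\<rho> 0 = 0" "\<And>x y. \<rho> (x + y) = \<rho> x + \<rho> y"
  shows "push \<rho> (push \<pi> \<mu>) = push (\<lambda>x. \<rho> (\<pi> x)) \<mu>"
  using linear_extension.lin_push[OF linear_extension_push[of \<rho>, OF assms], of \<pi> \<mu>]
  by (simp add: push_eq_lin)

lemma lookup_single_mult:
  fixes \<kappa> :: "'a::ab_group_add \<Rightarrow>\<^sub>0 complex"
  shows "lookup (single a c * \<kappa>) x = c * lookup \<kappa> (x - a)"
proof -
  have "single a c * \<kappa> = single a c * (\<Sum>u\<in>keys \<kappa>. single u (lookup \<kappa> u))"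
    by (simp flip: poly_mapping_expand)
  also have "\<dots> = (\<Sum>u\<in>keys \<kappa>. single (a + u) (c * lookup \<kappa> u))"
    by (simp add: sum_distrib_left mult_single)
  also have "lookup \<dots> x = (\<Sum>u\<in>keys \<kappa>. if u = x - a then c * lookup \<kappa> (x - a) else 0)"
    unfolding lookup_sum by (rule sum.cong) (auto simp: lookup_single when_def)
  also have "\<dots> = c * lookup \<kappa> (x - a)"
    by (subst sum.delta) (auto simp: in_keys_iff)
  finally show ?thesis .
qed

section \<open>Transforms and their order of vanishing\<close>

definition pair :: "nat set \<Rightarrow> (nat \<Rightarrow> int) \<Rightarrow> (nat \<Rightarrow> complex) \<Rightarrow> complex" where
  "pair K x y = (\<Sum>i\<in>K. of_int (x i) * y i)"

lemma pair_0 [simp]: "pair K 0 y = 0"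
  by (simp add: pair_def)

lemma pair_add: "pair K (x + x') y = pair K x y + pair K x' y"
  by (simp add: pair_def distrib_right sum.distrib)

text \<open>The Fourier-Laplace transform of a finitely supported measure on the lattice,
  restricted to the line through a dual vector.\<close>
definition transform :: "nat set \<Rightarrow> (nat \<Rightarrow> complex) \<Rightarrow> ((nat \<Rightarrow> int) \<Rightarrow>\<^sub>0 complex) \<Rightarrow> complex fps" where
  "transform K y = lin fps_const (\<lambda>x. fps_exp (pair K x y))"

interpretation transform: linear_extension fps_const "\<lambda>x. fps_exp (pair K x y)" for K y
  by standard (auto simp: pair_add fps_exp_add_mult fps_const_mult[symmetric] simp del: fps_const_mult)

lemmas transform_simps = transform.lin_simps[folded transform_def]

lemma fps_nth_transform:
  "fps_nth (transform K y \<mu>) i = (\<Sum>x\<in>keys \<mu>. lookup \<mu> x * pair K x y ^ i / fact i)"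
  by (simp add: transform_def lin_def fps_sum_nth)

lemma transform_push: "transform K y (push \<pi> \<mu>) = transform K' y' \<mu>"
  if "\<And>x. x \<in> keys \<mu> \<Longrightarrow> pair K (\<pi> x) y = pair K' x y'"
  unfolding transform_def transform.lin_push using that by (simp add: lin_def)

text \<open>The exponential sum vanishes to order \<open>j\<close> at the origin. Testing it on
  lines suffices, since its part of degree \<open>i\<close> is a homogeneous polynomial in
  \<open>y\<close>; only power series in one variable are needed.\<close>

definition vanishes_to_order :: "nat set \<Rightarrow> nat \<Rightarrow> ((nat \<Rightarrow> int) \<Rightarrow>\<^sub>0 complex) \<Rightarrow> bool" where
  "vanishes_to_order K j \<mu> \<longleftrightarrow> (\<forall>y. \<forall>i<j. fps_nth (transform K y \<mu>) i = 0)"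

text \<open>On a line with \<open>pair K a y \<noteq> 0\<close> the factor exp a - 1 has order
  exactly one, so it can be cancelled. Each coefficient of the transform is continuous in
  \<open>y\<close>, which extends its vanishing to the remaining directions.\<close>

lemma vanishes_to_order_cancel:
  assumes y0: "pair K a y0 \<noteq> 0"
    and ord: "vanishes_to_order K j ((single a 1 - 1) * \<kappa>)"
  shows "vanishes_to_order K (j - 1) \<kappa>"
  unfolding vanishes_to_order_def
proof (intro allI impI)
  have generic: "fps_nth (transform K y \<kappa>) i = 0" if y: "pair K a y \<noteq> 0" and i: "i < j - 1" for y i
  proof (cases "transform K y \<kappa> = 0")
    case False
    define E where "E = fps_exp (pair K a y) - 1"
    have E: "fps_nth E 0 = 0" "fps_nth E 1 \<noteq> 0" using y by (auto simp: E_def)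
    then have E0: "E \<noteq> 0" by auto
    have sE: "subdegree E = 1"
      using E by (intro subdegreeI) auto
    have prod: "transform K y ((single a 1 - 1) * \<kappa>) = E * transform K y \<kappa>"
      by (simp add: transform_simps E_def)
    have "\<forall>i<j. fps_nth (E * transform K y \<kappa>) i = 0"
      using ord by (simp add: vanishes_to_order_def flip: prod)
    then have "subdegree (E * transform K y \<kappa>) \<ge> j"
      using E0 False by (intro subdegree_geI) auto
    then have "subdegree (transform K y \<kappa>) \<ge> j - 1"
      using E0 False sE by simp
    then show ?thesis
      using i by (intro nth_less_subdegree_zero) auto
  qed simp
  fix y i assume i: "i < j - 1"
  show "fps_nth (transform K y \<kappa>) i = 0"
  proof (cases "pair K a y = 0")
    case True
    \<comment> \<open>The coefficient along a perturbed direction; \<open>y0\<close> makes every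
      \<open>s \<noteq> 0\<close> generic.\<close>
    define g where "g = (\<lambda>s. fps_nth (transform K (\<lambda>i. y i + s * y0 i) \<kappa>) i)"
    have pair: "pair K x (\<lambda>i. y i + s * y0 i) = pair K x y + s * pair K x y0" for x s
      by (simp add: pair_def distrib_left sum.distrib sum_distrib_left mult_ac)
    have "g s = 0" if "s \<noteq> 0" for s
      unfolding g_def using that i y0 True by (intro generic) (auto simp: pair)
    then have "(g \<longlongrightarrow> 0) (at 0)"
      by (intro tendsto_eventually) (auto simp: eventually_at_filter)
    moreover have "isCont g 0"
      unfolding g_def fps_nth_transform pair by (intro continuous_intros) auto
    then have "(g \<longlongrightarrow> g 0) (at 0)"
      by (simp add: isCont_def)
    ultimately have "g 0 = 0"
      using tendsto_unique[OF at_neq_bot] by blast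
    then show ?thesis by (simp add: g_def)
  qed (use generic i in auto)
qed

text \<open>Telescoping for positive multiples; a negative multiple differs from the opposite one by
  the unit \<open>single (\<lambda>i. r * a i) 1\<close> and a sign.\<close>

lemma single_minus_one_dvd_multiple:
  fixes a :: "nat \<Rightarrow> int"
  shows "(single a (1::complex) - 1) dvd (single (\<lambda>i. r * a i) 1 - 1)"
proof -
  have nat: "(single a (1::complex) - 1) dvd (single (\<lambda>i. int k * a i) 1 - 1)" for k
  proof (induction k)
    case 0
    have "(\<lambda>i. int 0 * a i) = 0" by auto
    then show ?case by simp
  next
    case (Suc k)
    have "(\<lambda>i. int (Suc k) * a i) = a + (\<lambda>i. int k * a i)"
      by (auto simp: algebra_simps)
    then have "single (\<lambda>i. int (Suc k) * a i) (1::complex) - 1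
      = single a 1 * (single (\<lambda>i. int k * a i) 1 - 1) + (single a 1 - 1)"
      by (simp add: right_diff_distrib mult_single)
    then show ?case using Suc by (simp only: dvd_add dvd_mult dvd_refl)
  qed
  show ?thesis
  proof (cases "r \<ge> 0")
    case True
    then show ?thesis using nat[of "nat r"] by simp
  next
    case False
    have "(\<lambda>i. r * a i) + (\<lambda>i. int (nat (- r)) * a i) = 0"
      using False by (auto simp: fun_eq_iff)
    then have "single (\<lambda>i. r * a i) (1::complex) - 1
      = - (single (\<lambda>i. r * a i) 1 * (single (\<lambda>i. int (nat (- r)) * a i) 1 - 1))"
      by (simp add: right_diff_distrib mult_single)
    then show ?thesis
      using nat[of "nat (- r)"] by (metis dvd_minus_iff dvd_mult)
  qed
qed

text \<open>Subtracting the zero measure \<open>push \<pi> \<mu>\<close> pairs each point with its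
  projection, from which it differs by a multiple of \<open>a\<close>. This computes the kernel of
  the contraction.\<close>

lemma single_minus_one_dvd:
  fixes a :: "nat \<Rightarrow> int"
  assumes "\<And>x. x \<in> keys \<mu> \<Longrightarrow> x = \<pi> x + (\<lambda>i. r x * a i)" "push \<pi> \<mu> = 0"
  shows "(single a 1 - 1) dvd \<mu>"
proof -
  have "\<mu> = \<mu> - push \<pi> \<mu>" by (simp add: assms)
  also have "\<dots> = (\<Sum>x\<in>keys \<mu>. single x (lookup \<mu> x) - single (\<pi> x) (lookup \<mu> x))"
    unfolding sum_subtractf push_def by (simp flip: poly_mapping_expand)
  also have "\<dots> = (\<Sum>x\<in>keys \<mu>. single (\<pi> x) (lookup \<mu> x) * (single (\<lambda>i. r x * a i) 1 - 1))"
    by (intro sum.cong) (auto simp: right_diff_distrib mult_single assms(1)[symmetric])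
  finally have eq: "\<mu> = \<dots>" .
  show ?thesis
    by (subst eq) (intro dvd_sum dvd_mult single_minus_one_dvd_multiple[of a])
qed

section \<open>Lattice points of zonotopes\<close>

text \<open>A family of generators instead of a set, so that repeated generators count with
  multiplicity and dilations are covered.\<close>

definition zlat :: "'j set \<Rightarrow> ('j \<Rightarrow> nat \<Rightarrow> int) \<Rightarrow> (nat \<Rightarrow> int) set" where
  "zlat J a = {z. \<exists>t. (\<forall>j\<in>J. 0 \<le> t j \<and> t j \<le> (1::real)) \<and>
     (\<forall>i. real_of_int (z i) = (\<Sum>j\<in>J. t j * real_of_int (a j i)))}"

lemma zlat_insertI:
  assumes "z \<in> zlat J a" "j0 \<notin> J" "finite J" "0 \<le> r" "r \<le> 1"
    "\<And>i. real_of_int (z' i) = real_of_int (z i) + r * real_of_int (a j0 i)"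
  shows "z' \<in> zlat (insert j0 J) a"
proof -
  obtain t where t: "\<forall>j\<in>J. 0 \<le> t j \<and> t j \<le> 1"
    "\<And>i. real_of_int (z i) = (\<Sum>j\<in>J. t j * real_of_int (a j i))"
    using assms(1) by (auto simp: zlat_def)
  have "(\<Sum>j\<in>J. (t(j0 := r)) j * real_of_int (a j i)) = (\<Sum>j\<in>J. t j * real_of_int (a j i))" for i
    using assms(2) by (intro sum.cong) auto
  then show ?thesis
    unfolding zlat_def mem_Collect_eq using t assms
    by (intro exI[of _ "t(j0 := r)"]) auto
qed

lemma zlat_insert_subset: "j0 \<notin> J \<Longrightarrow> finite J \<Longrightarrow> zlat J a \<subseteq> zlat (insert j0 J) a"
  using zlat_insertI[where r = 0] by fastforce

lemma zlat_mono: "finite J \<Longrightarrow> S \<subseteq> J \<Longrightarrow> zlat S a \<subseteq> zlat J a"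
proof (induction J rule: finite_induct)
  case (insert j J)
  show ?case
  proof (cases "j \<in> S")
    case False
    then show ?thesis using insert zlat_insert_subset[of j J a] by blast
  next
    case True
    have fin: "finite S" using insert finite_subset by blast
    show ?thesis
    proof
      fix z assume "z \<in> zlat S a"
      then obtain t where t: "\<forall>j\<in>S. 0 \<le> t j \<and> t j \<le> 1"
        "\<And>i. real_of_int (z i) = (\<Sum>j\<in>S. t j * real_of_int (a j i))"
        by (auto simp: zlat_def)
      have "(\<Sum>j\<in>insert j J. (if j \<in> S then t j else 0) * real_of_int (a j i))
         = (\<Sum>j\<in>S. t j * real_of_int (a j i))" for i
        using insert by (intro sum.mono_neutral_cong_right) auto
      then show "z \<in> zlat (insert j J) a"
        unfolding zlat_def mem_Collect_eq using t
        by (intro exI[of _ "\<lambda>j. if j \<in> S then t j else 0"]) auto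
    qed
  qed
qed auto

lemma zlat_insert_zero:
  assumes "a j0 = 0" "j0 \<notin> J" "finite J"
  shows "zlat (insert j0 J) a = zlat J a"
  using zlat_insert_subset[OF assms(2,3), of a] assms by (auto simp: zlat_def)

text \<open>The coefficients \<open>t\<close> are real while \<pi> acts only on integer points, so
  its linearity is demanded coordinatewise over the reals.\<close>

lemma zlat_image:
  assumes "z \<in> zlat J a"
    and "\<And>i. \<exists>K c. \<forall>x. real_of_int (\<pi> x i) = (\<Sum>k\<in>K. c k * real_of_int (x k))"
  shows "\<pi> z \<in> zlat J (\<lambda>j. \<pi> (a j))"
proof -
  obtain t where t: "\<forall>j\<in>J. 0 \<le> t j \<and> t j \<le> 1"
    "\<And>i. real_of_int (z i) = (\<Sum>j\<in>J. t j * real_of_int (a j i))"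
    using assms(1) by (auto simp: zlat_def)
  have "real_of_int (\<pi> z i) = (\<Sum>j\<in>J. t j * real_of_int (\<pi> (a j) i))" for i
  proof -
    obtain K c where c: "\<And>x. real_of_int (\<pi> x i) = (\<Sum>k\<in>K. c k * real_of_int (x k))"
      using assms(2)[of i] by auto
    have "real_of_int (\<pi> z i) = (\<Sum>k\<in>K. \<Sum>j\<in>J. t j * (c k * real_of_int (a j k)))"
      by (simp add: c t sum_distrib_left mult_ac)
    also have "\<dots> = (\<Sum>j\<in>J. t j * real_of_int (\<pi> (a j) i))"
      by (subst sum.swap) (simp add: c sum_distrib_left)
    finally show ?thesis .
  qed
  then show ?thesis using t by (auto simp: zlat_def)
qed

text \<open>Removing the contribution of \<open>a j0\<close> from the two given points leaves points of the smaller
  zonotope on the same line, still on either side of \<open>x\<close>.\<close>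
lemma zlat_between:
  fixes r0 r1 :: int
  assumes "j0 \<notin> J" "finite J" "r0 \<le> 0" "0 \<le> r1"
    "(\<lambda>i. x i + r0 * a j0 i) \<in> zlat (insert j0 J) a"
    "(\<lambda>i. x i + (r1 + 1) * a j0 i) \<in> zlat (insert j0 J) a"
  shows "x \<in> zlat J a"
proof -
  obtain t where t: "\<forall>j\<in>insert j0 J. 0 \<le> t j \<and> t j \<le> 1"
    "\<And>i. real_of_int (x i + r0 * a j0 i) = (\<Sum>j\<in>insert j0 J. t j * real_of_int (a j i))"
    using assms(5) unfolding zlat_def by blast
  obtain s where s: "\<forall>j\<in>insert j0 J. 0 \<le> s j \<and> s j \<le> 1"
    "\<And>i. real_of_int (x i + (r1 + 1) * a j0 i) = (\<Sum>j\<in>insert j0 J. s j * real_of_int (a j i))"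
    using assms(6) unfolding zlat_def by blast
  define u where "u = t j0 - real_of_int r0"
  \<comment> \<open>The upper point lies one step beyond \<open>r1\<close>; this compensates for
    \<open>s j0 \<le> 1\<close> and makes \<open>w\<close> nonnegative.\<close>
  define w where "w = real_of_int r1 + 1 - s j0"
  have u: "u \<ge> 0" and w: "w \<ge> 0" using t(1) s(1) assms(3,4) by (auto simp: u_def w_def)
  have T: "real_of_int (x i) = (\<Sum>j\<in>J. t j * real_of_int (a j i)) + u * real_of_int (a j0 i)" for i
    using t(2)[of i] assms(1,2) by (simp add: u_def algebra_simps)
  have S: "real_of_int (x i) = (\<Sum>j\<in>J. s j * real_of_int (a j i)) - w * real_of_int (a j0 i)" for i
    using s(2)[of i] assms(1,2) by (simp add: w_def algebra_simps)
  show ?thesis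
  proof (cases "u + w = 0")
    case True
    then have "u = 0" using u w by linarith
    then show ?thesis using T t(1) by (auto simp: zlat_def)
  next
    case False
    then have pos: "u + w > 0" using u w by linarith
    \<comment> \<open>Averaging with weights proportional to \<open>w\<close> and \<open>u\<close>
      cancels the multiples of \<open>a j0\<close>.\<close>
    define v where "v = (\<lambda>j. (w * t j + u * s j) / (u + w))"
    have "0 \<le> v j \<and> v j \<le> 1" if "j \<in> J" for j
    proof -
      have "w * t j + u * s j \<le> w * 1 + u * 1"
        using that t(1) s(1) u w by (intro add_mono mult_left_mono) auto
      moreover have "0 \<le> w * t j + u * s j"
        using that t(1) s(1) u w by (intro add_nonneg_nonneg mult_nonneg_nonneg) auto
      ultimately show ?thesis using pos by (simp add: v_def divide_simps)
    qed
    moreover have "real_of_int (x i) = (\<Sum>j\<in>J. v j * real_of_int (a j i))" for i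
    proof -
      have "(\<Sum>j\<in>J. v j * real_of_int (a j i))
        = (w * (\<Sum>j\<in>J. t j * real_of_int (a j i)) + u * (\<Sum>j\<in>J. s j * real_of_int (a j i))) / (u + w)"
        unfolding sum_distrib_left sum.distrib[symmetric] sum_divide_distrib v_def
        by (intro sum.cong refl) (simp add: algebra_simps)
      also have "\<dots> = (w * (real_of_int (x i) - u * real_of_int (a j0 i))
          + u * (real_of_int (x i) + w * real_of_int (a j0 i))) / (u + w)"
        using T[of i] S[of i] by simp
      also have "\<dots> = real_of_int (x i)"
        using False by (simp add: divide_simps) (simp add: algebra_simps)
      finally show ?thesis by simp
    qed
    ultimately show ?thesis by (auto simp: zlat_def)
  qed
qed

text \<open>On the line through \<open>x\<close> in direction \<open>a j0\<close>, the first point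
  of the support of \<kappa> and the successor of its last point each receive a single term in the
  product, so nothing cancels there. Both lie in the large zonotope, and \<open>x\<close> lies
  between them in the sense of \<open>zlat_between\<close>.\<close>

lemma keys_quotient_subset_zlat:
  fixes a :: "'j \<Rightarrow> nat \<Rightarrow> int" and \<kappa> :: "(nat \<Rightarrow> int) \<Rightarrow>\<^sub>0 complex"
  assumes "a j0 \<noteq> 0" "j0 \<notin> J" "finite J"
    and keys: "keys ((single (a j0) 1 - 1) * \<kappa>) \<subseteq> zlat (insert j0 J) a"
  shows "keys \<kappa> \<subseteq> zlat J a"
proof
  fix x assume x: "x \<in> keys \<kappa>"
  define l where "l = (\<lambda>(r::int) i. x i + r * a j0 i)"
  obtain i0 where i0: "a j0 i0 \<noteq> 0" using assms(1) by (auto simp: fun_eq_iff)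
  have l_shift: "l r - a j0 = l (r - 1)" for r
    by (auto simp: l_def fun_eq_iff algebra_simps)
  have inj: "inj l"
  proof (rule injI)
    fix r r' assume "l r = l r'"
    then have "l r i0 = l r' i0" by simp
    then show "r = r'" using i0 by (simp add: l_def)
  qed
  define R where "R = l -` keys \<kappa>"
  have fin: "finite R" unfolding R_def using inj by (intro finite_vimageI) auto
  have "l 0 = x" by (simp add: l_def)
  then have 0: "0 \<in> R" using x by (simp add: R_def)
  then have ne: "R \<noteq> {}" by auto
  define r0 where "r0 = Min R"
  define r1 where "r1 = Max R"
  have r: "r0 \<le> 0" "0 \<le> r1" "r0 \<in> R" "r1 \<in> R"
    using fin 0 Min_in[OF fin ne] Max_in[OF fin ne] by (auto simp: r0_def r1_def)
  have "r0 - 1 \<notin> R" "r1 + 1 \<notin> R"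
    using fin Min_le[of R "r0 - 1"] Max_ge[of R "r1 + 1"] by (auto simp: r0_def r1_def)
  then have out: "lookup \<kappa> (l (r0 - 1)) = 0" "lookup \<kappa> (l (r1 + 1)) = 0"
    by (auto simp: R_def in_keys_iff)
  have look: "lookup ((single (a j0) 1 - 1) * \<kappa>) (l r) = lookup \<kappa> (l (r - 1)) - lookup \<kappa> (l r)" for r
    by (simp add: left_diff_distrib lookup_minus lookup_single_mult l_shift)
  have "l r0 \<in> keys ((single (a j0) 1 - 1) * \<kappa>)" "l (r1 + 1) \<in> keys ((single (a j0) 1 - 1) * \<kappa>)"
    using r out by (auto simp: in_keys_iff look R_def)
  then show "x \<in> zlat J a"
    using keys r assms(2,3) by (intro zlat_between[of j0 J r0 r1]) (auto simp: l_def)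
qed

lemma finite_zlat:
  assumes "finite J" "finite K" "\<And>j i. j \<in> J \<Longrightarrow> i \<notin> K \<Longrightarrow> a j i = 0"
  shows "finite (zlat J a)"
proof -
  define b where "b = (\<Sum>j\<in>J. \<Sum>i\<in>K. \<bar>a j i\<bar>)"
  have "zlat J a \<subseteq> {z. \<forall>i. (i \<in> K \<longrightarrow> z i \<in> {-b..b}) \<and> (i \<notin> K \<longrightarrow> z i = 0)}"
  proof
    fix z assume "z \<in> zlat J a"
    then obtain t where t: "\<forall>j\<in>J. 0 \<le> t j \<and> t j \<le> 1"
      "\<And>i. real_of_int (z i) = (\<Sum>j\<in>J. t j * real_of_int (a j i))"
      by (auto simp: zlat_def)
    have "z i = 0" if "i \<notin> K" for i
      using t(2)[of i] assms(3) that by simp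
    moreover have "z i \<in> {-b..b}" if i: "i \<in> K" for i
    proof -
      have "\<bar>real_of_int (z i)\<bar> \<le> (\<Sum>j\<in>J. \<bar>t j * real_of_int (a j i)\<bar>)"
        unfolding t(2) by (rule sum_abs)
      also have "\<dots> \<le> (\<Sum>j\<in>J. 1 * real_of_int \<bar>a j i\<bar>)"
        unfolding abs_mult using t(1) by (intro sum_mono mult_mono) auto
      also have "\<dots> \<le> (\<Sum>j\<in>J. real_of_int (\<Sum>i\<in>K. \<bar>a j i\<bar>))"
        using assms(2) i by (intro sum_mono) (auto intro!: member_le_sum simp flip: of_int_abs)
      also have "\<dots> = real_of_int b" by (simp add: b_def)
      finally show ?thesis by (auto simp: abs_le_iff simp flip: of_int_abs)
    qed
    ultimately show "z \<in> {z. \<forall>i. (i \<in> K \<longrightarrow> z i \<in> {-b..b}) \<and> (i \<notin> K \<longrightarrow> z i = 0)}" by auto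
  qed
  moreover have "finite {z. \<forall>i. (i \<in> K \<longrightarrow> z i \<in> {-b..b}) \<and> (i \<notin> K \<longrightarrow> z i = 0)}"
    using assms(2) by (intro finite_set_of_finite_funs) auto
  ultimately show ?thesis by (rule finite_subset)
qed

section \<open>Total unimodularity and the augmentation filtration\<close>

definition aug_prod :: "('j \<Rightarrow> nat \<Rightarrow> int) \<Rightarrow> 'j set \<Rightarrow> ((nat \<Rightarrow> int) \<Rightarrow>\<^sub>0 complex)" where
  "aug_prod a S = (\<Prod>s\<in>S. single (a s) 1 - 1)"

lemma keys_aug_prod: "finite S \<Longrightarrow> keys (aug_prod a S) \<subseteq> zlat S a"
proof (induction S rule: finite_induct)
  case empty
  then show ?case by (auto simp: aug_prod_def zlat_def)
next
  case (insert s S)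
  show ?case
  proof
    fix z assume "z \<in> keys (aug_prod a (insert s S))"
    then have "z \<in> keys ((single (a s) 1 - 1) * aug_prod a S)"
      using insert.hyps by (simp add: aug_prod_def)
    then obtain u v where z: "z = u + v" and u: "u \<in> keys (single (a s) (1::complex) - 1)"
      and v: "v \<in> zlat S a"
      using keys_mult insert.IH by blast
    have "u = a s \<or> u = 0"
      using u by (auto simp: in_keys_iff lookup_minus lookup_single lookup_one when_def split: if_splits)
    then show "z \<in> zlat (insert s S) a"
    proof
      assume "u = a s"
      then show ?thesis using v z insert.hyps by (intro zlat_insertI[of v S a s 1]) auto
    next
      assume "u = 0"
      then show ?thesis using v z insert.hyps by (intro zlat_insertI[of v S a s 0]) auto
    qed
  qed
qed

lemma keys_aug_prod_subset: "finite J \<Longrightarrow> S \<subseteq> J \<Longrightarrow> keys (aug_prod a S) \<subseteq> zlat J a"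
  using keys_aug_prod[of S a] zlat_mono[of J S a] finite_subset by blast

text \<open>This is what makes lifting possible: the coefficients of a solution for the projected
  generators also define a measure upstairs that projects onto it.\<close>

lemma push_lincomb_aug_prod:
  fixes \<pi> :: "(nat \<Rightarrow> int) \<Rightarrow> (nat \<Rightarrow> int)"
  assumes "\<pi> 0 = 0" "\<And>x y. \<pi> (x + y) = \<pi> x + \<pi> y"
  shows "push \<pi> (\<Sum>S\<in>\<S>. single 0 (c S) * aug_prod a S) = (\<Sum>S\<in>\<S>. single 0 (c S) * aug_prod (\<lambda>j. \<pi> (a j)) S)"
proof -
  interpret linear_extension "single 0" "\<lambda>x. single (\<pi> x) (1::complex)"
    by (rule linear_extension_push) fact+
  show ?thesis
    by (simp add: push_eq_lin lin_simps aug_prod_def assms(1) mult_single)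
qed

lemma transform_aug_prod: "transform K y (aug_prod a S) = (\<Prod>s\<in>S. fps_exp (pair K (a s) y) - 1)"
  by (simp add: aug_prod_def transform_simps)

text \<open>Each factor is \<open>fps_X\<close> times a series with constant term
  \<open>c s\<close>, so the product starts in degree \<open>card S\<close> with the product of
  these constants.\<close>

lemma fps_nth_prod_exp_minus_one:
  fixes c :: "'s \<Rightarrow> complex"
  assumes "finite S"
  shows "i < card S \<Longrightarrow> fps_nth (\<Prod>s\<in>S. fps_exp (c s) - 1) i = 0"
    and "fps_nth (\<Prod>s\<in>S. fps_exp (c s) - 1) (card S) = (\<Prod>s\<in>S. c s)"
proof -
  have "\<exists>g. fps_exp c - 1 = fps_X * g \<and> fps_nth g 0 = c" for c :: complex
  proof (intro exI conjI)
    show "fps_exp c - 1 = fps_X * fps_shift 1 (fps_exp c - 1)"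
      by (rule fps_ext) (auto simp: fps_X_mult_nth)
    show "fps_nth (fps_shift 1 (fps_exp c - 1)) 0 = c" by simp
  qed
  then obtain g where g: "\<And>c::complex. fps_exp c - 1 = fps_X * g c" "\<And>c. fps_nth (g c) 0 = c"
    by metis
  have eq: "(\<Prod>s\<in>S. fps_exp (c s) - 1) = fps_X ^ card S * (\<Prod>s\<in>S. g (c s))"
    by (simp add: g prod.distrib)
  have prod0: "fps_nth (\<Prod>s\<in>S. g (c s)) 0 = (\<Prod>s\<in>S. c s)"
    using assms by (induction S rule: finite_induct) (auto simp: g)
  show "i < card S \<Longrightarrow> fps_nth (\<Prod>s\<in>S. fps_exp (c s) - 1) i = 0"
    unfolding eq by (simp add: fps_X_power_mult_nth)
  show "fps_nth (\<Prod>s\<in>S. fps_exp (c s) - 1) (card S) = (\<Prod>s\<in>S. c s)"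
    unfolding eq by (simp add: fps_X_power_mult_nth prod0)
qed

lemmas fps_nth_transform_aug_prod =
  fps_nth_prod_exp_minus_one[where c = "\<lambda>s. pair K (a s) y" for K a y, folded transform_aug_prod]

lemma transform_lincomb:
  "fps_nth (transform K y (\<Sum>S\<in>\<S>. single 0 (c S) * \<mu> S)) i = (\<Sum>S\<in>\<S>. c S * fps_nth (transform K y (\<mu> S)) i)"
  by (simp add: transform_simps fps_sum_nth)

text \<open>Total unimodularity without determinants, in a form that is visibly stable under deletion and
  contraction: systems given by a submatrix that are solvable over the reals are solvable over the
  integers.\<close>
definition tu :: "nat set \<Rightarrow> 'j set \<Rightarrow> ('j \<Rightarrow> nat \<Rightarrow> int) \<Rightarrow> bool" where
  "tu K J a \<longleftrightarrow> (\<forall>j\<in>J. \<forall>i. i \<notin> K \<longrightarrow> a j i = 0) \<and>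
    (\<forall>R\<subseteq>K. \<forall>S\<subseteq>J. \<forall>z. (\<exists>c. \<forall>i\<in>R. real_of_int (z i) = (\<Sum>j\<in>S. c j * real_of_int (a j i))) \<longrightarrow>
       (\<exists>c. \<forall>i\<in>R. z i = (\<Sum>j\<in>S. c j * a j i)))"

lemma tu_support: "tu K J a \<Longrightarrow> j \<in> J \<Longrightarrow> i \<notin> K \<Longrightarrow> a j i = 0"
  by (simp add: tu_def)

lemma tu_solve:
  assumes "tu K J a" "R \<subseteq> K" "S \<subseteq> J" "\<And>i. i \<in> R \<Longrightarrow> real_of_int (z i) = (\<Sum>j\<in>S. c j * real_of_int (a j i))"
  shows "\<exists>c'. \<forall>i\<in>R. z i = (\<Sum>j\<in>S. c' j * a j i)"
  by (rule assms(1)[unfolded tu_def, THEN conjunct2, rule_format, OF assms(2,3)])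
    (use assms(4) in auto)

lemma tu_mono: "tu K J a \<Longrightarrow> J' \<subseteq> J \<Longrightarrow> tu K J' a"
  unfolding tu_def using subset_trans[of _ J' J] by auto

text \<open>The one-by-one system with right-hand side 1 is solvable over the reals, hence over the
  integers, so the entry is a unit.\<close>

lemma tu_entry:
  assumes "tu K J a" "j0 \<in> J" "a j0 i0 \<noteq> 0"
  shows "a j0 i0 * a j0 i0 = 1"
proof -
  have "i0 \<in> K" using tu_support[OF assms(1,2), of i0] assms(3) by auto
  then have "\<exists>c'. \<forall>i\<in>{i0}. (1::int) = (\<Sum>j\<in>{j0}. c' j * a j i)"
    using assms(2,3) \<open>i0 \<in> K\<close>
    by (intro tu_solve[OF assms(1), where c = "\<lambda>j. 1 / real_of_int (a j i0)" and z = "\<lambda>_. 1"]) auto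
  then obtain c' where "c' j0 * a j0 i0 = 1" by auto
  then have "a j0 i0 = 1 \<or> a j0 i0 = -1"
    by (metis mult.commute zmult_eq_1_iff)
  then show ?thesis by auto
qed

text \<open>Projection along \<open>v\<close> onto the hyperplane where coordinate \<open>i0\<close>
  is zero. Division by the pivot \<open>v i0\<close> is written as multiplication, as the pivot is
  its own inverse.\<close>

definition contract :: "nat \<Rightarrow> (nat \<Rightarrow> int) \<Rightarrow> (nat \<Rightarrow> int) \<Rightarrow> (nat \<Rightarrow> int)" where
  "contract i0 v x = (\<lambda>i. x i - x i0 * v i0 * v i)"

lemma contract_0 [simp]: "contract i0 v 0 = 0"
  by (auto simp: contract_def)

lemma contract_add: "contract i0 v (x + y) = contract i0 v x + contract i0 v y"
  by (auto simp: contract_def algebra_simps)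

text \<open>A contracted system on the rows \<open>R\<close> amounts to the original system on
  \<open>insert i0 R\<close> with the extra column \<open>j0\<close> and right-hand side 0 in row
  \<open>i0\<close>: that row determines the coefficient of \<open>j0\<close>, and eliminating it
  produces the contracted columns.\<close>

lemma tu_contract:
  assumes tu: "tu K (insert j0 J) a" and j0: "j0 \<notin> J" and J: "finite J" and nz: "a j0 i0 \<noteq> 0"
  shows "tu (K - {i0}) J (\<lambda>j. contract i0 (a j0) (a j))"
proof -
  have unit: "a j0 i0 * a j0 i0 = 1" using tu_entry[OF tu _ nz] by simp
  have i0: "i0 \<in> K" using tu_support[OF tu, of j0 i0] nz by auto
  have "\<exists>c. \<forall>i\<in>R. z i = (\<Sum>j\<in>S. c j * contract i0 (a j0) (a j) i)"
    if R: "R \<subseteq> K - {i0}" and S: "S \<subseteq> J"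
      and c: "\<And>i. i \<in> R \<Longrightarrow> real_of_int (z i) = (\<Sum>j\<in>S. c j * real_of_int (contract i0 (a j0) (a j) i))"
    for R S z c
  proof -
    have fin: "finite S" and nin: "j0 \<notin> S" using S J j0 finite_subset by auto
    define z' where "z' = z(i0 := 0)"
    define e where "e = (\<Sum>j\<in>S. c j * real_of_int (a j i0))"
    \<comment> \<open>The coefficient of \<open>j0\<close> is chosen to make row \<open>i0\<close>
      vanish.\<close>
    define c1 where "c1 = c(j0 := - e * real_of_int (a j0 i0))"
    have c1: "(\<Sum>j\<in>insert j0 S. c1 j * real_of_int (a j i))
      = (\<Sum>j\<in>S. c j * real_of_int (a j i)) - e * real_of_int (a j0 i0) * real_of_int (a j0 i)" for i
    proof -
      have "(\<Sum>j\<in>S. c1 j * real_of_int (a j i)) = (\<Sum>j\<in>S. c j * real_of_int (a j i))"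
        using nin by (intro sum.cong) (auto simp: c1_def)
      then show ?thesis using fin nin by (simp add: c1_def)
    qed
    have "real_of_int (z' i) = (\<Sum>j\<in>insert j0 S. c1 j * real_of_int (a j i))" if "i \<in> insert i0 R" for i
    proof (cases "i = i0")
      case True
      have "e * real_of_int (a j0 i0) * real_of_int (a j0 i0) = e * real_of_int (a j0 i0 * a j0 i0)"
        by simp
      then show ?thesis using True unfolding c1 unit by (simp add: z'_def e_def)
    next
      case False
      then have "real_of_int (z' i) = (\<Sum>j\<in>S. c j * real_of_int (contract i0 (a j0) (a j) i))"
        using that c by (simp add: z'_def)
      also have "\<dots> = (\<Sum>j\<in>S. c j * real_of_int (a j i)
          - c j * real_of_int (a j i0) * (real_of_int (a j0 i0) * real_of_int (a j0 i)))"
        by (intro sum.cong) (auto simp: contract_def algebra_simps)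
      also have "\<dots> = (\<Sum>j\<in>insert j0 S. c1 j * real_of_int (a j i))"
        unfolding c1 e_def by (simp add: sum_subtractf sum_distrib_right mult.assoc)
      finally show ?thesis .
    qed
    then have "\<exists>c'. \<forall>i\<in>insert i0 R. z' i = (\<Sum>j\<in>insert j0 S. c' j * a j i)"
      using R S i0 by (intro tu_solve[OF tu]) auto
    then obtain c' where c': "\<And>i. i \<in> insert i0 R \<Longrightarrow> z' i = (\<Sum>j\<in>insert j0 S. c' j * a j i)"
      by blast
    define e' where "e' = (\<Sum>j\<in>S. c' j * a j i0)"
    have "0 = c' j0 * a j0 i0 + e'"
      using c'[of i0] fin nin by (simp add: z'_def e'_def)
    then have "c' j0 * a j0 i0 = - e'" by linarith
    then have "c' j0 * (a j0 i0 * a j0 i0) = - e' * a j0 i0"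
      by (simp only: mult.assoc[symmetric])
    then have cj0: "c' j0 = - e' * a j0 i0" using unit by simp
    have "z i = (\<Sum>j\<in>S. c' j * contract i0 (a j0) (a j) i)" if i: "i \<in> R" for i
    proof -
      have "z i = z' i" using i R by (auto simp: z'_def)
      also have "\<dots> = (\<Sum>j\<in>S. c' j * a j i) - e' * (a j0 i0 * a j0 i)"
        using c'[of i] i fin nin cj0 by simp
      also have "\<dots> = (\<Sum>j\<in>S. c' j * contract i0 (a j0) (a j) i)"
        unfolding e'_def sum_distrib_right sum_subtractf[symmetric] contract_def
        by (intro sum.cong) (auto simp: algebra_simps)
      finally show ?thesis .
    qed
    then show ?thesis by blast
  qed
  moreover have "contract i0 (a j0) (a j) i = 0" if "j \<in> J" "i \<notin> K - {i0}" for i j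
  proof (cases "i = i0")
    case True
    have "a j i0 * a j0 i0 * a j0 i0 = a j i0 * (a j0 i0 * a j0 i0)" by (simp add: mult.assoc)
    then show ?thesis using True unit by (simp add: contract_def)
  next
    case False
    then show ?thesis using that tu_support[OF tu] by (auto simp: contract_def)
  qed
  ultimately show ?thesis unfolding tu_def by blast
qed

text \<open>Deletion-contraction: the contraction of the last generator determines the measure up to a
  multiple of \<open>single (a j0) 1 - 1\<close>, and the cofactor is supported on the deletion.\<close>
theorem augmentation_filtration:
  fixes a :: "'j \<Rightarrow> nat \<Rightarrow> int"
  assumes "finite J" "finite K" "tu K J a" "keys \<mu> \<subseteq> zlat J a" "vanishes_to_order K k \<mu>"
  shows "\<exists>c. \<mu> = (\<Sum>S\<in>{S. S \<subseteq> J \<and> k \<le> card S}. single 0 (c S) * aug_prod a S)"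
  using assms
proof (induction J arbitrary: K k a \<mu> rule: finite_induct)
  case empty
  have "keys \<mu> \<subseteq> {0}" using empty.prems by (auto simp: zlat_def fun_eq_iff subset_iff)
  then have \<mu>: "\<mu> = single 0 (lookup \<mu> 0)"
    by (intro poly_mapping_eqI) (auto simp: lookup_single when_def in_keys_iff)
  show ?case
  proof (cases "k = 0")
    case True
    have "{S. S \<subseteq> {} \<and> k \<le> card S} = {{} :: 'j set}" using True by auto
    then have "single 0 (lookup \<mu> 0) = (\<Sum>S\<in>{S. S \<subseteq> {} \<and> k \<le> card S}. single 0 (lookup \<mu> 0) * aug_prod a S)"
      by (simp add: aug_prod_def)
    then show ?thesis using \<mu> by (intro exI[of _ "\<lambda>_. lookup \<mu> 0"]) (rule trans)
  next
    case False
    then have "fps_nth (transform K 0 (single 0 (lookup \<mu> 0))) 0 = 0"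
      using empty.prems \<mu> by (simp add: vanishes_to_order_def)
    then have "lookup \<mu> 0 = 0" by (simp add: transform_simps)
    then have "\<mu> = 0" using \<mu> by simp
    then show ?thesis by (intro exI[of _ "\<lambda>_. 0"]) simp
  qed
next
  case (insert j0 J)
  have tuJ: "tu K J a" using insert.prems tu_mono by blast
  have fin: "finite {S. S \<subseteq> J' \<and> k' \<le> card S}" if "J' \<subseteq> insert j0 J" for J' k'
  proof (rule finite_subset)
    show "{S. S \<subseteq> J' \<and> k' \<le> card S} \<subseteq> Pow (insert j0 J)" using that by blast
  qed (use insert.hyps in simp)
  show ?case
  proof (cases "a j0 = 0")
    case True
    then have "keys \<mu> \<subseteq> zlat J a" using insert zlat_insert_zero[of a j0 J] by simp
    then obtain c where c: "\<mu> = (\<Sum>S\<in>{S. S \<subseteq> J \<and> k \<le> card S}. single 0 (c S) * aug_prod a S)"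
      using insert.IH[OF _ tuJ] insert.prems by blast
    have "\<mu> = (\<Sum>S\<in>{S. S \<subseteq> insert j0 J \<and> k \<le> card S}.
        single 0 (if S \<subseteq> J then c S else 0) * aug_prod a S)"
      unfolding c by (intro sum.mono_neutral_cong_left fin) auto
    then show ?thesis by (intro exI[of _ "\<lambda>S. if S \<subseteq> J then c S else 0"])
  next
    case False
    then obtain i0 where nz: "a j0 i0 \<noteq> 0" by (auto simp: fun_eq_iff)
    have i0: "i0 \<in> K" using tu_support[OF insert.prems(2), of j0 i0] nz by auto
    have unit: "a j0 i0 * a j0 i0 = 1" using tu_entry[OF insert.prems(2) _ nz] by simp
    define \<pi> where "\<pi> = contract i0 (a j0)"
    define a' where "a' = (\<lambda>j. \<pi> (a j))"
    have \<pi>_add: "\<pi> 0 = 0" "\<And>x y. \<pi> (x + y) = \<pi> x + \<pi> y"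
      by (simp_all add: \<pi>_def contract_add)
    interpret \<pi>: linear_extension "single 0" "\<lambda>x. single (\<pi> x) (1::complex)"
      by (rule linear_extension_push) fact+
    have tu': "tu (K - {i0}) J a'"
      unfolding a'_def \<pi>_def by (rule tu_contract) (use insert nz in auto)
    have \<pi>_j0: "\<pi> (a j0) = 0"
      using unit by (auto simp: \<pi>_def contract_def fun_eq_iff)
    have \<pi>_linear: "\<exists>K c. \<forall>x. real_of_int (\<pi> x i) = (\<Sum>k\<in>K. c k * real_of_int (x k))" for i
    proof (cases "i = i0")
      case True
      have "\<pi> x i0 = 0" for x using unit by (simp add: \<pi>_def contract_def mult.assoc)
      then show ?thesis using True by (intro exI[of _ "{}"]) auto
    next
      case False
      then show ?thesis
        by (intro exI[of _ "{i, i0}"] exI[of _ "\<lambda>k. if k = i then 1 else - real_of_int (a j0 i0 * a j0 i)"])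
           (auto simp: \<pi>_def contract_def)
    qed
    have keys': "keys (push \<pi> \<mu>) \<subseteq> zlat J a'"
    proof
      fix z assume "z \<in> keys (push \<pi> \<mu>)"
      then obtain x where x: "x \<in> keys \<mu>" "z = \<pi> x"
        using keys_push[of \<pi> \<mu>] by auto
      then have "x \<in> zlat (insert j0 J) a"
        using insert.prems(3) by auto
      from zlat_image[of x "insert j0 J" a \<pi>, OF this \<pi>_linear]
      have "z \<in> zlat (insert j0 J) (\<lambda>j. \<pi> (a j))"
        using x(2) by simp
      then show "z \<in> zlat J a'"
        using zlat_insert_zero[of "\<lambda>j. \<pi> (a j)" j0 J] insert.hyps \<pi>_j0 by (simp add: a'_def)
    qed
    have ord': "vanishes_to_order (K - {i0}) k (push \<pi> \<mu>)"
      unfolding vanishes_to_order_def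
    proof (intro allI impI)
      fix y i assume i: "i < k"
      \<comment> \<open>The image of \<open>y\<close> under the adjoint of the contraction. The
        transform of the pushforward is thus that of \<mu> restricted to dual vectors orthogonal to
        \<open>a j0\<close>, and the order of vanishing is inherited.\<close>
      define y' where "y' = y(i0 := - of_int (a j0 i0) * pair (K - {i0}) (a j0) y)"
      have "pair (K - {i0}) (\<pi> x) y = pair K x y'" for x
      proof -
        have "pair K x y' = of_int (x i0) * y' i0 + pair (K - {i0}) x y'"
          unfolding pair_def using i0 \<open>finite K\<close> by (subst sum.remove[of K i0]) auto
        also have "pair (K - {i0}) x y' = pair (K - {i0}) x y"
          unfolding pair_def by (intro sum.cong) (auto simp: y'_def)
        also have "of_int (x i0) * y' i0 + pair (K - {i0}) x y = pair (K - {i0}) (\<pi> x) y"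
          unfolding pair_def \<pi>_def contract_def y'_def
          by (simp add: sum_distrib_left sum_distrib_right sum_subtractf sum_negf algebra_simps)
        finally show ?thesis by simp
      qed
      then have "transform (K - {i0}) y (push \<pi> \<mu>) = transform K y' \<mu>"
        by (intro transform_push) auto
      then show "fps_nth (transform (K - {i0}) y (push \<pi> \<mu>)) i = 0"
        using insert.prems i by (simp add: vanishes_to_order_def)
    qed
    obtain c where c: "push \<pi> \<mu> = (\<Sum>S\<in>{S. S \<subseteq> J \<and> k \<le> card S}. single 0 (c S) * aug_prod a' S)"
      using insert.IH[OF _ tu' keys' ord'] \<open>finite K\<close> by blast
    define \<nu> where "\<nu> = (\<Sum>S\<in>{S. S \<subseteq> J \<and> k \<le> card S}. single 0 (c S) * aug_prod a S)"
    have push_\<nu>: "push \<pi> \<nu> = push \<pi> \<mu>"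
      unfolding \<nu>_def c a'_def by (rule push_lincomb_aug_prod) fact+
    have keys_\<nu>: "keys \<nu> \<subseteq> zlat (insert j0 J) a"
      unfolding \<nu>_def
    proof (intro order_trans[OF keys_sum_subset] UN_least order_trans[OF keys_single_0_mult])
      fix S assume "S \<in> {S. S \<subseteq> J \<and> k \<le> card S}"
      then show "keys (aug_prod a S) \<subseteq> zlat (insert j0 J) a"
        using insert.hyps by (intro keys_aug_prod_subset) auto
    qed
    have "push \<pi> (\<mu> - \<nu>) = 0"
      using push_\<nu> by (simp add: push_eq_lin \<pi>.lin_diff)
    moreover have "x = \<pi> x + (\<lambda>i. (x i0 * a j0 i0) * a j0 i)" for x
      by (auto simp: \<pi>_def contract_def)
    ultimately have "(single (a j0) 1 - 1) dvd (\<mu> - \<nu>)"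
      by (intro single_minus_one_dvd) auto
    then obtain \<kappa> where \<kappa>: "\<mu> - \<nu> = (single (a j0) 1 - 1) * \<kappa>" by (elim dvdE)
    have "keys (\<mu> - \<nu>) \<subseteq> zlat (insert j0 J) a"
    proof
      fix x assume "x \<in> keys (\<mu> - \<nu>)"
      then have "x \<in> keys \<mu> \<or> x \<in> keys \<nu>" by (auto simp: in_keys_iff lookup_minus)
      then show "x \<in> zlat (insert j0 J) a" using keys_\<nu> insert.prems(3) by blast
    qed
    then have keys_\<kappa>: "keys \<kappa> \<subseteq> zlat J a"
      using keys_quotient_subset_zlat[of a j0 J, OF False insert.hyps(2,1)] by (simp only: \<kappa>)
    have "vanishes_to_order K k \<nu>"
      unfolding vanishes_to_order_def \<nu>_def transform_lincomb
    proof (intro allI impI sum.neutral ballI)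
      fix y i S assume "i < k" "S \<in> {S. S \<subseteq> J \<and> k \<le> card S}"
      then have "finite S" "i < card S" using insert.hyps finite_subset by auto
      then show "c S * fps_nth (transform K y (aug_prod a S)) i = 0"
        by (simp add: fps_nth_transform_aug_prod)
    qed
    then have "vanishes_to_order K k ((single (a j0) 1 - 1) * \<kappa>)"
      using insert.prems unfolding \<kappa>[symmetric] by (simp add: vanishes_to_order_def transform_simps)
    moreover have "pair K (a j0) (\<lambda>i. if i = i0 then 1 else 0) \<noteq> 0"
      using i0 \<open>finite K\<close> nz by (simp add: pair_def if_distrib cong: if_cong)
    \<comment> \<open>Cancelling a factor of order one costs one order, which adjoining
      \<open>j0\<close> to each set restores. For \<open>k = 0\<close> the truncated difference is 0
      and both cardinality bounds are vacuous.\<close>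
    ultimately have "vanishes_to_order K (k - 1) \<kappa>"
      by (intro vanishes_to_order_cancel)
    then obtain c' where c': "\<kappa> = (\<Sum>S\<in>{S. S \<subseteq> J \<and> k - 1 \<le> card S}. single 0 (c' S) * aug_prod a S)"
      using insert.IH[OF \<open>finite K\<close> tuJ keys_\<kappa>] by blast
    \<comment> \<open>Sets containing \<open>j0\<close> take their coefficients from the deletion,
      through \<kappa>; the others take them from the contraction, through \<nu>.\<close>
    define C where "C = (\<lambda>S. if j0 \<in> S then c' (S - {j0}) else c S)"
    define \<S> where "\<S> = {S. S \<subseteq> insert j0 J \<and> k \<le> card S}"
    have "(single (a j0) 1 - 1) * \<kappa> = (\<Sum>S\<in>{S. S \<subseteq> J \<and> k - 1 \<le> card S}. single 0 (c' S) * aug_prod a (insert j0 S))"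
      unfolding c' sum_distrib_left
    proof (rule sum.cong)
      fix S assume "S \<in> {S. S \<subseteq> J \<and> k - 1 \<le> card S}"
      then have "finite S" "j0 \<notin> S" using insert.hyps finite_subset by auto
      then show "(single (a j0) 1 - 1) * (single 0 (c' S) * aug_prod a S) = single 0 (c' S) * aug_prod a (insert j0 S)"
        by (simp add: aug_prod_def mult_ac)
    qed simp
    also have "\<dots> = (\<Sum>S\<in>{S \<in> \<S>. j0 \<in> S}. single 0 (C S) * aug_prod a S)"
    proof (rule sum.reindex_bij_witness[of _ "\<lambda>S. S - {j0}" "insert j0"])
      fix S assume S: "S \<in> {S. S \<subseteq> J \<and> k - 1 \<le> card S}"
      then have f: "finite S" and n: "j0 \<notin> S" using insert.hyps finite_subset by auto
      show "insert j0 S - {j0} = S" using n by auto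
      show "insert j0 S \<in> {S \<in> \<S>. j0 \<in> S}" using S f n by (auto simp: \<S>_def)
      show "single 0 (C (insert j0 S)) * aug_prod a (insert j0 S) = single 0 (c' S) * aug_prod a (insert j0 S)"
        using n by (simp add: C_def)
    next
      fix S assume S: "S \<in> {S \<in> \<S>. j0 \<in> S}"
      then have f: "finite S" using insert.hyps finite_subset by (auto simp: \<S>_def)
      show "insert j0 (S - {j0}) = S" using S by auto
      show "S - {j0} \<in> {S. S \<subseteq> J \<and> k - 1 \<le> card S}" using S f by (auto simp: \<S>_def)
    qed
    finally have A: "(single (a j0) 1 - 1) * \<kappa> = (\<Sum>S\<in>{S \<in> \<S>. j0 \<in> S}. single 0 (C S) * aug_prod a S)" .
    have B: "\<nu> = (\<Sum>S\<in>{S \<in> \<S>. j0 \<notin> S}. single 0 (C S) * aug_prod a S)"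
      unfolding \<nu>_def using insert.hyps by (intro sum.cong) (auto simp: \<S>_def C_def)
    have "\<mu> = \<nu> + (single (a j0) 1 - 1) * \<kappa>" using \<kappa> by (simp add: algebra_simps)
    also have "\<dots> = (\<Sum>S\<in>\<S>. single 0 (C S) * aug_prod a S)"
    proof -
      have "finite \<S>" unfolding \<S>_def by (rule fin) simp
      moreover have "\<S> = {S \<in> \<S>. j0 \<notin> S} \<union> {S \<in> \<S>. j0 \<in> S}" by blast
      ultimately show ?thesis
        unfolding A B by (subst sum.union_disjoint[symmetric]) auto
    qed
    finally show ?thesis unfolding \<S>_def by (intro exI[of _ C])
  qed
qed

section \<open>Unimodular matrices\<close>

text \<open>Columns are selected by a function, in any order and possibly with repetitions, so that
  an exchange of columns is simply a function update.\<close>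

definition col_choice :: "int mat \<Rightarrow> nat \<Rightarrow> (nat \<Rightarrow> nat) \<Rightarrow> int mat" where
  "col_choice A d f = mat d d (\<lambda>(i, k). A $$ (i, f k))"

lemma col_choice_carrier [simp]: "col_choice A d f \<in> carrier_mat d d"
  by (simp add: col_choice_def)

text \<open>A repeated column gives determinant 0; otherwise the columns are those of a maximal
  \<open>submatrix\<close> up to order, which affects only the sign.\<close>

lemma det_col_choice_unimodular:
  assumes A: "A \<in> carrier_mat d n" and uni: "unimodular A" and f: "\<And>k. k < d \<Longrightarrow> f k < n"
  shows "det (col_choice A d f) \<in> {-1, 0, 1}"
proof (cases "inj_on f {..<d}")
  case False
  then obtain k l where kl: "k < d" "l < d" "k \<noteq> l" "f k = f l"
    by (auto simp: inj_on_def)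
  have "col (col_choice A d f) k = col (col_choice A d f) l"
    using kl by (intro eq_vecI) (auto simp: col_choice_def)
  then have "det (col_choice A d f) = 0"
    using kl by (intro det_identical_columns[of _ d k l]) auto
  then show ?thesis by simp
next
  case inj: True
  define J where "J = f ` {..<d}"
  have J: "J \<subseteq> {..<dim_col A}" "card J = dim_row A" "finite J"
    using A f inj by (auto simp: J_def card_image)
  have cardJ: "card {j. j < dim_col A \<and> j \<in> J} = d"
  proof -
    have "{j. j < dim_col A \<and> j \<in> J} = J" using J by auto
    then show ?thesis using J A by simp
  qed
  define M where "M = submatrix A UNIV J"
  have M: "M \<in> carrier_mat d d"
    using A cardJ by (auto simp: M_def dim_submatrix)
  \<comment> \<open>The rank of \<open>f k\<close> within \<open>J\<close>, inverse to
    \<open>pick\<close>; the identity beyond \<open>d\<close> is what \<open>permutes\<close> asks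
    for.\<close>
  define p where "p = (\<lambda>k. if k < d then card {a \<in> J. a < f k} else k)"
  have pick: "pick J (p k) = f k" if "k < d" for k
    using that by (simp add: p_def J_def pick_card_in_set)
  have p_less: "p k < d" if "k < d" for k
  proof -
    have "{a \<in> J. a < f k} \<subset> J" using that by (auto simp: J_def)
    then have "card {a \<in> J. a < f k} < card J" using J by (intro psubset_card_mono)
    then show ?thesis using that J A by (simp add: p_def)
  qed
  have "inj_on p {0..<d}"
    by (rule inj_onI) (metis atLeastLessThan_iff inj inj_on_def lessThan_iff pick)
  then have "bij_betw p {0..<d} {0..<d}"
    using p_less by (intro bij_betw_imageI endo_inj_surj) auto
  then have perm: "p permutes {0..<d}"
    by (rule bij_imp_permutes) (auto simp: p_def)
  have "transpose_mat (col_choice A d f) = mat d d (\<lambda>(i, j). transpose_mat M $$ (p i, j))"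
  proof (rule eq_matI)
    fix i j assume "i < dim_row (mat d d (\<lambda>(i, j). transpose_mat M $$ (p i, j)))"
      "j < dim_col (mat d d (\<lambda>(i, j). transpose_mat M $$ (p i, j)))"
    then have ij: "i < d" "j < d" by auto
    have "M $$ (j, p i) = A $$ (pick UNIV j, pick J (p i))"
      unfolding M_def using ij A cardJ p_less by (intro submatrix_index) auto
    then show "transpose_mat (col_choice A d f) $$ (i, j)
        = mat d d (\<lambda>(i, j). transpose_mat M $$ (p i, j)) $$ (i, j)"
      using ij M p_less by (simp add: col_choice_def pick pick_UNIV)
  qed (auto simp: col_choice_def)
  then have "det (col_choice A d f) = signof p * det M"
    using det_permute_rows[of "transpose_mat M" d p] perm M
    by (metis col_choice_carrier det_transpose transpose_carrier_mat)
  moreover have "det M \<in> {-1, 0, 1}"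
    using uni J unfolding unimodular_def M_def by blast
  moreover have "signof p \<in> {-1, 1 :: int}"
    by (auto simp: sign_def)
  ultimately show ?thesis by auto
qed

lemma ex_col_choice_det_nonzero:
  assumes A: "A \<in> carrier_mat d n" and uni: "unimodular A"
  shows "\<exists>f. (\<forall>k<d. f k < n) \<and> det (col_choice A d f) \<noteq> 0"
proof -
  interpret vec_space "TYPE(real)" d .
  define R where "R = map_mat real_of_int A"
  have R: "R \<in> carrier_mat d n" using A by (simp add: R_def)
  have rank: "rank R = d" using uni A by (auto simp: unimodular_def R_def)
  obtain S where S: "maximal S (\<lambda>T. T \<subseteq> set (cols R) \<and> lin_indpt T)" "finite S"
    using maximal_exists_superset[of "set (cols R)" "\<lambda>T. T \<subseteq> set (cols R) \<and> lin_indpt T" "{}"]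
    by (auto simp: lin_dep_def)
  then have S_sub: "S \<subseteq> set (cols R)" "lin_indpt S" by (auto simp: maximal_def)
  have "card S = d" using rank_card_indpt[OF R S(1)] rank by simp
  then obtain xs where xs: "set xs = S" "distinct xs" "length xs = d"
    using finite_distinct_list[OF S(2)] distinct_card by metis
  have "\<exists>j<n. xs ! k = col R j" if "k < d" for k
  proof -
    have "xs ! k \<in> set (cols R)" using that xs S_sub nth_mem by blast
    then show ?thesis using R by (auto simp: cols_def)
  qed
  then obtain f where f: "\<And>k. k < d \<Longrightarrow> f k < n \<and> xs ! k = col R (f k)" by metis
  have xs_carrier: "set xs \<subseteq> carrier_vec d"
    using xs(1) S_sub(1) cols_dim[of R] R by auto
  have eq: "map_mat real_of_int (col_choice A d f) = mat_of_cols d xs"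
    using f A xs by (intro eq_matI) (auto simp: col_choice_def mat_of_cols_def R_def)
  have car: "mat_of_cols d xs \<in> carrier_mat d d" using xs by auto
  have "rank (mat_of_cols d xs) = d"
    using xs S_sub xs_carrier car by (intro lin_indpt_full_rank) auto
  then have "det (map_mat real_of_int (col_choice A d f)) \<noteq> 0"
    using det_rank_iff[OF car] eq by simp
  then have "det (col_choice A d f) \<noteq> 0" by (simp add: of_int_hom.hom_det)
  then show ?thesis using f by blast
qed

text \<open>As \<open>det M\<close> squares to 1, \<open>det M\<close> times the adjugate is an
  integral two-sided inverse.\<close>

lemma unit_det_inverse:
  fixes M :: "int mat"
  assumes M: "M \<in> carrier_mat d d" and det: "det M \<in> {-1, 1}"
  obtains N where "\<And>i l. i < d \<Longrightarrow> l < d \<Longrightarrow> (\<Sum>k<d. M $$ (i, k) * N k l) = (if i = l then 1 else 0)"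
    and "\<And>i l. i < d \<Longrightarrow> l < d \<Longrightarrow> (\<Sum>k<d. N i k * M $$ (k, l)) = (if i = l then 1 else 0)"
proof
  define N where "N = (\<lambda>k l. det M * adj_mat M $$ (k, l))"
  have unit: "det M * det M = 1" using det by auto
  note adj = adj_mat[OF M]
  fix i l assume il: "i < d" "l < d"
  have "(M * adj_mat M) $$ (i, l) = (if i = l then det M else 0)"
    unfolding adj using il by simp
  then have "(\<Sum>k<d. M $$ (i, k) * adj_mat M $$ (k, l)) = (if i = l then det M else 0)"
    using il M adj(1) by (simp add: scalar_prod_def lessThan_atLeast0)
  then have "det M * (\<Sum>k<d. M $$ (i, k) * adj_mat M $$ (k, l)) = (if i = l then 1 else 0)"
    using unit by simp
  then show "(\<Sum>k<d. M $$ (i, k) * N k l) = (if i = l then 1 else 0)"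
    by (simp add: N_def sum_distrib_left mult_ac)
  have "(adj_mat M * M) $$ (i, l) = (if i = l then det M else 0)"
    unfolding adj using il by simp
  then have "(\<Sum>k<d. adj_mat M $$ (i, k) * M $$ (k, l)) = (if i = l then det M else 0)"
    using il M adj(1) by (simp add: scalar_prod_def lessThan_atLeast0)
  then have "det M * (\<Sum>k<d. adj_mat M $$ (i, k) * M $$ (k, l)) = (if i = l then 1 else 0)"
    using unit by simp
  then show "(\<Sum>k<d. N i k * M $$ (k, l)) = (if i = l then 1 else 0)"
    by (simp add: N_def sum_distrib_left mult_ac)
qed

lemma sum_matrix_product:
  fixes M N :: "nat \<Rightarrow> nat \<Rightarrow> 'a::comm_ring_1"
  assumes "\<And>l. l < d \<Longrightarrow> (\<Sum>k<d. M i k * N k l) = (if i = l then 1 else 0)" "i < d"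
  shows "(\<Sum>k<d. M i k * (\<Sum>l<d. N k l * x l)) = x i"
proof -
  have "(\<Sum>k<d. M i k * (\<Sum>l<d. N k l * x l)) = (\<Sum>l<d. (\<Sum>k<d. M i k * N k l) * x l)"
    unfolding sum_distrib_left sum_distrib_right by (subst sum.swap) (simp add: mult_ac)
  also have "\<dots> = (\<Sum>l<d. if i = l then x l else 0)"
    using assms by (intro sum.cong) auto
  finally show ?thesis using assms(2) by simp
qed

text \<open>Among the column bases choose one meeting \<open>S\<close> in as many columns as possible: then every
  column of \<open>S\<close>, hence \<open>z\<close>, only involves basis columns from \<open>S\<close>, and Cramer's rule gives
  integral coordinates.\<close>
lemma unimodular_solve:
  assumes A: "A \<in> carrier_mat d n" and uni: "unimodular A" and S: "S \<subseteq> {..<n}"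
    and z: "\<And>i. i < d \<Longrightarrow> real_of_int (z i) = (\<Sum>j\<in>S. c j * real_of_int (A $$ (i, j)))"
  shows "\<exists>c'. \<forall>i<d. z i = (\<Sum>j\<in>S. c' j * A $$ (i, j))"
proof -
  define P where "P = (\<lambda>f. (\<forall>k<d. f k < n) \<and> det (col_choice A d f) \<noteq> 0)"
  define w where "w = (\<lambda>f::nat \<Rightarrow> nat. card {k \<in> {..<d}. f k \<in> S})"
  obtain f0 where "P f0" using ex_col_choice_det_nonzero[OF A uni] by (auto simp: P_def)
  moreover have "\<forall>f. P f \<longrightarrow> w f \<le> d"
  proof (intro allI impI)
    fix f :: "nat \<Rightarrow> nat"
    show "w f \<le> d" unfolding w_def using card_mono[of "{..<d}" "{k \<in> {..<d}. f k \<in> S}"] by auto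
  qed
  ultimately obtain f where f: "P f" and max: "\<And>g. P g \<Longrightarrow> w g \<le> w f"
    using ex_has_greatest_nat[of P f0 w "Suc d"] by (auto simp: less_Suc_eq_le)
  define M where "M = col_choice A d f"
  have M: "M \<in> carrier_mat d d" by (simp add: M_def)
  have M_index: "M $$ (i, k) = A $$ (i, f k)" if "i < d" "k < d" for i k
    using that by (simp add: M_def col_choice_def)
  have "det M \<in> {-1, 1}"
    using det_col_choice_unimodular[OF A uni, of f] f by (auto simp: P_def M_def)
  then obtain N where MN: "\<And>i l. i < d \<Longrightarrow> l < d \<Longrightarrow> (\<Sum>k<d. M $$ (i, k) * N k l) = (if i = l then 1 else 0)"
    and NM: "\<And>i l. i < d \<Longrightarrow> l < d \<Longrightarrow> (\<Sum>k<d. N i k * M $$ (k, l)) = (if i = l then 1 else 0)"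
    by (rule unit_det_inverse[OF M]) (rule that)
  have basis: "v i = (\<Sum>k<d. A $$ (i, f k) * (\<Sum>l<d. N k l * v l))" if "i < d" for v i
  proof -
    have "(\<Sum>k<d. M $$ (i, k) * (\<Sum>l<d. N k l * v l)) = v i"
      using MN that by (intro sum_matrix_product[where M = "\<lambda>i k. M $$ (i, k)"]) auto
    then show ?thesis using that by (simp add: M_index)
  qed
  \<comment> \<open>By Cramer's rule this coordinate is, up to the unit \<open>det M\<close>, the
    determinant after replacing the column in position \<open>k\<close> by \<open>s\<close>. Were it
    nonzero, the new basis would have one more position with a column in \<open>S\<close>.\<close>
  have exchange: "(\<Sum>l<d. N k l * A $$ (l, s)) = 0" if k: "k < d" "f k \<notin> S" and s: "s \<in> S" for k s
  proof (rule ccontr)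
    assume nz: "(\<Sum>l<d. N k l * A $$ (l, s)) \<noteq> 0"
    define x where "x = vec d (\<lambda>k. \<Sum>l<d. N k l * A $$ (l, s))"
    have "col_choice A d (f(k := s)) = replace_col M (M *\<^sub>v x) k"
    proof (rule eq_matI)
      fix i l assume "i < dim_row (replace_col M (M *\<^sub>v x) k)" "l < dim_col (replace_col M (M *\<^sub>v x) k)"
      then have il: "i < d" "l < d" using M by (auto simp: replace_col_def)
      have "(M *\<^sub>v x) $ i = (\<Sum>k<d. M $$ (i, k) * (\<Sum>l<d. N k l * A $$ (l, s)))"
        using il M by (simp add: x_def scalar_prod_def lessThan_atLeast0)
      also have "\<dots> = A $$ (i, s)"
        using basis[of i "\<lambda>l. A $$ (l, s)"] il by (simp add: M_index)
      finally show "col_choice A d (f(k := s)) $$ (i, l) = replace_col M (M *\<^sub>v x) k $$ (i, l)"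
        using il M by (simp add: replace_col_def col_choice_def M_index)
    qed (use M in \<open>auto simp: replace_col_def col_choice_def\<close>)
    then have "det (col_choice A d (f(k := s))) = x $ k * det M"
      using cramer_lemma_mat[OF M, of x k] k by (simp add: x_def)
    then have "P (f(k := s))"
      using f nz k s S by (auto simp: P_def x_def M_def)
    then have "w (f(k := s)) \<le> w f" by (rule max)
    moreover have "{k' \<in> {..<d}. (f(k := s)) k' \<in> S} = insert k {k' \<in> {..<d}. f k' \<in> S}"
      using k s by auto
    ultimately show False using k by (simp add: w_def)
  qed
  define q where "q = (\<lambda>k. \<Sum>l<d. N k l * z l)"
  have q0: "q k = 0" if k: "k < d" "f k \<notin> S" for k
  proof -
    have "real_of_int (q k) = (\<Sum>l<d. real_of_int (N k l) * (\<Sum>j\<in>S. c j * real_of_int (A $$ (l, j))))"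
      by (simp add: q_def z)
    also have "\<dots> = (\<Sum>j\<in>S. c j * real_of_int (\<Sum>l<d. N k l * A $$ (l, j)))"
      unfolding sum_distrib_left of_int_sum by (subst sum.swap) (simp add: mult_ac)
    also have "\<dots> = 0" using exchange[OF k] by simp
    finally show ?thesis by simp
  qed
  have "z i = (\<Sum>j\<in>S. (\<Sum>k\<in>{k \<in> {..<d}. f k = j}. q k) * A $$ (i, j))" if i: "i < d" for i
  proof -
    have "finite S" using S finite_subset by auto
    have "z i = (\<Sum>k<d. A $$ (i, f k) * q k)" using basis[OF i, of z] by (simp add: q_def)
    also have "\<dots> = (\<Sum>k\<in>{k \<in> {..<d}. f k \<in> S}. A $$ (i, f k) * q k)"
      using q0 by (intro sum.mono_neutral_right) auto
    also have "\<dots> = (\<Sum>j\<in>S. \<Sum>k\<in>{k \<in> {k \<in> {..<d}. f k \<in> S}. f k = j}. A $$ (i, f k) * q k)"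
      using \<open>finite S\<close> by (intro sum.group[symmetric]) auto
    also have "\<dots> = (\<Sum>j\<in>S. (\<Sum>k\<in>{k \<in> {..<d}. f k = j}. q k) * A $$ (i, j))"
      unfolding sum_distrib_right by (intro sum.cong) auto
    finally show ?thesis .
  qed
  then show ?thesis by (intro exI[of _ "\<lambda>j. \<Sum>k\<in>{k \<in> {..<d}. f k = j}. q k"]) blast
qed

section \<open>Change of lattice basis and repeated columns\<close>

definition mat_app :: "nat \<Rightarrow> (nat \<Rightarrow> nat \<Rightarrow> int) \<Rightarrow> (nat \<Rightarrow> int) \<Rightarrow> (nat \<Rightarrow> int)" where
  "mat_app d N x = (\<lambda>i. if i < d then \<Sum>l<d. N i l * x l else 0)"

lemma mat_app_0 [simp]: "mat_app d N 0 = 0"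
  by (auto simp: mat_app_def)

lemma mat_app_add: "mat_app d N (x + y) = mat_app d N x + mat_app d N y"
  by (auto simp: mat_app_def distrib_left sum.distrib)

definition mat_col :: "int mat \<Rightarrow> nat \<Rightarrow> nat \<Rightarrow> int" where
  "mat_col A j i = (if i < dim_row A then A $$ (i, j) else 0)"

text \<open>\<open>B\<close> is a column basis and \<open>N\<close> its inverse: the basis columns become unit vectors, so discarding
  a row amounts to adding a column to the system.\<close>
lemma unimodular_imp_tu:
  assumes A: "A \<in> carrier_mat d n" and uni: "unimodular A"
  shows "\<exists>B N. (\<forall>x. (\<forall>i\<ge>d. x i = 0) \<longrightarrow> mat_app d B (mat_app d N x) = x) \<and>
    tu {..<d} {..<n} (\<lambda>j. mat_app d N (mat_col A j))"
proof -
  obtain f where f: "\<forall>k<d. f k < n" "det (col_choice A d f) \<noteq> 0"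
    using ex_col_choice_det_nonzero[OF A uni] by blast
  define M where "M = col_choice A d f"
  have M: "M \<in> carrier_mat d d" by (simp add: M_def)
  have M_index: "M $$ (i, k) = A $$ (i, f k)" if "i < d" "k < d" for i k
    using that by (simp add: M_def col_choice_def)
  have "det M \<in> {-1, 1}"
    using det_col_choice_unimodular[OF A uni, of f] f by (auto simp: M_def)
  then obtain N where MN: "\<And>i l. i < d \<Longrightarrow> l < d \<Longrightarrow> (\<Sum>k<d. M $$ (i, k) * N k l) = (if i = l then 1 else 0)"
    and NM: "\<And>i l. i < d \<Longrightarrow> l < d \<Longrightarrow> (\<Sum>k<d. N i k * M $$ (k, l)) = (if i = l then 1 else 0)"
    by (rule unit_det_inverse[OF M]) (rule that)
  define a where "a = (\<lambda>j. mat_app d N (mat_col A j))"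
  have a: "a j i = (\<Sum>l<d. N i l * A $$ (l, j))" if "i < d" for i j
    using that A by (auto simp: a_def mat_app_def mat_col_def intro!: sum.cong)
  have A_a: "A $$ (i, j) = (\<Sum>k<d. M $$ (i, k) * a j k)" if "i < d" for i j
    using sum_matrix_product[where M = "\<lambda>i k. M $$ (i, k)" and i = i and d = d and N = N
        and x = "\<lambda>l. A $$ (l, j)"] MN that
    by (simp add: a)
  have a_basis: "a (f k) i = (if i = k then 1 else 0)" if "i < d" "k < d" for i k
  proof -
    have "a (f k) i = (\<Sum>l<d. N i l * M $$ (l, k))" using that by (simp add: a M_index)
    then show ?thesis using NM that by simp
  qed
  have "mat_app d (\<lambda>i k. M $$ (i, k)) (mat_app d N x) = x" if "\<forall>i\<ge>d. x i = 0" for x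
  proof
    fix i
    show "mat_app d (\<lambda>i k. M $$ (i, k)) (mat_app d N x) i = x i"
      using sum_matrix_product[where M = "\<lambda>i k. M $$ (i, k)" and i = i and d = d and N = N and x = x]
        MN that by (auto simp: mat_app_def)
  qed
  moreover have "tu {..<d} {..<n} a"
    unfolding tu_def
  proof (intro conjI ballI allI impI)
    fix j i assume "i \<notin> {..<d}"
    then show "a j i = 0" by (simp add: a_def mat_app_def)
  next
    fix R S z
    assume R: "R \<subseteq> {..<d}" and S: "S \<subseteq> {..<n}"
      and "\<exists>c. \<forall>i\<in>R. real_of_int (z i) = (\<Sum>j\<in>S. c j * real_of_int (a j i))"
    then obtain c where c: "\<And>i. i \<in> R \<Longrightarrow> real_of_int (z i) = (\<Sum>j\<in>S. c j * real_of_int (a j i))"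
      by blast
    define z' where "z' = (\<lambda>i. if i \<in> R then z i else 0)"
    define T where "T = f ` ({..<d} - R)"
    have fin: "finite S" "finite T" using S finite_subset by (auto simp: T_def)
    have inj: "inj_on f {..<d}"
    proof (rule inj_onI)
      fix k l assume "k \<in> {..<d}" "l \<in> {..<d}" "f k = f l"
      then have "(if k = k then 1 else 0) = (if k = l then 1 else 0 :: int)"
        using a_basis[of k k] a_basis[of k l] by simp
      then show "k = l" by (simp split: if_splits)
    qed
    define r where "r = (\<lambda>i. \<Sum>j\<in>S. c j * real_of_int (a j i))"
    \<comment> \<open>The unit vectors in \<open>T\<close> remove the residues \<open>r k\<close> in
      the rows outside \<open>R\<close>. \<open>S\<close> and \<open>T\<close> may overlap, in which
      case a common column carries both coefficients.\<close>
    define e where "e = (\<lambda>j. (if j \<in> S then c j else 0) -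
        (\<Sum>k\<in>{k \<in> {..<d} - R. f k = j}. r k))"
    have "(\<Sum>j\<in>S \<union> T. e j * real_of_int (a j i)) = real_of_int (z' i)" if i: "i < d" for i
    proof -
      have "(\<Sum>j\<in>S \<union> T. e j * real_of_int (a j i))
         = (\<Sum>j\<in>S \<union> T. (if j \<in> S then c j else 0) * real_of_int (a j i))
           - (\<Sum>j\<in>S \<union> T. \<Sum>k\<in>{k \<in> {..<d} - R. f k = j}. r k * real_of_int (a (f k) i))"
        unfolding sum_subtractf[symmetric]
        by (intro sum.cong refl) (simp add: e_def left_diff_distrib sum_distrib_right)
      also have "(\<Sum>j\<in>S \<union> T. (if j \<in> S then c j else 0) * real_of_int (a j i)) = r i"
        unfolding r_def using fin by (intro sum.mono_neutral_cong_right) auto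
      also have "(\<Sum>j\<in>S \<union> T. \<Sum>k\<in>{k \<in> {..<d} - R. f k = j}. r k * real_of_int (a (f k) i))
         = (\<Sum>k\<in>{..<d} - R. r k * real_of_int (a (f k) i))"
        using fin by (intro sum.group) (auto simp: T_def)
      also have "\<dots> = (\<Sum>k\<in>{..<d} - R. if k = i then r i else 0)"
        using i by (intro sum.cong) (auto simp: a_basis)
      also have "\<dots> = (if i \<in> R then 0 else r i)" using i by simp
      finally show ?thesis using c by (simp add: r_def z'_def)
    qed
    \<comment> \<open>Multiplying by \<open>M\<close> returns to the columns of \<open>A\<close>,
      where the condition on maximal minors applies.\<close>
    then have "real_of_int (\<Sum>k<d. M $$ (i, k) * z' k) = (\<Sum>j\<in>S \<union> T. e j * real_of_int (A $$ (i, j)))"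
      if "i < d" for i
    proof -
      have "(\<Sum>j\<in>S \<union> T. e j * real_of_int (A $$ (i, j)))
          = (\<Sum>k<d. real_of_int (M $$ (i, k)) * (\<Sum>j\<in>S \<union> T. e j * real_of_int (a j k)))"
        using that unfolding sum_distrib_left
        by (subst sum.swap) (simp add: A_a sum_distrib_left mult_ac)
      also have "\<dots> = (\<Sum>k<d. real_of_int (M $$ (i, k)) * real_of_int (z' k))"
        using \<open>\<And>i. i < d \<Longrightarrow> (\<Sum>j\<in>S \<union> T. e j * real_of_int (a j i)) = real_of_int (z' i)\<close> by simp
      finally show ?thesis by simp
    qed
    then have "\<exists>c'. \<forall>i<d. (\<Sum>k<d. M $$ (i, k) * z' k) = (\<Sum>j\<in>S \<union> T. c' j * A $$ (i, j))"
      using S f by (intro unimodular_solve[OF A uni]) (auto simp: T_def)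
    then obtain c' where c': "\<And>i. i < d \<Longrightarrow> (\<Sum>k<d. M $$ (i, k) * z' k) = (\<Sum>j\<in>S \<union> T. c' j * A $$ (i, j))"
      by blast
    have "z i = (\<Sum>j\<in>S. c' j * a j i)" if i: "i \<in> R" for i
    proof -
      have id: "i < d" using i R by auto
      have "z i = (\<Sum>l<d. N i l * (\<Sum>k<d. M $$ (l, k) * z' k))"
        using sum_matrix_product[where M = N and N = "\<lambda>l k. M $$ (l, k)" and i = i and d = d and x = z']
          NM id i by (simp add: z'_def)
      also have "\<dots> = (\<Sum>l<d. N i l * (\<Sum>j\<in>S \<union> T. c' j * A $$ (l, j)))"
        using c' by simp
      also have "\<dots> = (\<Sum>j\<in>S \<union> T. c' j * a j i)"
        unfolding sum_distrib_left by (subst sum.swap) (simp add: a[OF id] sum_distrib_left mult_ac)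
      \<comment> \<open>The added columns are unit vectors for rows outside \<open>R\<close>, so
        they vanish in row \<open>i\<close>.\<close>
      also have "\<dots> = (\<Sum>j\<in>S. c' j * a j i)"
        using fin id i by (intro sum.mono_neutral_right) (auto simp: T_def a_basis split: if_splits)
      finally show ?thesis .
    qed
    then show "\<exists>c. \<forall>i\<in>R. z i = (\<Sum>j\<in>S. c j * a j i)" by blast
  qed
  ultimately show ?thesis unfolding a_def by blast
qed

text \<open>Real coefficients are summed over each fibre of \<open>g\<close>; an integral solution
  is put on one representative of each fibre. This admits the repeated columns of a
  dilation.\<close>

lemma tu_reindex:
  assumes tu: "tu K I b" and g: "g ` J \<subseteq> I" and J: "finite J"
  shows "tu K J (\<lambda>j. b (g j))"
  unfolding tu_def
proof (intro conjI ballI allI impI)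
  fix j i assume "j \<in> J" "i \<notin> K"
  then show "b (g j) i = 0" using tu_support[OF tu] g by auto
next
  fix R S z
  assume R: "R \<subseteq> K" and S: "S \<subseteq> J"
    and "\<exists>c. \<forall>i\<in>R. real_of_int (z i) = (\<Sum>j\<in>S. c j * real_of_int (b (g j) i))"
  then obtain c where c: "\<And>i. i \<in> R \<Longrightarrow> real_of_int (z i) = (\<Sum>j\<in>S. c j * real_of_int (b (g j) i))"
    by blast
  have fin: "finite S" using S J finite_subset by auto
  have eq: "real_of_int (z i) = (\<Sum>k\<in>g ` S. (\<Sum>j\<in>{j \<in> S. g j = k}. c j) * real_of_int (b k i))" if "i \<in> R" for i
  proof -
    have "real_of_int (z i) = (\<Sum>k\<in>g ` S. \<Sum>j\<in>{j \<in> S. g j = k}. c j * real_of_int (b (g j) i))"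
      unfolding c[OF that] using fin by (rule sum.image_gen)
    then show ?thesis by (simp add: sum_distrib_right)
  qed
  have gS: "g ` S \<subseteq> I" using S g by auto
  have "\<exists>c'. \<forall>i\<in>R. z i = (\<Sum>k\<in>g ` S. c' k * b k i)"
    by (rule tu_solve[OF tu R gS eq])
  then obtain c' where c': "\<And>i. i \<in> R \<Longrightarrow> z i = (\<Sum>k\<in>g ` S. c' k * b k i)" by blast
  define \<sigma> where "\<sigma> = inv_into S g"
  have \<sigma>: "\<sigma> k \<in> S" "g (\<sigma> k) = k" if "k \<in> g ` S" for k
    using that by (auto simp: \<sigma>_def inv_into_into f_inv_into_f)
  have "z i = (\<Sum>j\<in>S. (if j = \<sigma> (g j) then c' (g j) else 0) * b (g j) i)" if "i \<in> R" for i
  proof -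
    have "(\<Sum>j\<in>S. (if j = \<sigma> (g j) then c' (g j) else 0) * b (g j) i)
      = (\<Sum>j\<in>{j \<in> S. j = \<sigma> (g j)}. c' (g j) * b (g j) i)"
      by (rule sum.mono_neutral_cong_right) (use fin in auto)
    also have "\<dots> = (\<Sum>k\<in>g ` S. c' k * b k i)"
      by (rule sum.reindex_bij_witness[of _ \<sigma> g]) (use \<sigma> in auto)
    finally show ?thesis using c'[OF that] by simp
  qed
  then show "\<exists>c. \<forall>i\<in>R. z i = (\<Sum>j\<in>S. c j * b (g j) i)"
    by (intro exI[of _ "\<lambda>j. if j = \<sigma> (g j) then c' (g j) else 0"]) blast
qed

text \<open>The measure is transported by the integral matrix \<open>N\<close> to a
  \<open>tu\<close> family, expanded there, and transported back by \<open>B\<close>. The two maps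
  cancel on vectors vanishing beyond \<open>d\<close>, hence on the support of \<mu>.\<close>

theorem unimodular_augmentation_filtration:
  fixes g :: "'j \<Rightarrow> nat"
  assumes A: "A \<in> carrier_mat d n" and uni: "unimodular A" and J: "finite J" and g: "g ` J \<subseteq> {..<n}"
    and keys: "keys \<mu> \<subseteq> zlat J (\<lambda>j. mat_col A (g j))" and ord: "vanishes_to_order {..<d} k \<mu>"
  shows "\<exists>c. \<mu> = (\<Sum>S\<in>{S. S \<subseteq> J \<and> k \<le> card S}. single 0 (c S) * aug_prod (\<lambda>j. mat_col A (g j)) S)"
proof -
  define a where "a = (\<lambda>j. mat_col A (g j))"
  obtain B N where BN: "\<And>x. \<forall>i\<ge>d. x i = 0 \<Longrightarrow> mat_app d B (mat_app d N x) = x"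
    and tu: "tu {..<d} {..<n} (\<lambda>j. mat_app d N (mat_col A j))"
    using unimodular_imp_tu[OF A uni] by blast
  have tu': "tu {..<d} J (\<lambda>j. mat_app d N (a j))"
    unfolding a_def by (rule tu_reindex[OF tu g J])
  have a0: "a j i = 0" if "i \<ge> d" for i j using that A by (simp add: a_def mat_col_def)
  have mat_linear: "\<exists>K c. \<forall>x. real_of_int (mat_app d N x i) = (\<Sum>k\<in>K. c k * real_of_int (x k))" for i
  proof (cases "i < d")
    case True
    then show ?thesis
      by (intro exI[of _ "{..<d}"] exI[of _ "\<lambda>k. real_of_int (N i k)"]) (simp add: mat_app_def)
  next
    case False
    then show ?thesis by (intro exI[of _ "{}"]) (simp add: mat_app_def)
  qed
  have keys': "keys (push (mat_app d N) \<mu>) \<subseteq> zlat J (\<lambda>j. mat_app d N (a j))"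
  proof
    fix z assume "z \<in> keys (push (mat_app d N) \<mu>)"
    then obtain x where x: "x \<in> keys \<mu>" "z = mat_app d N x" using keys_push[of "mat_app d N" \<mu>] by auto
    then have "x \<in> zlat J a" using keys by (auto simp: a_def)
    from zlat_image[of x J a "mat_app d N", OF this mat_linear]
    show "z \<in> zlat J (\<lambda>j. mat_app d N (a j))" using x by simp
  qed
  have ord': "vanishes_to_order {..<d} k (push (mat_app d N) \<mu>)"
    unfolding vanishes_to_order_def
  proof (intro allI impI)
    fix y i assume i: "i < k"
    \<comment> \<open>Pushing forward by \<open>N\<close> pulls dual vectors back by its
      transpose.\<close>
    have "transform {..<d} y (push (mat_app d N) \<mu>) = transform {..<d} (\<lambda>l. \<Sum>i<d. of_int (N i l) * y i) \<mu>"
    proof (rule transform_push)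
      fix x
      show "pair {..<d} (mat_app d N x) y = pair {..<d} x (\<lambda>l. \<Sum>i<d. of_int (N i l) * y i)"
        unfolding pair_def mat_app_def sum_distrib_left
        by (subst sum.swap) (simp add: sum_distrib_right sum_distrib_left mult_ac)
    qed
    then show "fps_nth (transform {..<d} y (push (mat_app d N) \<mu>)) i = 0"
      using ord i by (simp add: vanishes_to_order_def)
  qed
  obtain c where c: "push (mat_app d N) \<mu>
      = (\<Sum>S\<in>{S. S \<subseteq> J \<and> k \<le> card S}. single 0 (c S) * aug_prod (\<lambda>j. mat_app d N (a j)) S)"
    using augmentation_filtration[OF J _ tu' keys' ord'] by blast
  have "push (mat_app d B) (push (mat_app d N) \<mu>) = push (\<lambda>x. mat_app d B (mat_app d N x)) \<mu>"
    by (rule push_push) (simp_all add: mat_app_add)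
  also have "\<dots> = push (\<lambda>x. x) \<mu>"
  proof (rule push_cong)
    fix x assume "x \<in> keys \<mu>"
    then obtain t where "\<And>i. real_of_int (x i) = (\<Sum>j\<in>J. t j * real_of_int (a j i))"
      using keys by (auto simp: zlat_def a_def)
    then have "real_of_int (x i) = 0" if "i \<ge> d" for i using a0[OF that] by simp
    then show "mat_app d B (mat_app d N x) = x" by (intro BN) auto
  qed
  also have "\<dots> = \<mu>" by (rule push_id)
  finally have "\<mu> = push (mat_app d B) (push (mat_app d N) \<mu>)" by simp
  also have "\<dots> = (\<Sum>S\<in>{S. S \<subseteq> J \<and> k \<le> card S}. single 0 (c S) *
      aug_prod (\<lambda>j. mat_app d B (mat_app d N (a j))) S)"
    unfolding c by (rule push_lincomb_aug_prod) (simp_all add: mat_app_add)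
  also have "(\<lambda>j. mat_app d B (mat_app d N (a j))) = a"
    using BN a0 by auto
  finally have "\<mu> = (\<Sum>S\<in>{S. S \<subseteq> J \<and> k \<le> card S}. single 0 (c S) * aug_prod a S)" .
  then show ?thesis unfolding a_def by (intro exI[of _ c])
qed

section \<open>The differentiation pairing\<close>

definition mfact :: "('v \<Rightarrow>\<^sub>0 nat) \<Rightarrow> complex" where
  "mfact m = (\<Prod>v\<in>keys m. fact (lookup m v))"

lemma mfact_superset: "finite V \<Longrightarrow> keys m \<subseteq> V \<Longrightarrow> mfact m = (\<Prod>v\<in>V. fact (lookup m v))"
  unfolding mfact_def by (rule prod.mono_neutral_left) (auto simp: in_keys_iff)

lemma mfact_nonzero [simp]: "mfact m \<noteq> 0"
  by (simp add: mfact_def)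

lemma lookup_pderiv_var:
  "lookup (pderiv_var v p) m = of_nat (lookup m v + 1) * lookup p (m + single v 1)"
proof -
  have "lookup (pderiv_var v p) m = (\<Sum>m'\<in>keys p.
      lookup (single (m' - single v 1) (of_nat (lookup m' v) * lookup p m')) m)"
    by (simp add: pderiv_var_def lookup_sum)
  also have "\<dots> = (\<Sum>m'\<in>keys p. if m' = m + single v 1 then of_nat (lookup m v + 1) * lookup p m' else 0)"
  proof (rule sum.cong)
    fix m'
    show "lookup (single (m' - single v 1) (of_nat (lookup m' v) * lookup p m')) m
      = (if m' = m + single v 1 then of_nat (lookup m v + 1) * lookup p m' else 0)"
    proof (cases "lookup m' v = 0")
      case True
      then have "m' \<noteq> m + single v 1" by (auto simp: lookup_add)
      then show ?thesis using True by (simp add: lookup_single)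
    next
      case False
      have "m' - single v 1 = m \<longleftrightarrow> m' = m + single v 1"
        using False by (auto simp: poly_mapping_eq_iff fun_eq_iff lookup_add lookup_minus lookup_single when_def)
      then show ?thesis by (auto simp: lookup_single when_def lookup_add)
    qed
  qed simp
  also have "\<dots> = of_nat (lookup m v + 1) * lookup p (m + single v 1)"
    by (subst sum.delta) (auto simp: in_keys_iff)
  finally show ?thesis .
qed

lemma lookup_pderiv_var_power:
  "lookup ((pderiv_var v ^^ k) p) m
    = fact (lookup m v + k) / fact (lookup m v) * lookup p (m + single v k)"
proof (induction k arbitrary: m)
  case (Suc k)
  have "lookup ((pderiv_var v ^^ Suc k) p) m
    = of_nat (lookup m v + 1) * (fact (lookup m v + 1 + k) / fact (lookup m v + 1)
        * lookup p (m + single v 1 + single v k))"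
    by (simp add: lookup_pderiv_var Suc.IH lookup_add)
  also have "m + single v 1 + single v k = m + single v (Suc k)"
    by (simp add: add.assoc flip: single_add)
  finally show ?case
    using of_nat_neq_0[of "lookup m v", where 'a = complex] by (simp add: divide_simps)
qed simp

text \<open>The value at the monomial 0 alone is not inductive, since each derivative shifts the
  exponent; \<open>m\<close> collects the shifts already made in other variables.\<close>

lemma lookup_foldr_pderiv_var:
  assumes "distinct vs" "\<And>v. v \<in> set vs \<Longrightarrow> lookup m v = 0"
  shows "lookup (foldr (\<lambda>v. pderiv_var v ^^ c v) vs f) m
    = (\<Prod>v\<in>set vs. fact (c v)) * lookup f (m + (\<Sum>v\<in>set vs. single v (c v)))"
  using assms
proof (induction vs arbitrary: m)
  case (Cons v vs)
  have "lookup (foldr (\<lambda>v. pderiv_var v ^^ c v) vs f) (m + single v (c v))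
    = (\<Prod>v\<in>set vs. fact (c v)) * lookup f (m + single v (c v) + (\<Sum>v\<in>set vs. single v (c v)))"
    using Cons.prems by (intro Cons.IH) (auto simp: lookup_add lookup_single when_def)
  then show ?case using Cons.prems by (simp add: lookup_pderiv_var_power add.assoc)
qed simp

text \<open>The apolar form: distinct monomials are orthogonal, and a monomial pairs with itself to
  the product of the factorials of its exponents.\<close>

definition pairing :: "'v mpoly \<Rightarrow> 'v mpoly \<Rightarrow> complex" where
  "pairing g f = lin (\<lambda>c. c) (\<lambda>m. mfact m * lookup f m) g"

interpretation pairing: additive_extension "\<lambda>c. c" "\<lambda>m. mfact m * lookup f m" for f
  by standard auto

lemmas pairing_sum = pairing.lin_sum[folded pairing_def]

lemma lookup_diffop_0: "lookup (diffop g f) 0 = pairing g f"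
proof -
  have "lookup (diff_mono m f) 0 = mfact m * lookup f m" for m
    by (simp add: diff_mono_def lookup_foldr_pderiv_var mfact_def flip: poly_mapping_expand)
  then show ?thesis
    by (simp add: diffop_def lookup_sum const_poly_def lookup_single_0_mult pairing_def lin_def)
qed

section \<open>Moments\<close>

definition monos_deg :: "'v set \<Rightarrow> nat \<Rightarrow> ('v \<Rightarrow>\<^sub>0 nat) set" where
  "monos_deg K k = {m. keys m \<subseteq> K \<and> mdeg m = k}"

lemma finite_monos_deg: "finite K \<Longrightarrow> finite (monos_deg K k)"
proof -
  assume K: "finite K"
  have "lookup ` monos_deg K k \<subseteq> {f. \<forall>v. (v \<in> K \<longrightarrow> f v \<in> {..k}) \<and> (v \<notin> K \<longrightarrow> f v = 0)}"
  proof clarify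
    fix m v assume m: "m \<in> monos_deg K k"
    have "v \<notin> keys m" if "v \<notin> K" using m that by (auto simp: monos_deg_def)
    moreover have "lookup m v \<le> k"
    proof (cases "v \<in> keys m")
      case True
      then have "lookup m v \<le> (\<Sum>v\<in>keys m. lookup m v)" by (intro member_le_sum) auto
      then show ?thesis using m by (simp add: monos_deg_def mdeg_def)
    qed (simp add: in_keys_iff)
    ultimately show "(v \<in> K \<longrightarrow> lookup m v \<in> {..k}) \<and> (v \<notin> K \<longrightarrow> lookup m v = 0)"
      by (auto simp: in_keys_iff)
  qed
  then have "finite (lookup ` monos_deg K k)"
    by (rule finite_subset) (rule finite_set_of_finite_funs[OF K finite_atMost])
  then show "finite (monos_deg K k)"
    by (rule finite_imageD) (rule inj_onI, rule poly_mapping_eqI, simp)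
qed

lemma monos_deg_empty: "monos_deg {} k = (if k = 0 then {0} else {})"
  by (auto simp: monos_deg_def)

lemma sum_monos_deg_insert:
  assumes "finite K" "v \<notin> K"
  shows "(\<Sum>m\<in>monos_deg (insert v K) k. h m) = (\<Sum>i\<le>k. \<Sum>m\<in>monos_deg K (k - i). h (single v i + m))"
proof -
  have "(\<Sum>i\<le>k. \<Sum>m\<in>monos_deg K (k - i). h (single v i + m))
    = (\<Sum>(i, m)\<in>(SIGMA i:{..k}. monos_deg K (k - i)). h (single v i + m))"
    using assms(1) by (subst sum.Sigma) (auto simp: finite_monos_deg)
  also have "\<dots> = (\<Sum>m\<in>monos_deg (insert v K) k. h m)"
  proof (rule sum.reindex_bij_witness[of _ "\<lambda>m. (lookup m v, m - single v (lookup m v))"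
        "\<lambda>(i, m). single v i + m"], goal_cases)
    case (1 p)
    then obtain i m where p: "p = (i, m)" "keys m \<subseteq> K" by (auto simp: monos_deg_def)
    then have "lookup m v = 0" using assms(2) by (auto simp: in_keys_iff)
    then show ?case using p by (simp add: lookup_add)
  next
    case (2 p)
    then obtain i m where p: "p = (i, m)" "i \<le> k" "keys m \<subseteq> K" "mdeg m = k - i"
      by (auto simp: monos_deg_def)
    then show ?case
      using Poly_Mapping.keys_add[of "single v i" m] by (auto simp: monos_deg_def mdeg_add split: if_splits)
  next
    case (3 m)
    show ?case
      by (rule poly_mapping_eqI) (auto simp: lookup_add lookup_minus lookup_single when_def)
  next
    case (4 m)
    define m' where "m' = m - single v (lookup m v)"
    have m: "m = single v (lookup m v) + m'"
      unfolding m'_def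
      by (rule poly_mapping_eqI) (auto simp: lookup_add lookup_minus lookup_single when_def)
    have "mdeg m = lookup m v + mdeg m'"
      using arg_cong[OF m, of mdeg] by (simp add: mdeg_add)
    moreover have "keys m' \<subseteq> K"
    proof
      fix u assume "u \<in> keys m'"
      then have "u \<in> keys m" "u \<noteq> v"
        by (auto simp: m'_def in_keys_iff lookup_minus lookup_single when_def split: if_splits)
      then show "u \<in> K" using 4 by (auto simp: monos_deg_def)
    qed
    ultimately show ?case using 4 by (auto simp: monos_deg_def m'_def)
  qed auto
  finally show ?thesis by simp
qed

text \<open>With divided powers the multinomial theorem is the multiplicativity of exp, applied to
  one variable at a time.\<close>

lemma multinomial_exp:
  fixes c :: "'v \<Rightarrow> complex"
  assumes "finite K"
  shows "(\<Sum>v\<in>K. c v) ^ k / fact k = (\<Sum>m\<in>monos_deg K k. monom_val c m / mfact m)"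
  using assms
proof (induction K arbitrary: k rule: finite_induct)
  case empty
  then show ?case by (simp add: monos_deg_empty mfact_def)
next
  case (insert v K)
  have "(\<Sum>u\<in>insert v K. c u) ^ k / fact k = fps_nth (fps_exp (c v) * fps_exp (\<Sum>u\<in>K. c u)) k"
    using insert.hyps by (simp flip: fps_exp_add_mult)
  also have "\<dots> = (\<Sum>i\<le>k. (c v ^ i / fact i) * ((\<Sum>u\<in>K. c u) ^ (k - i) / fact (k - i)))"
    by (simp add: fps_mult_nth atLeast0AtMost)
  also have "\<dots> = (\<Sum>i\<le>k. \<Sum>m\<in>monos_deg K (k - i). (c v ^ i / fact i) * (monom_val c m / mfact m))"
    by (simp only: insert.IH sum_distrib_left)
  also have "\<dots> = (\<Sum>i\<le>k. \<Sum>m\<in>monos_deg K (k - i). monom_val c (single v i + m) / mfact (single v i + m))"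
  proof (intro sum.cong refl)
    fix i m assume "m \<in> monos_deg K (k - i)"
    then have m: "keys m \<subseteq> K" "lookup m v = 0"
      using insert.hyps by (auto simp: monos_deg_def in_keys_iff)
    have "mfact (single v i + m) = (\<Prod>u\<in>insert v K. fact (lookup (single v i + m) u))"
      using insert.hyps m Poly_Mapping.keys_add[of "single v i" m]
      by (intro mfact_superset) (auto split: if_splits)
    also have "\<dots> = fact i * (\<Prod>u\<in>K. fact (lookup (single v i + m) u))"
      using insert.hyps m by (simp add: lookup_add)
    also have "(\<Prod>u\<in>K. fact (lookup (single v i + m) u)) = mfact m"
      unfolding mfact_superset[OF insert.hyps(1) m(1)]
      using insert.hyps by (intro prod.cong) (auto simp: lookup_add lookup_single when_def)
    finally show "(c v ^ i / fact i) * (monom_val c m / mfact m)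
        = monom_val c (single v i + m) / mfact (single v i + m)"
      by (simp add: monom_val_add)
  qed
  also have "\<dots> = (\<Sum>m\<in>monos_deg (insert v K) k. monom_val c m / mfact m)"
    using insert.hyps by (simp add: sum_monos_deg_insert)
  finally show ?case .
qed

definition moment :: "((nat \<Rightarrow> int) \<Rightarrow>\<^sub>0 complex) \<Rightarrow> (nat \<Rightarrow>\<^sub>0 nat) \<Rightarrow> complex" where
  "moment \<mu> m = (\<Sum>x\<in>keys \<mu>. lookup \<mu> x * monom_val (\<lambda>i. of_int (x i)) m)"

interpretation moment: additive_extension "\<lambda>c. c" "moment \<mu>" for \<mu>
  by standard auto

lemma integral_eq_moment:
  "(\<Sum>x\<in>keys \<mu>. lookup \<mu> x * meval q (\<lambda>i. of_int (x i))) = lin (\<lambda>c. c) (moment \<mu>) q"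
  unfolding meval_eq_lin lin_def moment_def sum_distrib_left
  by (subst sum.swap) (simp add: mult_ac)

text \<open>The factor \<open>1 / mfact m\<close> serves two purposes: pairing a form of degree
  \<open>k\<close> with this polynomial integrates the form against \<mu>, and evaluating the
  polynomial at \<open>y\<close> gives the coefficient of degree \<open>k\<close> of the transform.
  It thus links inverse systems to orders of vanishing.\<close>

definition moment_poly :: "nat set \<Rightarrow> nat \<Rightarrow> ((nat \<Rightarrow> int) \<Rightarrow>\<^sub>0 complex) \<Rightarrow> nat mpoly" where
  "moment_poly K k \<mu> = (\<Sum>m\<in>monos_deg K k. single m (moment \<mu> m / mfact m))"

lemma lookup_moment_poly:
  assumes "finite K"
  shows "lookup (moment_poly K k \<mu>) m = (if m \<in> monos_deg K k then moment \<mu> m / mfact m else 0)"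
proof -
  have "lookup (moment_poly K k \<mu>) m
    = (\<Sum>m'\<in>monos_deg K k. if m' = m then moment \<mu> m / mfact m else 0)"
    unfolding moment_poly_def lookup_sum by (rule sum.cong) (auto simp: lookup_single when_def)
  then show ?thesis using assms by (simp add: finite_monos_deg)
qed

lemma meval_moment_poly:
  assumes "finite K"
  shows "meval (moment_poly K k \<mu>) y = fps_nth (transform K y \<mu>) k"
proof -
  have "fps_nth (transform K y \<mu>) k = (\<Sum>x\<in>keys \<mu>. lookup \<mu> x *
      (\<Sum>m\<in>monos_deg K k. monom_val (\<lambda>i. of_int (x i) * y i) m / mfact m))"
    unfolding fps_nth_transform multinomial_exp[OF assms, symmetric] by (simp add: pair_def)
  also have "\<dots> = (\<Sum>m\<in>monos_deg K k. moment \<mu> m / mfact m * monom_val y m)"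
    unfolding monom_val_mult sum_distrib_left
    by (subst sum.swap) (simp add: moment_def sum_divide_distrib sum_distrib_right sum_distrib_left mult_ac)
  also have "\<dots> = meval (moment_poly K k \<mu>) y"
    by (simp add: moment_poly_def meval_simps)
  finally show ?thesis by simp
qed

section \<open>Products of linear forms as leading parts of measures\<close>

definition linform :: "nat set \<Rightarrow> (nat \<Rightarrow> int) \<Rightarrow> nat mpoly" where
  "linform K v = (\<Sum>i\<in>K. single (single i 1) (of_int (v i)))"

lemma meval_linform: "meval (linform K v) y = pair K v y"
  by (simp add: linform_def meval_simps pair_def)

lemma vars_in_linform: "vars_in K (linform K v)"
  unfolding linform_def by (intro vars_in_sum vars_in_single) auto

definition linform_prod :: "nat set \<Rightarrow> ('j \<Rightarrow> nat \<Rightarrow> int) \<Rightarrow> 'j set \<Rightarrow> nat mpoly" where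
  "linform_prod K a S = (\<Prod>s\<in>S. linform K (a s))"

lemma vars_in_linform_prod: "vars_in K (linform_prod K a S)"
  unfolding linform_prod_def by (intro vars_in_prod vars_in_linform)

lemma meval_linform_prod: "meval (linform_prod K a S) y = (\<Prod>s\<in>S. pair K (a s) y)"
  by (simp add: linform_prod_def meval_simps meval_linform)

lemma moment_poly_aug_prod:
  assumes "finite K" "finite S"
  shows "moment_poly K (card S) (aug_prod a S) = linform_prod K a S"
    and "k < card S \<Longrightarrow> moment_poly K k (aug_prod a S) = 0"
  using assms
  by (auto intro!: meval_eqI simp: meval_moment_poly meval_linform_prod fps_nth_transform_aug_prod meval_simps)

section \<open>The inverse system of a zonotope\<close>

definition int_point :: "(nat \<Rightarrow> int) \<Rightarrow> (nat \<Rightarrow> complex)" where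
  "int_point z = (\<lambda>i. complex_of_int (z i))"

text \<open>Integrating against the measure \<open>aug_prod a S\<close> is a product of finite differences, which acts
  on a polynomial of degree \<open>card S\<close> as the product of directional derivatives of its top component.\<close>
lemma pairing_linform_prod_eq_0:
  assumes J: "finite J" and S: "S \<subseteq> J" and K: "finite K"
    and vanish: "\<And>x. x \<in> zlat J a \<Longrightarrow> meval (g + r) (int_point x) = 0"
    and g: "homogeneous e g" "vars_in K g" and r: "vars_in K r" "\<And>m. m \<in> keys r \<Longrightarrow> mdeg m < e"
  shows "pairing g (linform_prod K a S) = 0"
proof -
  have fin: "finite S" using S J finite_subset by blast
  define \<mu> where "\<mu> = aug_prod a S"
  have lp: "linform_prod K a S = moment_poly K (card S) \<mu>"
    using moment_poly_aug_prod(1)[OF K fin] by (simp add: \<mu>_def)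
  show ?thesis
  proof (cases "e = card S")
    case False
    then have "lookup (linform_prod K a S) m = 0" if "m \<in> keys g" for m
      using that g(1) K by (auto simp: lp lookup_moment_poly monos_deg_def homogeneous_def)
    then show ?thesis by (simp add: pairing_def lin_def)
  next
    case True
    have "pairing g (linform_prod K a S) = lin (\<lambda>c. c) (moment \<mu>) g"
      unfolding pairing_def lin_def
      using g True by (intro sum.cong) (auto simp: lp lookup_moment_poly[OF K] monos_deg_def homogeneous_def vars_in_def)
    moreover have "moment \<mu> m = 0" if "m \<in> keys r" for m
    proof -
      have "moment_poly K (mdeg m) \<mu> = 0"
        using moment_poly_aug_prod(2)[OF K fin] r(2)[OF that] True by (simp add: \<mu>_def)
      moreover have "m \<in> monos_deg K (mdeg m)"
        using r(1) that by (auto simp: monos_deg_def vars_in_def)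
      ultimately show ?thesis
        using lookup_moment_poly[OF K, of "mdeg m" \<mu> m] by simp
    qed
    then have "lin (\<lambda>c. c) (moment \<mu>) r = 0" by (simp add: lin_def)
    moreover have "lin (\<lambda>c. c) (moment \<mu>) (g + r) = 0"
      unfolding integral_eq_moment[symmetric]
    proof (intro sum.neutral ballI)
      fix x assume "x \<in> keys \<mu>"
      then have "x \<in> zlat J a" using keys_aug_prod_subset[OF J S] by (auto simp: \<mu>_def)
      then show "lookup \<mu> x * meval (g + r) (\<lambda>i. complex_of_int (x i)) = 0"
        using vanish by (simp add: int_point_def)
    qed
    ultimately show ?thesis by (simp add: moment.lin_add)
  qed
qed

lemma keys_single_mult: "keys (single m c * p) \<subseteq> (\<lambda>m'. m + m') ` keys p"
  for p :: "'m::comm_monoid_add \<Rightarrow>\<^sub>0 complex"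
proof
  fix x assume "x \<in> keys (single m c * p)"
  then obtain u v where "u \<in> keys (single m c)" "v \<in> keys p" "x = u + v"
    using keys_mult[of "single m c" p] by blast
  then show "x \<in> (\<lambda>m'. m + m') ` keys p" by (auto split: if_splits)
qed

lemma linform_prod_in_inverse_system:
  assumes J: "finite J" and S: "S \<subseteq> J" and K: "finite K"
  shows "linform_prod K a S \<in> inverse_system K (gr_ideal K (int_point ` zlat J a))"
  unfolding inverse_system_def
proof (intro CollectI conjI ballI vars_in_linform_prod)
  fix G assume "G \<in> gr_ideal K (int_point ` zlat J a)"
  then obtain k :: nat and h g where G: "G = (\<Sum>i<k. h i * g i)"
    and hg: "\<And>i. i < k \<Longrightarrow> vars_in K (h i) \<and>
      (\<exists>p. g i = topcomp p \<and> p \<in> vanishing_ideal K (int_point ` zlat J a) \<and> p \<noteq> 0)"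
    unfolding gr_ideal_def ideal_gen_def by blast
  have "pairing (h i * g i) (linform_prod K a S) = 0" if i: "i < k" for i
  proof -
    obtain p where p: "g i = topcomp p" "vars_in K p" "p \<noteq> 0"
      "\<And>x. x \<in> zlat J a \<Longrightarrow> meval p (int_point x) = 0"
      using hg[OF i] by (auto simp: vanishing_ideal_def)
    define e where "e = Max (mdeg ` keys p)"
    define r where "r = p - hcomp e p"
    have gi: "g i = hcomp e p" by (simp add: p(1) topcomp_def e_def)
    have r: "mdeg m < e" "m \<in> keys p" if "m \<in> keys r" for m
    proof -
      have m: "m \<in> keys p" "mdeg m \<noteq> e"
        using that by (auto simp: r_def in_keys_iff lookup_minus lookup_hcomp split: if_splits)
      then have "mdeg m \<le> e" unfolding e_def by (intro Max_ge) auto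
      then show "mdeg m < e" "m \<in> keys p" using m by auto
    qed
    have vr: "vars_in K r" using r(2) p(2) by (auto simp: vars_in_def)
    \<comment> \<open>An ideal element is treated monomial by monomial in its multiplier: a monomial
      times \<open>p\<close> still vanishes on the points and has the shifted
      \<open>hcomp e p\<close> as its leading part.\<close>
    have "pairing (single m c * hcomp e p) (linform_prod K a S) = 0" if m: "keys m \<subseteq> K" for m c
    proof (rule pairing_linform_prod_eq_0[OF J S K, where r = "single m c * r" and e = "mdeg m + e"])
      fix x assume x: "x \<in> zlat J a"
      have "single m c * hcomp e p + single m c * r = single m c * p"
        by (simp add: r_def algebra_simps)
      then show "meval (single m c * hcomp e p + single m c * r) (int_point x) = 0"
        using p(4)[OF x] by (simp add: meval_simps)
    next
      show "homogeneous (mdeg m + e) (single m c * hcomp e p)"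
        using keys_single_mult[of m c "hcomp e p"]
        by (auto simp: homogeneous_def keys_hcomp mdeg_add)
      show "vars_in K (single m c * hcomp e p)" "vars_in K (single m c * r)"
        using m p(2) vr by (auto intro!: vars_in_mult vars_in_hcomp vars_in_single)
      show "mdeg m' < mdeg m + e" if "m' \<in> keys (single m c * r)" for m'
        using keys_single_mult[of m c r] r(1) that by (auto simp: mdeg_add)
    qed
    moreover have "h i * g i = (\<Sum>m\<in>keys (h i). single m (lookup (h i) m) * hcomp e p)"
      unfolding gi sum_distrib_right[symmetric] by (simp flip: poly_mapping_expand)
    ultimately show ?thesis
      using hg[OF i] by (simp add: pairing_sum vars_in_def)
  qed
  then show "lookup (diffop G (linform_prod K a S)) 0 = 0"
    by (simp add: lookup_diffop_0 G pairing_sum)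
qed

text \<open>Induction on \<open>X\<close>. A relation \<open>c0\<close> killing the vectors of
  \<open>X\<close> but not that of \<open>x\<close> dictates the weight of \<open>x\<close>, and
  what is left of \<open>b\<close> satisfies the hypothesis for \<open>X\<close>. If there is no
  such relation, \<open>x\<close> does not enlarge the span.\<close>

lemma Fredholm_alternative:
  fixes u :: "'m \<Rightarrow> 'x \<Rightarrow> complex" and b :: "'m \<Rightarrow> complex"
  assumes "finite X" "finite M"
    and "\<And>c. (\<And>x. x \<in> X \<Longrightarrow> (\<Sum>m\<in>M. c m * u m x) = 0) \<Longrightarrow> (\<Sum>m\<in>M. c m * b m) = 0"
  shows "\<exists>w. \<forall>m\<in>M. b m = (\<Sum>x\<in>X. w x * u m x)"
  using assms(1,3)
proof (induction X arbitrary: b rule: finite_induct)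
  case empty
  have "b m0 = 0" if "m0 \<in> M" for m0
    using empty[of "\<lambda>m. if m = m0 then 1 else 0"] assms(2) that
    by (simp add: if_distrib[of "\<lambda>u. u * _"] cong: if_cong)
  then show ?case by simp
next
  case (insert x X)
  show ?case
  proof (cases "\<exists>c. (\<forall>x\<in>X. (\<Sum>m\<in>M. c m * u m x) = 0) \<and> (\<Sum>m\<in>M. c m * u m x) \<noteq> 0")
    case False
    then have "(\<Sum>m\<in>M. c m * b m) = 0" if "\<And>x. x \<in> X \<Longrightarrow> (\<Sum>m\<in>M. c m * u m x) = 0" for c
      using that by (intro insert.prems) auto
    then obtain w where "\<forall>m\<in>M. b m = (\<Sum>x\<in>X. w x * u m x)" using insert.IH by blast
    moreover have "(\<Sum>y\<in>X. (w(x := 0)) y * u m y) = (\<Sum>y\<in>X. w y * u m y)" for m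
      using insert.hyps by (intro sum.cong) auto
    ultimately show ?thesis using insert.hyps by (intro exI[of _ "w(x := 0)"]) simp
  next
    case True
    then obtain c0 where c0: "\<And>y. y \<in> X \<Longrightarrow> (\<Sum>m\<in>M. c0 m * u m y) = 0"
      and nz: "(\<Sum>m\<in>M. c0 m * u m x) \<noteq> 0" by blast
    define \<beta> where "\<beta> = (\<Sum>m\<in>M. c0 m * b m) / (\<Sum>m\<in>M. c0 m * u m x)"
    have "(\<Sum>m\<in>M. c m * (b m - \<beta> * u m x)) = 0" if c: "\<And>y. y \<in> X \<Longrightarrow> (\<Sum>m\<in>M. c m * u m y) = 0" for c
    proof -
      \<comment> \<open>Chosen so that \<open>c - t * c0\<close> also kills the vector of
        \<open>x\<close>.\<close>
      define t where "t = (\<Sum>m\<in>M. c m * u m x) / (\<Sum>m\<in>M. c0 m * u m x)"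
      have lin: "(\<Sum>m\<in>M. (c m - t * c0 m) * v m) = (\<Sum>m\<in>M. c m * v m) - t * (\<Sum>m\<in>M. c0 m * v m)" for v
        by (simp add: left_diff_distrib sum_subtractf sum_distrib_left mult.assoc)
      have "(\<Sum>m\<in>M. (c m - t * c0 m) * b m) = 0"
      proof (rule insert.prems)
        fix y assume "y \<in> insert x X"
        then show "(\<Sum>m\<in>M. (c m - t * c0 m) * u m y) = 0"
          unfolding lin using c c0 nz by (auto simp: t_def)
      qed
      then have "(\<Sum>m\<in>M. c m * b m) = t * (\<Sum>m\<in>M. c0 m * b m)" by (simp add: lin)
      also have "\<dots> = \<beta> * (\<Sum>m\<in>M. c m * u m x)" by (simp add: t_def \<beta>_def)
      finally show ?thesis
        by (simp add: right_diff_distrib sum_subtractf sum_distrib_left mult_ac)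
    qed
    then obtain w where w: "\<forall>m\<in>M. b m - \<beta> * u m x = (\<Sum>x\<in>X. w x * u m x)"
      using insert.IH[of "\<lambda>m. b m - \<beta> * u m x"] by blast
    have "(\<Sum>y\<in>X. (w(x := \<beta>)) y * u m y) = (\<Sum>y\<in>X. w y * u m y)" for m
      using insert.hyps by (intro sum.cong) auto
    then show ?thesis using insert.hyps w
      by (intro exI[of _ "w(x := \<beta>)"]) (auto simp: algebra_simps)
  qed
qed

lemma ideal_gen_sum:
  fixes k :: nat
  assumes "\<And>i. i < k \<Longrightarrow> g i \<in> G"
  shows "(\<Sum>i<k. g i) \<in> ideal_gen V G"
  unfolding ideal_gen_def
  by (rule CollectI, rule exI[of _ k], rule exI[of _ "\<lambda>_. 1"], rule exI[of _ g]) (use assms in simp)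

lemma ideal_gen_superset: "p \<in> G \<Longrightarrow> p \<in> ideal_gen V G"
  using ideal_gen_sum[of 1 "\<lambda>_. p" G V] by simp

text \<open>An element of degree \<open>k\<close> of the inverse system is a functional on polynomials of degree at
  most \<open>k\<close> factoring through the lattice points, so it is given by a measure on them.\<close>
lemma inverse_system_measure:
  assumes J: "finite J" and K: "finite K" and supp: "\<And>j i. j \<in> J \<Longrightarrow> i \<notin> K \<Longrightarrow> a j i = 0"
    and f: "f \<in> inverse_system K (gr_ideal K (int_point ` zlat J a))"
  shows "\<exists>\<mu>. keys \<mu> \<subseteq> zlat J a \<and> vanishes_to_order K k \<mu> \<and> moment_poly K k \<mu> = hcomp k f"
proof -
  define M where "M = (\<Union>i\<le>k. monos_deg K i)"
  have finM: "finite M" using K by (auto simp: M_def finite_monos_deg)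
  have finL: "finite (zlat J a)" using finite_zlat[OF J K supp] .
  \<comment> \<open>The prescribed moments: pairing with \<open>f\<close> in degree \<open>k\<close>
    and zero in lower degrees, which forces the order of vanishing.\<close>
  define b where "b = (\<lambda>m. if mdeg m = k then mfact m * lookup f m else 0)"
  have "(\<Sum>m\<in>M. c m * b m) = 0"
    if c: "\<And>x. x \<in> zlat J a \<Longrightarrow> (\<Sum>m\<in>M. c m * monom_val (int_point x) m) = 0" for c
  proof -
    define p where "p = (\<Sum>m\<in>M. single m (c m))"
    have lookup_p: "lookup p m = (if m \<in> M then c m else 0)" for m
    proof -
      have "lookup p m = (\<Sum>m'\<in>M. if m' = m then c m else 0)"
        unfolding p_def lookup_sum by (rule sum.cong) (auto simp: lookup_single when_def)
      then show ?thesis using finM by simp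
    qed
    have keys_p: "keys p \<subseteq> M" by (auto simp: in_keys_iff lookup_p split: if_splits)
    have "vars_in K p" using keys_p by (auto simp: vars_in_def M_def monos_deg_def)
    moreover have "meval p (int_point x) = 0" if "x \<in> zlat J a" for x
      using c[OF that] by (simp add: p_def meval_simps)
    ultimately have p_van: "p \<in> vanishing_ideal K (int_point ` zlat J a)"
      by (auto simp: vanishing_ideal_def)
    have "(\<Sum>m\<in>M. c m * b m) = (\<Sum>m\<in>M. lookup (hcomp k p) m * (mfact m * lookup f m))"
      by (intro sum.cong) (auto simp: lookup_hcomp lookup_p b_def)
    also have "\<dots> = pairing (hcomp k p) f"
      unfolding pairing_def using finM keys_p
      by (intro pairing.lin_superset[symmetric]) (auto simp: keys_hcomp)
    \<comment> \<open>Either \<open>p\<close> has no part of degree \<open>k\<close>, or that part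
      is its top component and so lies in the ideal annihilating \<open>f\<close>.\<close>
    also have "\<dots> = 0"
    proof (cases "hcomp k p = 0")
      case True
      then show ?thesis by (simp add: pairing_def lin_def)
    next
      case False
      then obtain m where m: "m \<in> keys p" "mdeg m = k"
        using keys_eq_empty[of "hcomp k p"] by (auto simp: keys_hcomp)
      have "Max (mdeg ` keys p) = k"
        using m keys_p by (intro Max_eqI) (auto simp: M_def monos_deg_def)
      then have "topcomp p = hcomp k p" by (simp add: topcomp_def)
      moreover have "p \<noteq> 0" using m by auto
      ultimately have "hcomp k p \<in> {topcomp p | p. p \<in> vanishing_ideal K (int_point ` zlat J a) \<and> p \<noteq> 0}"
        using p_van by (auto intro!: exI[of _ p])
      then have "hcomp k p \<in> gr_ideal K (int_point ` zlat J a)"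
        unfolding gr_ideal_def by (rule ideal_gen_superset)
      then show ?thesis using f by (auto simp: inverse_system_def lookup_diffop_0)
    qed
    finally show ?thesis .
  qed
  then obtain w where w: "\<And>m. m \<in> M \<Longrightarrow> b m = (\<Sum>x\<in>zlat J a. w x * monom_val (int_point x) m)"
    using Fredholm_alternative[OF finL finM, of "\<lambda>m x. monom_val (int_point x) m" b] by blast
  define \<mu> where "\<mu> = (\<Sum>x\<in>zlat J a. single x (w x))"
  have lookup_\<mu>: "lookup \<mu> x = (if x \<in> zlat J a then w x else 0)" for x
  proof -
    have "lookup \<mu> x = (\<Sum>x'\<in>zlat J a. if x' = x then w x else 0)"
      unfolding \<mu>_def lookup_sum by (rule sum.cong) (auto simp: lookup_single when_def)
    then show ?thesis using finL by simp
  qed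
  have keys_\<mu>: "keys \<mu> \<subseteq> zlat J a" by (auto simp: in_keys_iff lookup_\<mu> split: if_splits)
  have moment: "moment \<mu> m = b m" if "m \<in> M" for m
  proof -
    have "moment \<mu> m = (\<Sum>x\<in>zlat J a. lookup \<mu> x * monom_val (int_point x) m)"
      unfolding moment_def int_point_def using finL keys_\<mu>
      by (intro sum.mono_neutral_left) (auto simp: in_keys_iff)
    then show ?thesis using w[OF that] by (simp add: lookup_\<mu>)
  qed
  have "moment_poly K i \<mu> = (if i = k then hcomp k f else 0)" if "i \<le> k" for i
  proof (rule poly_mapping_eqI)
    fix m
    have "m \<in> M" if "m \<in> monos_deg K i" using that \<open>i \<le> k\<close> by (auto simp: M_def)
    moreover have "lookup f m = 0" if "\<not> keys m \<subseteq> K"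
      using f that by (auto simp: inverse_system_def vars_in_def in_keys_iff)
    ultimately show "lookup (moment_poly K i \<mu>) m = lookup (if i = k then hcomp k f else 0) m"
      using lookup_moment_poly[OF K, of i \<mu> m] moment[of m]
      by (auto simp: lookup_hcomp b_def monos_deg_def)
  qed
  then have "vanishes_to_order K k \<mu>" "moment_poly K k \<mu> = hcomp k f"
    by (auto simp: vanishes_to_order_def meval_moment_poly[OF K, symmetric] meval_simps)
  then show ?thesis using keys_\<mu> by blast
qed

text \<open>For the inclusion into the span, each component of \<open>f\<close> is handled
  separately: in the expansion of its measure, sets with more than \<open>k\<close> elements vanish
  to higher order and only those with exactly \<open>k\<close> reach degree
  \<open>k\<close>.\<close>

theorem inverse_system_zonotope:
  fixes g :: "'j \<Rightarrow> nat"
  assumes A: "A \<in> carrier_mat d n" and uni: "unimodular A" and J: "finite J" and g: "g ` J \<subseteq> {..<n}"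
  defines "a \<equiv> \<lambda>j. mat_col A (g j)"
  shows "inverse_system {..<d} (gr_ideal {..<d} (int_point ` zlat J a))
    = {\<Sum>S\<in>Pow J. const_poly (c S) * linform_prod {..<d} a S | c. True}" (is "?V = ?P")
proof
  show "?V \<subseteq> ?P"
  proof
    fix f assume f: "f \<in> ?V"
    have supp: "a j i = 0" if "i \<notin> {..<d}" for j i
      using that A by (simp add: a_def mat_col_def)
    have ex: "\<exists>c. hcomp k f = (\<Sum>S\<in>{S \<in> Pow J. card S = k}. const_poly (c S) * linform_prod {..<d} a S)" for k
    proof -
      obtain \<mu> where \<mu>: "keys \<mu> \<subseteq> zlat J a" "vanishes_to_order {..<d} k \<mu>" "moment_poly {..<d} k \<mu> = hcomp k f"
        using inverse_system_measure[OF J _ supp f, of k] by auto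
      obtain c where c: "\<mu> = (\<Sum>S\<in>{S. S \<subseteq> J \<and> k \<le> card S}. single 0 (c S) * aug_prod a S)"
        using unimodular_augmentation_filtration[OF A uni J g, of \<mu> k] \<mu> unfolding a_def by blast
      have "meval (hcomp k f) y
        = meval (\<Sum>S\<in>{S \<in> Pow J. card S = k}. const_poly (c S) * linform_prod {..<d} a S) y" for y
      proof -
        have "meval (hcomp k f) y
          = (\<Sum>S\<in>{S. S \<subseteq> J \<and> k \<le> card S}. c S * fps_nth (transform {..<d} y (aug_prod a S)) k)"
          unfolding \<mu>(3)[symmetric] by (subst c) (simp add: meval_moment_poly transform_lincomb)
        also have "\<dots> = (\<Sum>S\<in>{S \<in> Pow J. card S = k}. c S * (\<Prod>s\<in>S. pair {..<d} (a s) y))"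
        proof (rule sum.mono_neutral_cong_right)
          show "finite {S. S \<subseteq> J \<and> k \<le> card S}" using J by simp
          show "{S \<in> Pow J. card S = k} \<subseteq> {S. S \<subseteq> J \<and> k \<le> card S}" by auto
          show "\<forall>S\<in>{S. S \<subseteq> J \<and> k \<le> card S} - {S \<in> Pow J. card S = k}.
              c S * fps_nth (transform {..<d} y (aug_prod a S)) k = 0"
          proof
            fix S assume "S \<in> {S. S \<subseteq> J \<and> k \<le> card S} - {S \<in> Pow J. card S = k}"
            then have "finite S" "k < card S" using J finite_subset by auto
            then show "c S * fps_nth (transform {..<d} y (aug_prod a S)) k = 0"
              by (simp add: fps_nth_transform_aug_prod)
          qed
          fix S assume "S \<in> {S \<in> Pow J. card S = k}"
          then have "finite S" "k = card S" using J finite_subset by auto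
          then show "c S * fps_nth (transform {..<d} y (aug_prod a S)) k = c S * (\<Prod>s\<in>S. pair {..<d} (a s) y)"
            by (simp add: fps_nth_transform_aug_prod)
        qed
        also have "\<dots> = meval (\<Sum>S\<in>{S \<in> Pow J. card S = k}. const_poly (c S) * linform_prod {..<d} a S) y"
          by (simp add: meval_simps meval_linform_prod)
        finally show ?thesis .
      qed
      then have "hcomp k f = (\<Sum>S\<in>{S \<in> Pow J. card S = k}. const_poly (c S) * linform_prod {..<d} a S)"
        by (rule meval_eqI)
      then show ?thesis by (intro exI[of _ c])
    qed
    \<comment> \<open>The expansions in different degrees are unrelated; a set \<open>S\<close> will
      take its coefficient from degree \<open>card S\<close>.\<close>
    have "\<exists>c. \<forall>k. hcomp k f
        = (\<Sum>S\<in>{S \<in> Pow J. card S = k}. const_poly (c k S) * linform_prod {..<d} a S)"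
      by (rule choice, rule allI, rule ex)
    then obtain c where c: "\<And>k. hcomp k f
        = (\<Sum>S\<in>{S \<in> Pow J. card S = k}. const_poly (c k S) * linform_prod {..<d} a S)"
      by blast
    obtain N0 where N0: "\<And>m. m \<in> keys f \<Longrightarrow> mdeg m < N0" using mdeg_bound by blast
    \<comment> \<open>Beyond both the degree of \<open>f\<close> and \<open>card J\<close>, so that
      grouping by cardinality exhausts \<open>Pow J\<close>.\<close>
    define N where "N = max N0 (Suc (card J))"
    have "f = (\<Sum>k<N. hcomp k f)" using N0 by (intro sum_hcomp) (auto simp: N_def less_max_iff_disj)
    also have "\<dots> = (\<Sum>k<N. \<Sum>S\<in>{S \<in> Pow J. card S = k}. const_poly (c (card S) S) * linform_prod {..<d} a S)"
      unfolding c by (intro sum.cong refl) auto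
    also have "\<dots> = (\<Sum>S\<in>Pow J. const_poly (c (card S) S) * linform_prod {..<d} a S)"
    proof (rule sum.group)
      show "card ` Pow J \<subseteq> {..<N}"
        using card_mono[OF J] by (auto simp: N_def less_max_iff_disj less_Suc_eq_le)
    qed (use J in auto)
    finally have "f = (\<Sum>S\<in>Pow J. const_poly (c (card S) S) * linform_prod {..<d} a S)" .
    then show "f \<in> ?P" by (intro CollectI exI[of _ "\<lambda>S. c (card S) S"] conjI TrueI)
  qed
  show "?P \<subseteq> ?V"
  proof clarify
    fix c
    have S: "linform_prod {..<d} a S \<in> ?V" if "S \<in> Pow J" for S
      using that J by (intro linform_prod_in_inverse_system) auto
    have "pairing G (\<Sum>S\<in>Pow J. const_poly (c S) * linform_prod {..<d} a S)
        = (\<Sum>S\<in>Pow J. c S * pairing G (linform_prod {..<d} a S))" for G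
      unfolding pairing_def lin_def lookup_sum const_poly_def lookup_single_0_mult sum_distrib_left
      by (subst sum.swap) (simp add: mult_ac)
    then show "(\<Sum>S\<in>Pow J. const_poly (c S) * linform_prod {..<d} a S) \<in> ?V"
      using S by (auto simp: inverse_system_def lookup_diffop_0 intro!: vars_in_sum vars_in_mult)
  qed
qed

section \<open>The harmonic algebra\<close>

text \<open>A coefficient in \<open>[0, m]\<close> is split into \<open>m\<close> equal parts in
  \<open>[0, 1]\<close>; conversely the coefficients of the \<open>m\<close> copies of a column add
  up.\<close>

lemma dil_zonotope_lattice_points_eq_zlat:
  assumes A: "A \<in> carrier_mat d n"
  shows "dil_zonotope_lattice_points A m = zlat ({..<n} \<times> {..<m}) (\<lambda>p. mat_col A (fst p))"
proof (intro equalityI subsetI)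
  fix z assume "z \<in> dil_zonotope_lattice_points A m"
  then obtain t where z0: "\<forall>i\<ge>d. z i = 0" and t: "\<forall>j<n. 0 \<le> t j \<and> t j \<le> real m"
    and z: "\<forall>i<d. real_of_int (z i) = (\<Sum>j<n. real_of_int (A $$ (i, j)) * t j)"
    using A by (auto simp: dil_zonotope_lattice_points_def)
  \<comment> \<open>For \<open>m = 0\<close> the division by \<open>real m\<close> is harmless
    because all coefficients are 0.\<close>
  have m0: "t j = 0" if "m = 0" "j < n" for j using t that by fastforce
  have "real_of_int (z i) = (\<Sum>p\<in>{..<n} \<times> {..<m}. t (fst p) / real m * real_of_int (mat_col A (fst p) i))" for i
  proof -
    have "(\<Sum>p\<in>{..<n} \<times> {..<m}. t (fst p) / real m * real_of_int (mat_col A (fst p) i))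
      = (\<Sum>j<n. \<Sum>r<m. t j / real m * real_of_int (mat_col A j i))"
      unfolding sum.cartesian_product by (intro sum.cong) auto
    also have "\<dots> = (\<Sum>j<n. real_of_int (mat_col A j i) * t j)"
      using m0 by (intro sum.cong) auto
    also have "\<dots> = real_of_int (z i)"
      using z z0 A by (cases "i < d") (auto simp: mat_col_def)
    finally show ?thesis by simp
  qed
  moreover have "\<forall>p\<in>{..<n} \<times> {..<m}. 0 \<le> t (fst p) / real m \<and> t (fst p) / real m \<le> 1"
    using t by (auto simp: divide_simps)
  ultimately show "z \<in> zlat ({..<n} \<times> {..<m}) (\<lambda>p. mat_col A (fst p))"
    unfolding zlat_def by (intro CollectI exI[of _ "\<lambda>p. t (fst p) / real m"] conjI allI)
next
  fix z assume "z \<in> zlat ({..<n} \<times> {..<m}) (\<lambda>p. mat_col A (fst p))"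
  then obtain t where t: "\<forall>p\<in>{..<n} \<times> {..<m}. 0 \<le> t p \<and> t p \<le> 1"
    and z: "\<And>i. real_of_int (z i) = (\<Sum>p\<in>{..<n} \<times> {..<m}. t p * real_of_int (mat_col A (fst p) i))"
    by (auto simp: zlat_def)
  define s where "s = (\<lambda>j. \<Sum>r<m. t (j, r))"
  have z': "real_of_int (z i) = (\<Sum>j<n. real_of_int (mat_col A j i) * s j)" for i
  proof -
    have "real_of_int (z i) = (\<Sum>j<n. \<Sum>r<m. t (j, r) * real_of_int (mat_col A j i))"
      unfolding z sum.cartesian_product by (intro sum.cong) auto
    then show ?thesis by (simp add: s_def sum_distrib_left mult_ac)
  qed
  have "real_of_int (z i) = 0" if "i \<ge> d" for i
    unfolding z' using A that by (simp add: mat_col_def)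
  moreover have "0 \<le> s j \<and> s j \<le> real m" if "j < n" for j
  proof -
    have "(\<Sum>r<m. t (j, r)) \<le> (\<Sum>r<m. 1)" using t that by (intro sum_mono) auto
    moreover have "0 \<le> (\<Sum>r<m. t (j, r))" using t that by (intro sum_nonneg) auto
    ultimately show ?thesis by (simp add: s_def)
  qed
  moreover have "real_of_int (z i) = (\<Sum>j<n. real_of_int (A $$ (i, j)) * s j)" if "i < d" for i
    unfolding z' using A that by (simp add: mat_col_def)
  ultimately show "z \<in> dil_zonotope_lattice_points A m"
    using A unfolding dil_zonotope_lattice_points_def by (intro CollectI conjI exI[of _ s]) auto
qed

section \<open>Substituting the column forms for the Segre coordinates\<close>

lemma embed_mono_superset:
  "finite V \<Longrightarrow> keys m \<subseteq> V \<Longrightarrow> embed_mono m = (\<Sum>i\<in>V. single (Some i) (lookup m i))"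
  unfolding embed_mono_def by (rule sum.mono_neutral_left) (auto simp: in_keys_iff)

lemma embed_mono_0: "embed_mono 0 = 0"
  by (simp add: embed_mono_def)

lemma embed_mono_add: "embed_mono (m + m') = embed_mono m + embed_mono m'"
proof -
  have "embed_mono (m + m') = (\<Sum>i\<in>keys m \<union> keys m'. single (Some i) (lookup (m + m') i))"
    by (intro embed_mono_superset) (simp_all add: Poly_Mapping.keys_add)
  then show ?thesis
    by (simp add: embed_mono_superset[of "keys m \<union> keys m'"] lookup_add single_add sum.distrib)
qed

lemma embed_eq_push: "embed f = push embed_mono f"
  by (simp add: embed_def push_def)

interpretation embed: linear_extension "single 0" "\<lambda>m. single (embed_mono m) (1::complex)"
  by (rule linear_extension_push) (simp_all add: embed_mono_0 embed_mono_add)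

lemmas embed_simps = embed.lin_simps[folded push_eq_lin embed_eq_push]

lemma embed_single: "embed (single m c) = single (embed_mono m) c"
  by (simp add: embed_def)

lemma embed_const: "embed (const_poly c) = const_poly c"
  by (simp add: const_poly_def embed_simps mult_single embed_mono_0)

lemma meval_embed: "meval (embed f) x = meval f (\<lambda>i. x (Some i))"
proof -
  have "meval (embed f) x = lin (\<lambda>c. c) (\<lambda>m. monom_val x (embed_mono m)) f"
    unfolding meval_eq_lin embed_eq_push by (rule meval.lin_push)
  also have "(\<lambda>m. monom_val x (embed_mono m)) = monom_val (\<lambda>i. x (Some i))"
    unfolding embed_mono_def monom_val_sum monom_val_single by (simp add: monom_val_def fun_eq_iff)
  finally show ?thesis by (simp add: meval_eq_lin)
qed

lemma x0pow_add: "x0pow (k + l) = x0pow k * x0pow l"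
  by (simp add: x0pow_def mult_single single_add)

lemma x0pow_0: "x0pow 0 = 1"
  by (simp add: x0pow_def)

lemma meval_x0pow: "meval (x0pow k) x = x None ^ k"
  by (simp add: x0pow_def meval_simps)

definition segre_form :: "int mat \<Rightarrow> nat set \<Rightarrow> nat option mpoly" where
  "segre_form A S = x0pow 1 * embed (linform_prod {..<dim_row A} (mat_col A) S)"

definition segre_map :: "int mat \<Rightarrow> nat set mpoly \<Rightarrow> nat option mpoly" where
  "segre_map A = lin const_poly (monom_val (segre_form A))"

interpretation segre_map: linear_extension const_poly "monom_val (segre_form A)" for A
  by standard (auto simp: const_poly_def single_add mult_single monom_val_add)

lemmas segre_map_simps = segre_map.lin_simps[folded segre_map_def]

lemma segre_map_const_mult: "segre_map A (const_poly c * p) = const_poly c * segre_map A p"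
  by (simp add: segre_map_simps const_poly_def)

abbreviation rep_linform_prod :: "int mat \<Rightarrow> (nat \<times> nat) set \<Rightarrow> nat mpoly" where
  "rep_linform_prod A \<equiv> linform_prod {..<dim_row A} (\<lambda>p. mat_col A (fst p))"

lemma V_dil_eq:
  assumes A: "A \<in> carrier_mat d n" and uni: "unimodular A"
  shows "V_dil A m = {\<Sum>T\<in>Pow ({..<n} \<times> {..<m}). const_poly (c T) * rep_linform_prod A T | c. True}"
proof -
  have ip: "(\<lambda>z i. complex_of_int (z i)) = int_point" by (simp add: int_point_def fun_eq_iff)
  have d: "dim_row A = d" using A by simp
  show ?thesis
    unfolding V_dil_def ip dil_zonotope_lattice_points_eq_zlat[OF A] d
    by (rule inverse_system_zonotope[OF A uni]) auto
qed

text \<open>The pair \<open>(j, r)\<close> records that the form of column \<open>j\<close> occurs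
  in the factor number \<open>r\<close>, so a column repeated in different factors is kept
  apart.\<close>

lemma prod_segre_form:
  assumes "\<And>r. r < k \<Longrightarrow> finite (S r)"
  shows "(\<Prod>r<k. segre_form A (S r)) = x0pow k * embed (rep_linform_prod A {(j, r). r < k \<and> j \<in> S r})"
  using assms
proof (induction k)
  case 0
  then show ?case by (simp add: x0pow_0 linform_prod_def embed_simps)
next
  case (Suc k)
  have split: "{(j, r). r < Suc k \<and> j \<in> S r} = {(j, r). r < k \<and> j \<in> S r} \<union> (\<lambda>j. (j, k)) ` S k"
    by (auto simp: less_Suc_eq)
  have "{(j, r). r < k \<and> j \<in> S r} = (\<lambda>(r, j). (j, r)) ` (SIGMA r:{..<k}. S r)" by auto
  moreover have "finite (SIGMA r:{..<k}. S r)"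
    using Suc.prems by (intro finite_SigmaI) auto
  ultimately have fin: "finite {(j, r). r < k \<and> j \<in> S r}"
    by (simp only: finite_imageI)
  have "rep_linform_prod A {(j, r). r < Suc k \<and> j \<in> S r}
    = rep_linform_prod A {(j, r). r < k \<and> j \<in> S r} * rep_linform_prod A ((\<lambda>j. (j, k)) ` S k)"
    unfolding linform_prod_def split using Suc.prems fin by (intro prod.union_disjoint) auto
  also have "rep_linform_prod A ((\<lambda>j. (j, k)) ` S k) = linform_prod {..<dim_row A} (mat_col A) (S k)"
    unfolding linform_prod_def by (subst prod.reindex) (auto simp: inj_on_def)
  finally show ?case
    using Suc x0pow_add[of k 1] by (simp add: segre_form_def embed_simps mult_ac)
qed

lemma monomial_eq_sum_single:
  "mdeg m = k \<Longrightarrow> \<exists>S. (\<forall>r<k. S r \<in> keys m) \<and> m = (\<Sum>r<k. single (S r) 1)"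
proof (induction k arbitrary: m)
  case 0
  have "m = 0"
  proof (rule poly_mapping_eqI)
    fix v
    show "lookup m v = lookup 0 v"
      using 0 member_le_sum[of v "keys m" "lookup m"] by (cases "v \<in> keys m") (auto simp: mdeg_def in_keys_iff)
  qed
  then show ?case by simp
next
  case (Suc k)
  then have "keys m \<noteq> {}" by (auto simp: mdeg_def)
  then obtain v where v: "v \<in> keys m" by blast
  define m' where "m' = m - single v 1"
  have m: "m = m' + single v 1"
    unfolding m'_def using v
    by (intro poly_mapping_eqI) (auto simp: lookup_add lookup_minus lookup_single when_def in_keys_iff)
  have "mdeg m' = k" using Suc.prems arg_cong[OF m, of mdeg] by (simp add: mdeg_add)
  then obtain S where S: "\<forall>r<k. S r \<in> keys m'" "m' = (\<Sum>r<k. single (S r) 1)" using Suc.IH by blast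
  have "keys m' \<subseteq> keys m" by (auto simp: m'_def in_keys_iff lookup_minus)
  moreover have "(\<Sum>r<k. single ((S(k := v)) r) 1) = m'"
    unfolding S(2) by (intro sum.cong) auto
  ultimately show ?case using S v m
    by (intro exI[of _ "S(k := v)"]) (auto simp: less_Suc_eq)
qed

section \<open>Closure properties and generation of the harmonic algebra\<close>

lemma V_dil_zero:
  assumes "A \<in> carrier_mat d n" "unimodular A"
  shows "0 \<in> V_dil A m"
  unfolding V_dil_eq[OF assms] by (intro CollectI exI[of _ "\<lambda>_. 0"]) (simp add: const_poly_def)

lemma V_dil_add:
  assumes A: "A \<in> carrier_mat d n" "unimodular A" and "f \<in> V_dil A m" "g \<in> V_dil A m"
  shows "f + g \<in> V_dil A m"
proof -
  obtain c c' where "f = (\<Sum>T\<in>Pow ({..<n} \<times> {..<m}). const_poly (c T) * rep_linform_prod A T)"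
    "g = (\<Sum>T\<in>Pow ({..<n} \<times> {..<m}). const_poly (c' T) * rep_linform_prod A T)"
    using assms(3,4) unfolding V_dil_eq[OF A] by blast
  then have "f + g = (\<Sum>T\<in>Pow ({..<n} \<times> {..<m}). const_poly (c T + c' T) * rep_linform_prod A T)"
    by (simp add: const_poly_def single_add distrib_right sum.distrib)
  then show ?thesis unfolding V_dil_eq[OF A] by (intro CollectI exI[of _ "\<lambda>T. c T + c' T"] conjI TrueI)
qed

lemma const_mult_linform_prod_in_V_dil:
  assumes A: "A \<in> carrier_mat d n" "unimodular A" and T: "T \<subseteq> {..<n} \<times> {..<m}"
  shows "const_poly c * rep_linform_prod A T \<in> V_dil A m"
proof -
  have "(\<Sum>T'\<in>Pow ({..<n} \<times> {..<m}). const_poly (if T' = T then c else 0) * rep_linform_prod A T')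
     = (\<Sum>T'\<in>Pow ({..<n} \<times> {..<m}). if T' = T then const_poly c * rep_linform_prod A T' else 0)"
    by (intro sum.cong) (auto simp: const_poly_def)
  also have "\<dots> = const_poly c * rep_linform_prod A T" using T by simp
  finally show ?thesis unfolding V_dil_eq[OF A]
    by (intro CollectI exI[of _ "\<lambda>T'. if T' = T then c else 0"]) simp
qed

lemma x0pow_embed_in_harmonic_algebra:
  assumes A: "A \<in> carrier_mat d n" "unimodular A" and f: "f \<in> V_dil A k"
  shows "x0pow k * embed f \<in> harmonic_algebra A"
proof -
  have "(\<Sum>m<Suc k. x0pow m * embed (if m = k then f else 0)) = (\<Sum>m<Suc k. if m = k then x0pow k * embed f else 0)"
    by (intro sum.cong) (auto simp: embed_simps)
  then have "x0pow k * embed f = (\<Sum>m<Suc k. x0pow m * embed (if m = k then f else 0))" by simp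
  moreover have "\<forall>m<Suc k. (if m = k then f else 0) \<in> V_dil A m" using f V_dil_zero[OF A] by auto
  ultimately show ?thesis
    unfolding harmonic_algebra_def by (intro CollectI exI[of _ "Suc k"] exI[of _ "\<lambda>m. if m = k then f else 0"] conjI)
qed

lemma harmonic_algebra_zero: "0 \<in> harmonic_algebra A"
  unfolding harmonic_algebra_def by (intro CollectI exI[of _ "0::nat"]) auto

lemma harmonic_algebra_add:
  assumes A: "A \<in> carrier_mat d n" "unimodular A" and F: "F \<in> harmonic_algebra A" and G: "G \<in> harmonic_algebra A"
  shows "F + G \<in> harmonic_algebra A"
proof -
  obtain N f where f: "F = (\<Sum>m<N. x0pow m * embed (f m))" "\<forall>m<N. f m \<in> V_dil A m"
    using F unfolding harmonic_algebra_def by blast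
  obtain N' g where g: "G = (\<Sum>m<N'. x0pow m * embed (g m))" "\<forall>m<N'. g m \<in> V_dil A m"
    using G unfolding harmonic_algebra_def by blast
  define f' where "f' = (\<lambda>m. if m < N then f m else 0)"
  define g' where "g' = (\<lambda>m. if m < N' then g m else 0)"
  have "F = (\<Sum>m<max N N'. x0pow m * embed (f' m))"
    unfolding f(1) f'_def by (intro sum.mono_neutral_cong_left) (auto simp: embed_simps)
  moreover have "G = (\<Sum>m<max N N'. x0pow m * embed (g' m))"
    unfolding g(1) g'_def by (intro sum.mono_neutral_cong_left) (auto simp: embed_simps)
  ultimately have "F + G = (\<Sum>m<max N N'. x0pow m * embed (f' m + g' m))"
    by (simp add: embed_simps distrib_left sum.distrib)
  moreover have "\<forall>m<max N N'. f' m + g' m \<in> V_dil A m"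
    using f(2) g(2) V_dil_zero[OF A] V_dil_add[OF A] by (auto simp: f'_def g'_def)
  ultimately show ?thesis
    unfolding harmonic_algebra_def
    by (intro CollectI exI[of _ "max N N'"] exI[of _ "\<lambda>m. f' m + g' m"] conjI)
qed

lemma harmonic_algebra_sum:
  assumes A: "A \<in> carrier_mat d n" "unimodular A" and "\<And>i. i \<in> I \<Longrightarrow> F i \<in> harmonic_algebra A"
  shows "(\<Sum>i\<in>I. F i) \<in> harmonic_algebra A"
  using assms(3)
  by (induction I rule: infinite_finite_induct) (auto intro: harmonic_algebra_zero harmonic_algebra_add[OF A])

lemma segre_map_in_harmonic_algebra:
  assumes A: "A \<in> carrier_mat d n" "unimodular A" and p: "vars_in (Pow {..<n}) p"
  shows "segre_map A p \<in> harmonic_algebra A"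
  unfolding segre_map_def lin_def
proof (rule harmonic_algebra_sum[OF A])
  fix m assume m: "m \<in> keys p"
  obtain S where S: "\<forall>r<mdeg m. S r \<in> keys m" "m = (\<Sum>r<mdeg m. single (S r) 1)"
    using monomial_eq_sum_single[of m] by blast
  define k where "k = mdeg m"
  define T where "T = {(j, r). r < k \<and> j \<in> S r}"
  have sub: "S r \<subseteq> {..<n}" if "r < k" for r
    using S(1) that m p by (auto simp: vars_in_def k_def)
  have "monom_val (segre_form A) m = (\<Prod>r<k. segre_form A (S r))"
    unfolding k_def by (subst S(2)) (simp add: monom_val_sum)
  also have "\<dots> = x0pow k * embed (rep_linform_prod A T)"
    unfolding T_def using finite_subset[OF sub finite_lessThan] by (intro prod_segre_form)
  finally have "const_poly (lookup p m) * monom_val (segre_form A) m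
    = x0pow k * embed (const_poly (lookup p m) * rep_linform_prod A T)"
    by (simp add: embed_simps embed_const mult_ac)
  moreover have "T \<subseteq> {..<n} \<times> {..<k}" using sub by (auto simp: T_def)
  ultimately show "const_poly (lookup p m) * monom_val (segre_form A) m \<in> harmonic_algebra A"
    by (simp only: x0pow_embed_in_harmonic_algebra[OF A const_mult_linform_prod_in_V_dil[OF A]])
qed

text \<open>A set of pairs is cut into its \<open>k\<close> slices, each a set of columns and hence
  a variable \<open>z_S\<close>. Empty slices are kept: they contribute plain factors
  \<open>x_0\<close> and bring the degree up to \<open>k\<close>.\<close>

lemma harmonic_algebra_subset_segre_map:
  assumes A: "A \<in> carrier_mat d n" "unimodular A"
  shows "harmonic_algebra A \<subseteq> segre_map A ` {p. vars_in (Pow {..<n}) p}"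
proof
  fix F assume "F \<in> harmonic_algebra A"
  then obtain N f where F: "F = (\<Sum>m<N. x0pow m * embed (f m))" and f: "\<And>m. m < N \<Longrightarrow> f m \<in> V_dil A m"
    unfolding harmonic_algebra_def by blast
  have "\<exists>q. vars_in (Pow {..<n}) q \<and> segre_map A q = x0pow k * embed (f k)" if k: "k < N" for k
  proof -
    obtain c where c: "f k = (\<Sum>T\<in>Pow ({..<n} \<times> {..<k}). const_poly (c T) * rep_linform_prod A T)"
      using f[OF k] unfolding V_dil_eq[OF A] by blast
    define slice where "slice = (\<lambda>T r. {j. (j, r) \<in> (T :: (nat \<times> nat) set)})"
    define q where "q = (\<Sum>T\<in>Pow ({..<n} \<times> {..<k}).
        const_poly (c T) * (\<Prod>r<k. single (single (slice T r) 1) 1))"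
    have slice: "slice T r \<subseteq> {..<n}" "{(j, r). r < k \<and> j \<in> slice T r} = T"
      if "T \<in> Pow ({..<n} \<times> {..<k})" for T r
      using that by (auto simp: slice_def)
    have "vars_in (Pow {..<n}) q"
      unfolding q_def using slice(1)
      by (intro vars_in_sum vars_in_mult vars_in_const vars_in_prod vars_in_single) auto
    moreover have "segre_map A q = (\<Sum>T\<in>Pow ({..<n} \<times> {..<k}).
        const_poly (c T) * (x0pow k * embed (rep_linform_prod A T)))"
    proof -
      have "segre_map A (\<Prod>r<k. single (single (slice T r) 1) 1) = x0pow k * embed (rep_linform_prod A T)"
        if T: "T \<in> Pow ({..<n} \<times> {..<k})" for T
      proof -
        have "segre_map A (\<Prod>r<k. single (single (slice T r) 1) 1) = (\<Prod>r<k. segre_form A (slice T r))"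
          by (simp add: segre_map_simps segre_map.s_1)
        also have "\<dots> = x0pow k * embed (rep_linform_prod A {(j, r). r < k \<and> j \<in> slice T r})"
          using finite_subset[OF slice(1)[OF T] finite_lessThan] by (intro prod_segre_form)
        finally show ?thesis using slice(2)[OF T] by simp
      qed
      then show ?thesis
        by (simp add: q_def segre_map.lin_sum[folded segre_map_def] segre_map_const_mult)
    qed
    then have "segre_map A q = x0pow k * embed (f k)"
      by (simp add: c embed_simps embed_const sum_distrib_left mult_ac)
    ultimately show ?thesis by blast
  qed
  then obtain q where q: "\<And>k. k < N \<Longrightarrow> vars_in (Pow {..<n}) (q k) \<and> segre_map A (q k) = x0pow k * embed (f k)"
    by metis
  have "segre_map A (\<Sum>k<N. q k) = F"
    using q by (simp add: F segre_map_simps)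
  moreover have "vars_in (Pow {..<n}) (\<Sum>k<N. q k)" using q by (intro vars_in_sum) auto
  ultimately show "F \<in> segre_map A ` {p. vars_in (Pow {..<n}) p}" by blast
qed

section \<open>The ideal of the arrangement Schubert variety\<close>

lemma meval_cong:
  assumes "vars_in V p" "\<And>v. v \<in> V \<Longrightarrow> x v = y v"
  shows "meval p x = meval p y"
  unfolding meval_def
  using assms by (intro sum.cong refl arg_cong[of _ _ "\<lambda>u. _ * u"] prod.cong) (auto simp: vars_in_def subset_iff)

lemma meval_segre_map: "meval (segre_map A p) x = meval p (\<lambda>S. meval (segre_form A S) x)"
proof -
  have "meval (monom_val (segre_form A) m) x = monom_val (\<lambda>S. meval (segre_form A S) x) m" for m
    by (simp add: monom_val_def meval_simps)
  then show ?thesis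
    by (simp add: segre_map_def lin_def meval_simps meval_eq_lin[of p])
qed

lemma meval_segre_form:
  "meval (segre_form A S) x = x None * (\<Prod>j\<in>S. \<Sum>i<dim_row A. x (Some i) * complex_of_int (A $$ (i, j)))"
  by (simp add: segre_form_def meval_simps meval_x0pow meval_embed meval_linform_prod pair_def mat_col_def mult.commute)

text \<open>The values of \<open>segre_map A p\<close> are those of \<open>p\<close> on the cone,
  with \<open>None\<close> supplying the scalar and \<open>Some i\<close> the coordinates of the row
  combination; a complex polynomial with all values 0 is zero.\<close>

lemma segre_map_eq_0_iff:
  assumes A: "A \<in> carrier_mat d n" and p: "vars_in (Pow {..<n}) p"
  shows "segre_map A p = 0 \<longleftrightarrow> (\<forall>w\<in>segre_cone A. meval p w = 0)"
proof -
  define pt where "pt = (\<lambda>(x :: nat option \<Rightarrow> complex) S. if S \<subseteq> {..<n}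
      then x None * (\<Prod>j\<in>S. \<Sum>i<d. x (Some i) * complex_of_int (A $$ (i, j))) else 0)"
  have cone: "segre_cone A = range pt"
  proof (intro equalityI subsetI)
    fix w assume "w \<in> segre_cone A"
    then obtain c y where "w = (\<lambda>S. if S \<subseteq> {..<n} then c * (\<Prod>j\<in>S. \<Sum>i<d. y i * complex_of_int (A $$ (i, j))) else 0)"
      using A by (auto simp: segre_cone_def)
    then have "w = pt (\<lambda>v. if v = None then c else y (the v))"
      by (auto simp: pt_def fun_eq_iff)
    then show "w \<in> range pt" by blast
  next
    fix w assume "w \<in> range pt"
    then obtain x where "w = pt x" by blast
    then show "w \<in> segre_cone A"
      unfolding segre_cone_def using A
      by (intro CollectI exI[of _ "x None"] exI[of _ "\<lambda>i. x (Some i)"])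
         (auto simp: pt_def fun_eq_iff)
  qed
  have "meval (segre_map A p) x = meval p (pt x)" for x
    unfolding meval_segre_map using p
    by (rule meval_cong) (use A in \<open>auto simp: meval_segre_form pt_def\<close>)
  then show ?thesis
    unfolding cone using meval_eq_0_imp[of "segre_map A p"] by (auto simp: meval_simps)
qed

lemma meval_scale_homogeneous:
  assumes "homogeneous k p"
  shows "meval p (\<lambda>v. t * x v) = t ^ k * meval p x"
proof -
  have "monom_val (\<lambda>v. t * x v) m = t ^ k * monom_val x m" if "m \<in> keys p" for m
  proof -
    have "monom_val (\<lambda>_. t) m = t ^ mdeg m" by (simp add: monom_val_def mdeg_def power_sum)
    then show ?thesis using assms that by (simp add: monom_val_mult homogeneous_def)
  qed
  then show ?thesis by (simp add: meval_eq_lin lin_def sum_distrib_left mult_ac)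
qed

lemma segre_cone_scale: "w \<in> segre_cone A \<Longrightarrow> (\<lambda>S. t * w S) \<in> segre_cone A"
proof -
  assume "w \<in> segre_cone A"
  then obtain c y where w: "w = (\<lambda>S. if S \<subseteq> {..<dim_col A}
          then c * (\<Prod>j\<in>S. \<Sum>i<dim_row A. y i * complex_of_int (A $$ (i,j))) else 0)"
    unfolding segre_cone_def by blast
  show ?thesis
    unfolding segre_cone_def by (intro CollectI exI[of _ "t * c"] exI[of _ y]) (auto simp: w fun_eq_iff)
qed

text \<open>The cone is stable under scaling, so along the multiples \<open>t * w\<close> the values
  of \<open>p\<close> form a polynomial in \<open>t\<close> that is identically zero; its
  coefficients are the values of the components at \<open>w\<close>.\<close>

lemma hcomp_vanishes_on_cone:
  assumes "\<forall>w\<in>segre_cone A. meval p w = 0" "w \<in> segre_cone A"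
  shows "meval (hcomp k p) w = 0"
proof -
  obtain N where N: "\<And>m. m \<in> keys p \<Longrightarrow> mdeg m < N" using mdeg_bound by blast
  have "(\<Sum>i\<le>N. meval (hcomp i p) w * t ^ i) = 0" for t
  proof -
    have "p = (\<Sum>i<Suc N. hcomp i p)" using N by (intro sum_hcomp) (auto intro: less_SucI)
    then have "meval p (\<lambda>S. t * w S) = meval (\<Sum>i<Suc N. hcomp i p) (\<lambda>S. t * w S)" by (rule arg_cong)
    also have "\<dots> = (\<Sum>i\<le>N. meval (hcomp i p) w * t ^ i)"
      by (simp add: meval_simps meval_scale_homogeneous[OF homogeneous_hcomp] lessThan_Suc_atMost mult.commute)
    finally show ?thesis using assms segre_cone_scale by metis
  qed
  then have zero: "\<forall>i\<le>N. meval (hcomp i p) w = 0" using polyfun_eq_0[of "\<lambda>i. meval (hcomp i p) w" N] by blast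
  show ?thesis
  proof (cases "k \<le> N")
    case False
    then have "keys (hcomp k p) = {}" using N by (fastforce simp: keys_hcomp)
    then show ?thesis by (simp add: meval_simps)
  qed (use zero in auto)
qed

lemma closed_zero_set:
  fixes F :: "'v mpoly"
  shows "closed {w. meval F w = 0}"
proof -
  have "continuous_on UNIV (\<lambda>w :: 'v \<Rightarrow> complex. meval F w)"
    unfolding meval_def by (intro continuous_intros continuous_on_product_coordinates)
  then show ?thesis by (intro closed_Collect_eq continuous_on_const)
qed

text \<open>The kernel is described by vanishing on the chart, the ideal by homogeneous generators
  vanishing on the closure. Splitting into components and continuity lead from the former to the
  latter.\<close>

lemma segre_map_kernel:
  assumes A: "A \<in> carrier_mat d n"
  shows "{p. vars_in (Pow {..<n}) p \<and> segre_map A p = 0} = segre_schubert_ideal A"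
proof (intro equalityI subsetI)
  have n: "dim_col A = n" using A by simp
  {
    fix p assume "p \<in> {p. vars_in (Pow {..<n}) p \<and> segre_map A p = 0}"
    then have p: "vars_in (Pow {..<n}) p" "\<forall>w\<in>segre_cone A. meval p w = 0"
      using segre_map_eq_0_iff[OF A] by auto
    obtain N where N: "\<And>m. m \<in> keys p \<Longrightarrow> mdeg m < N" using mdeg_bound by blast
    have "(\<Sum>k<N. hcomp k p) \<in> segre_schubert_ideal A"
      unfolding segre_schubert_ideal_def n
    proof (intro ideal_gen_sum CollectI conjI ballI)
      fix k w assume w: "w \<in> closure (segre_cone A)"
      have "segre_cone A \<subseteq> {w. meval (hcomp k p) w = 0}" using hcomp_vanishes_on_cone[OF p(2)] by blast
      then have "closure (segre_cone A) \<subseteq> {w. meval (hcomp k p) w = 0}"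
        by (rule closure_minimal) (rule closed_zero_set)
      then show "meval (hcomp k p) w = 0" using w by blast
    qed (use p(1) homogeneous_hcomp vars_in_hcomp in blast)+
    then show "p \<in> segre_schubert_ideal A" using sum_hcomp[of p N, OF N] by simp
  next
    fix p assume "p \<in> segre_schubert_ideal A"
    then obtain k :: nat and h g where p: "p = (\<Sum>i<k. h i * g i)"
      and hg: "\<And>i. i < k \<Longrightarrow> vars_in (Pow {..<n}) (h i) \<and> vars_in (Pow {..<n}) (g i)
        \<and> (\<forall>w\<in>closure (segre_cone A). meval (g i) w = 0)"
      unfolding segre_schubert_ideal_def ideal_gen_def n by blast
    have "segre_map A (g i) = 0" if "i < k" for i
      using hg[OF that] segre_map_eq_0_iff[OF A, of "g i"] closure_subset[of "segre_cone A"] by blast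
    then have "segre_map A p = 0" by (simp add: p segre_map_simps)
    moreover have "vars_in (Pow {..<n}) p" unfolding p using hg by (intro vars_in_sum vars_in_mult) auto
    ultimately show "p \<in> {p. vars_in (Pow {..<n}) p \<and> segre_map A p = 0}" by blast
  }
qed

section \<open>The bigrading\<close>

definition xdeg :: "(nat option \<Rightarrow>\<^sub>0 nat) \<Rightarrow> nat" where
  "xdeg m = (\<Sum>v\<in>keys m - {None}. lookup m v)"

lemma xdeg_superset: "finite V \<Longrightarrow> keys m \<subseteq> V \<Longrightarrow> xdeg m = (\<Sum>v\<in>V - {None}. lookup m v)"
  unfolding xdeg_def by (rule sum.mono_neutral_left) (auto simp: in_keys_iff)

lemma xdeg_add: "xdeg (m + m') = xdeg m + xdeg m'"
proof -
  have "xdeg (m + m') = (\<Sum>v\<in>keys m \<union> keys m' - {None}. lookup (m + m') v)"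
    by (intro xdeg_superset) (simp_all add: Poly_Mapping.keys_add)
  then show ?thesis
    by (simp add: xdeg_superset[of "keys m \<union> keys m'"] lookup_add sum.distrib)
qed

lemma bihomog_x_iff: "bihomog_x a b F \<longleftrightarrow> (\<forall>m\<in>keys F. lookup m None = a \<and> xdeg m = b)"
  by (simp add: bihomog_x_def xdeg_def)

lemma bihomog_x_mult:
  assumes "bihomog_x a b F" "bihomog_x a' b' G"
  shows "bihomog_x (a + a') (b + b') (F * G)"
  unfolding bihomog_x_iff
proof
  fix m assume "m \<in> keys (F * G)"
  then obtain u v where "u \<in> keys F" "v \<in> keys G" "m = u + v" using keys_mult[of F G] by blast
  then show "lookup m None = a + a' \<and> xdeg m = b + b'"
    using assms by (simp add: bihomog_x_iff lookup_add xdeg_add)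
qed

lemma bihomog_x_const: "bihomog_x 0 0 (const_poly c)"
  by (simp add: bihomog_x_iff const_poly_def xdeg_def)

lemma bihomog_x_one: "bihomog_x 0 0 1"
  by (simp add: bihomog_x_iff xdeg_def)

lemma bihomog_x_sum: "(\<And>i. i \<in> I \<Longrightarrow> bihomog_x a b (F i)) \<Longrightarrow> bihomog_x a b (\<Sum>i\<in>I. F i)"
  using keys_sum_subset[of F I] by (fastforce simp: bihomog_x_iff)

lemma bihomog_x_prod:
  "(\<And>i. i \<in> I \<Longrightarrow> bihomog_x (a i) (b i) (F i)) \<Longrightarrow> bihomog_x (\<Sum>i\<in>I. a i) (\<Sum>i\<in>I. b i) (\<Prod>i\<in>I. F i)"
  by (induction I rule: infinite_finite_induct) (auto intro: bihomog_x_mult bihomog_x_one)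

lemma bihomog_x_power: "bihomog_x a b F \<Longrightarrow> bihomog_x (k * a) (k * b) (F ^ k)"
  by (induction k) (auto intro: bihomog_x_mult bihomog_x_one)

lemma bihomog_x_segre_form: "bihomog_x 1 (card S) (segre_form A S)"
proof -
  have "bihomog_x 0 1 (embed (linform {..<dim_row A} (mat_col A j)))" for j
    unfolding linform_def embed.lin_sum[folded push_eq_lin embed_eq_push] embed_single
    by (intro bihomog_x_sum) (auto simp: embed_mono_def bihomog_x_iff lookup_single xdeg_def)
  then have "bihomog_x (\<Sum>j\<in>S. 0) (\<Sum>j\<in>S. 1) (embed (linform_prod {..<dim_row A} (mat_col A) S))"
    unfolding linform_prod_def embed_simps by (intro bihomog_x_prod)
  moreover have "bihomog_x 1 0 (x0pow 1)"
    by (simp add: x0pow_def bihomog_x_iff xdeg_def)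
  ultimately have "bihomog_x (1 + 0) (0 + card S) (segre_form A S)"
    unfolding segre_form_def by (intro bihomog_x_mult) simp_all
  then show ?thesis by simp
qed

lemma bihomog_x_segre_map:
  assumes "bihomog_z a b p"
  shows "bihomog_x a b (segre_map A p)"
  unfolding segre_map_def lin_def
proof (rule bihomog_x_sum)
  fix m assume m: "m \<in> keys p"
  have "bihomog_x (\<Sum>S\<in>keys m. lookup m S * 1) (\<Sum>S\<in>keys m. lookup m S * card S) (monom_val (segre_form A) m)"
    unfolding monom_val_def by (intro bihomog_x_prod bihomog_x_power bihomog_x_segre_form)
  then have "bihomog_x a b (monom_val (segre_form A) m)"
    using assms m by (simp add: bihomog_z_def)
  then have "bihomog_x (0 + a) (0 + b) (const_poly (lookup p m) * monom_val (segre_form A) m)"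
    by (intro bihomog_x_mult bihomog_x_const)
  then show "bihomog_x a b (const_poly (lookup p m) * monom_val (segre_form A) m)" by simp
qed

text \<open>The quotient ring is not formed: a surjective algebra homomorphism with the prescribed
  kernel that respects bidegrees induces the bigraded isomorphism.\<close>

theorem theorem1p4:
  fixes A :: "int mat" and d n :: nat
  assumes "A \<in> carrier_mat d n" and "unimodular A"
  shows "\<exists>\<phi> :: nat set mpoly \<Rightarrow> nat option mpoly.
    (\<forall>p. vars_in (Pow {..<n}) p \<longrightarrow> \<phi> p \<in> harmonic_algebra A) \<and>
    (\<forall>p q. vars_in (Pow {..<n}) p \<longrightarrow> vars_in (Pow {..<n}) q \<longrightarrow>
        \<phi> (p + q) = \<phi> p + \<phi> q \<and> \<phi> (p * q) = \<phi> p * \<phi> q) \<and>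
    (\<forall>c p. vars_in (Pow {..<n}) p \<longrightarrow> \<phi> (const_poly c * p) = const_poly c * \<phi> p) \<and>
    \<phi> 1 = 1 \<and>
    harmonic_algebra A \<subseteq> \<phi> ` {p. vars_in (Pow {..<n}) p} \<and>
    {p. vars_in (Pow {..<n}) p \<and> \<phi> p = 0} = segre_schubert_ideal A \<and>
    (\<forall>a b p. vars_in (Pow {..<n}) p \<longrightarrow> bihomog_z a b p \<longrightarrow> bihomog_x a b (\<phi> p))"
proof (intro exI[of _ "segre_map A"] conjI allI impI)
  show "segre_map A p \<in> harmonic_algebra A" if "vars_in (Pow {..<n}) p" for p
    by (rule segre_map_in_harmonic_algebra[OF assms that])
  show "harmonic_algebra A \<subseteq> segre_map A ` {p. vars_in (Pow {..<n}) p}"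
    by (rule harmonic_algebra_subset_segre_map[OF assms])
  show "{p. vars_in (Pow {..<n}) p \<and> segre_map A p = 0} = segre_schubert_ideal A"
    by (rule segre_map_kernel[OF assms(1)])
  show "segre_map A (const_poly c * p) = const_poly c * segre_map A p" for c p
    by (rule segre_map_const_mult)
qed (simp_all add: segre_map_simps bihomog_x_segre_map)

end
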